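(* Let $(R,m)$ be a noetherian local complete domain containing a field $k$, and let $\underline{x}=x_1,\dots,x_i$ be a sequence of elements of $m$. Let $R_0:=k[[x_1,\dots,x_i]]\subseteq R$, let $Q(R_0)$ and $Q(R)$ denote the quotient fields of $R_0$ and $R$. If $H^i_{\underline{x}R}(R)\neq 0$, then $$\dim(R_0)=i\quad\text{and}\quad R\cap Q(R_0)=R_0,$$ where the intersection is taken inside $Q(R)$.
   Context: $H^n_I(M)$ denotes the $n$-th local cohomology module of an $R$-module $M$ with respect to an ideal $I$, and $\underline{x}R$ denotes the ideal $(x_1,\dots,x_i)R$. The subring $R_0=k[[x_1,\dots,x_i]]$ of $R$ is the image of the $k$-algebra homomorphism $k[[X_1,\dots,X_i]]\to R$ from the formal power series ring in $i$ indeterminates which sends a power series $f(X_1,\dots,X_i)$ to its value $f(x_1,\dots,x_i)$ (which converges in the complete local ring $R$). $\dim$ denotes Krull dimension. *)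

theory Defs
  imports "HOL-Algebra.Algebra" "HOL-Library.Extended_Nat"
begin

section \<open>Modules and homomorphisms\<close>

definition module_hom ::
  "('a, 'r) ring_scheme \<Rightarrow> ('a, 'b, 'm) module_scheme \<Rightarrow> ('a, 'c, 'n) module_scheme \<Rightarrow> ('b \<Rightarrow> 'c) set"
  where "module_hom R M N =
    {f. f \<in> carrier M \<rightarrow> carrier N \<and>
        (\<forall>x\<in>carrier M. \<forall>y\<in>carrier M. f (x \<oplus>\<^bsub>M\<^esub> y) = f x \<oplus>\<^bsub>N\<^esub> f y) \<and>
        (\<forall>a\<in>carrier R. \<forall>x\<in>carrier M. f (a \<odot>\<^bsub>M\<^esub> x) = a \<odot>\<^bsub>N\<^esub> f x)}"

definition ring_module :: "('a, 'r) ring_scheme \<Rightarrow> ('a, 'a) module"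
  where "ring_module R =
    \<lparr>carrier = carrier R, monoid.mult = (\<otimes>\<^bsub>R\<^esub>), one = \<one>\<^bsub>R\<^esub>, ring.zero = \<zero>\<^bsub>R\<^esub>,
     ring.add = (\<oplus>\<^bsub>R\<^esub>), smult = (\<otimes>\<^bsub>R\<^esub>)\<rparr>"

text \<open>
  The record type of modules extends that of rings, but the locale \<open>module\<close> does not look at
  the fields \<open>mult\<close> and \<open>one\<close>; they carry no information here.
\<close>

definition quotient_module ::
  "('a, 'b, 'm) module_scheme \<Rightarrow> 'b set \<Rightarrow> ('a, 'b set) module"
  where "quotient_module M N =
    \<lparr>carrier = a_rcosets\<^bsub>M\<^esub> N, monoid.mult = undefined, one = undefined, ring.zero = N, ring.add = set_add M,
     smult = (\<lambda>a C. \<Union>c\<in>C. N +>\<^bsub>M\<^esub> (a \<odot>\<^bsub>M\<^esub> c))\<rparr>"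

text \<open>
  A definition in HOL can only quantify over test modules whose elements lie in a fixed type.
  The element type of the ring is large enough: the ideals of the ring, and the ring itself, are
  such modules, so by Baer's criterion the lifting property for these test modules implies the
  lifting property for all monomorphisms of \<open>R\<close>-modules, of any element type.
\<close>

definition injective_module ::
  "('a, 'r) ring_scheme \<Rightarrow> ('a, 'e, 'm) module_scheme \<Rightarrow> bool"
  where "injective_module R E \<longleftrightarrow> module R E \<and>
    (\<forall>(M :: ('a, 'a) module) (N :: ('a, 'a) module) j f.
       module R M \<and> module R N \<and> j \<in> module_hom R M N \<and> inj_on j (carrier M) \<and>
       f \<in> module_hom R M E \<longrightarrow>
       (\<exists>g\<in>module_hom R N E. \<forall>x\<in>carrier M. g (j x) = f x))"


section \<open>Local cohomology\<close>

text \<open>The differential of a cochain complex \<open>C\<close> in degree \<open>n\<close> is \<open>d n : C n \<rightarrow> C (n + 1)\<close>.\<close>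

definition cocycles :: "(nat \<Rightarrow> ('a, 'e, 'm) module_scheme) \<Rightarrow> (nat \<Rightarrow> 'e \<Rightarrow> 'e) \<Rightarrow> nat \<Rightarrow> 'e set"
  where "cocycles C d n = {c \<in> carrier (C n). d n c = \<zero>\<^bsub>C (Suc n)\<^esub>}"

definition coboundaries :: "(nat \<Rightarrow> ('a, 'e, 'm) module_scheme) \<Rightarrow> (nat \<Rightarrow> 'e \<Rightarrow> 'e) \<Rightarrow> nat \<Rightarrow> 'e set"
  where "coboundaries C d n =
    (case n of 0 \<Rightarrow> {\<zero>\<^bsub>C 0\<^esub>} | Suc j \<Rightarrow> d j ` carrier (C j))"

definition cohomology ::
  "(nat \<Rightarrow> ('a, 'e, 'm) module_scheme) \<Rightarrow> (nat \<Rightarrow> 'e \<Rightarrow> 'e) \<Rightarrow> nat \<Rightarrow> ('a, 'e set) module"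
  where "cohomology C d n =
    quotient_module ((C n)\<lparr>carrier := cocycles C d n\<rparr>) (coboundaries C d n)"

text \<open>
  \<open>0 \<rightarrow> M \<rightarrow> E 0 \<rightarrow> E 1 \<rightarrow> \<dots>\<close> is exact, with augmentation \<open>\<epsilon>\<close> and differentials \<open>d\<close>,
  and all \<open>E n\<close> are injective.
\<close>

definition injective_resolution ::
  "('a, 'r) ring_scheme \<Rightarrow> ('a, 'b, 'm) module_scheme \<Rightarrow>
   (nat \<Rightarrow> ('a, 'e, 'n) module_scheme) \<Rightarrow> ('b \<Rightarrow> 'e) \<Rightarrow> (nat \<Rightarrow> 'e \<Rightarrow> 'e) \<Rightarrow> bool"
  where "injective_resolution R M E \<epsilon> d \<longleftrightarrow>
    (\<forall>n. injective_module R (E n)) \<and>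
    (\<forall>n. d n \<in> module_hom R (E n) (E (Suc n))) \<and>
    \<epsilon> \<in> module_hom R M (E 0) \<and> inj_on \<epsilon> (carrier M) \<and>
    \<epsilon> ` carrier M = cocycles E d 0 \<and>
    (\<forall>n. d n ` carrier (E n) = cocycles E d (Suc n))"

abbreviation ideal_power :: "('a, 'r) ring_scheme \<Rightarrow> 'a set \<Rightarrow> nat \<Rightarrow> 'a set"
  where "ideal_power R I n \<equiv> I [^]\<^bsub>ideals_set R\<^esub> n"

text \<open>The \<open>I\<close>-torsion functor \<open>\<Gamma>\<^sub>I\<close>; on homomorphisms it is restriction.\<close>

definition torsion_module ::
  "('a, 'r) ring_scheme \<Rightarrow> 'a set \<Rightarrow> ('a, 'e, 'm) module_scheme \<Rightarrow> ('a, 'e, 'm) module_scheme"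
  where "torsion_module R I M =
    M\<lparr>carrier := {x \<in> carrier M. \<exists>n. \<forall>a\<in>ideal_power R I n. a \<odot>\<^bsub>M\<^esub> x = \<zero>\<^bsub>M\<^esub>}\<rparr>"

text \<open>
  Local cohomology \<open>H\<^sup>n\<^sub>I(M)\<close> is the \<open>n\<close>-th right derived functor of \<open>\<Gamma>\<^sub>I\<close>, computed
  from an injective resolution \<open>(E, d)\<close> of \<open>M\<close>; up to isomorphism it does not depend on the
  resolution.
\<close>

definition local_cohomology ::
  "('a, 'r) ring_scheme \<Rightarrow> 'a set \<Rightarrow> (nat \<Rightarrow> ('a, 'e, 'm) module_scheme) \<Rightarrow> (nat \<Rightarrow> 'e \<Rightarrow> 'e) \<Rightarrow>
   nat \<Rightarrow> ('a, 'e set) module"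
  where "local_cohomology R I E d n = cohomology (\<lambda>j. torsion_module R I (E j)) d n"


section \<open>Complete local rings\<close>

definition local_ring :: "('a, 'r) ring_scheme \<Rightarrow> 'a set \<Rightarrow> bool"
  where "local_ring R \<mm> \<longleftrightarrow> cring R \<and> maximalideal \<mm> R \<and> (\<forall>J. maximalideal J R \<longrightarrow> J = \<mm>)"

definition adic_limit :: "('a, 'r) ring_scheme \<Rightarrow> 'a set \<Rightarrow> (nat \<Rightarrow> 'a) \<Rightarrow> 'a \<Rightarrow> bool"
  where "adic_limit R I s r \<longleftrightarrow>
    (\<forall>N. \<exists>n\<^sub>0. \<forall>n\<ge>n\<^sub>0. s n \<ominus>\<^bsub>R\<^esub> r \<in> ideal_power R I N)"

definition adic_Cauchy :: "('a, 'r) ring_scheme \<Rightarrow> 'a set \<Rightarrow> (nat \<Rightarrow> 'a) \<Rightarrow> bool"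
  where "adic_Cauchy R I s \<longleftrightarrow>
    (\<forall>N. \<exists>n\<^sub>0. \<forall>p\<ge>n\<^sub>0. \<forall>q\<ge>n\<^sub>0. s p \<ominus>\<^bsub>R\<^esub> s q \<in> ideal_power R I N)"

definition adic_complete :: "('a, 'r) ring_scheme \<Rightarrow> 'a set \<Rightarrow> bool"
  where "adic_complete R I \<longleftrightarrow>
    (\<Inter>N. ideal_power R I N) = {\<zero>\<^bsub>R\<^esub>} \<and>
    (\<forall>s. range s \<subseteq> carrier R \<and> adic_Cauchy R I s \<longrightarrow> (\<exists>r\<in>carrier R. adic_limit R I s r))"


section \<open>The subring of power series in given elements\<close>

definition exponents :: "nat \<Rightarrow> (nat \<Rightarrow> nat) set"
  where "exponents i = {..<i} \<rightarrow>\<^sub>E UNIV"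

definition monomial_value :: "('a, 'r) ring_scheme \<Rightarrow> nat \<Rightarrow> (nat \<Rightarrow> 'a) \<Rightarrow> (nat \<Rightarrow> nat) \<Rightarrow> 'a"
  where "monomial_value R i x \<nu> = (\<Otimes>\<^bsub>R\<^esub>j\<in>{..<i}. x j [^]\<^bsub>R\<^esub> \<nu> j)"

text \<open>
  A formal power series in \<open>i\<close> indeterminates is its coefficient function \<open>f\<close> on \<open>exponents i\<close>.
  \<open>truncation_value R i x f N\<close> is the value at \<open>x\<close> of the part of \<open>f\<close> of total degree
  less than \<open>N\<close>.
\<close>

definition truncation_value ::
  "('a, 'r) ring_scheme \<Rightarrow> nat \<Rightarrow> (nat \<Rightarrow> 'a) \<Rightarrow> ((nat \<Rightarrow> nat) \<Rightarrow> 'a) \<Rightarrow> nat \<Rightarrow> 'a"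
  where "truncation_value R i x f N =
    (\<Oplus>\<^bsub>R\<^esub>\<nu>\<in>{\<nu> \<in> exponents i. (\<Sum>j<i. \<nu> j) < N}. f \<nu> \<otimes>\<^bsub>R\<^esub> monomial_value R i x \<nu>)"

text \<open>The image of \<open>k[[X\<^sub>1, \<dots>, X\<^sub>i]] \<rightarrow> R\<close>, \<open>f \<mapsto> f(x\<^sub>1, \<dots>, x\<^sub>i)\<close>.\<close>

definition power_series_subring ::
  "('a, 'r) ring_scheme \<Rightarrow> 'a set \<Rightarrow> 'a set \<Rightarrow> nat \<Rightarrow> (nat \<Rightarrow> 'a) \<Rightarrow> 'a set"
  where "power_series_subring R \<mm> k i x =
    {r \<in> carrier R. \<exists>f\<in>exponents i \<rightarrow> k. adic_limit R \<mm> (truncation_value R i x f) r}"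


section \<open>Krull dimension and quotient fields\<close>

text \<open>The supremum of the lengths \<open>n\<close> of chains \<open>p 0 \<subset> \<dots> \<subset> p n\<close> of prime ideals.\<close>

definition krull_dim :: "('a, 'r) ring_scheme \<Rightarrow> enat"
  where "krull_dim R =
    Sup {enat n | n. \<exists>p. (\<forall>j\<le>n. primeideal (p j) R) \<and> (\<forall>j<n. p j \<subset> p (Suc j))}"

definition fractions :: "('q, 'r) ring_scheme \<Rightarrow> 'q set \<Rightarrow> 'q set"
  where "fractions Q S = {a \<otimes>\<^bsub>Q\<^esub> inv\<^bsub>Q\<^esub> b | a b. a \<in> S \<and> b \<in> S \<and> b \<noteq> \<zero>\<^bsub>Q\<^esub>}"

definition quotient_field ::
  "('a, 'r) ring_scheme \<Rightarrow> ('q, 's) ring_scheme \<Rightarrow> ('a \<Rightarrow> 'q) \<Rightarrow> bool"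
  where "quotient_field R Q \<iota> \<longleftrightarrow>
    field Q \<and> \<iota> \<in> ring_hom R Q \<and> inj_on \<iota> (carrier R) \<and>
    carrier Q = fractions Q (\<iota> ` carrier R)"

end

theory Submission
  imports Defs "HOL-Library.Function_Algebras"
begin

text \<open>
  Write \<open>A = k[[X\<^sub>1, \<dots>, X\<^sub>i]]\<close>, with evaluation \<open>A \<rightarrow> R\<close>. A zigzag along the sequence \<open>x\<^sub>1, x\<^sub>2, \<dots>\<close>
  represents every class of the top local cohomology as a multiple of a fraction with denominator
  \<open>(x\<^sub>1 \<cdots> x\<^sub>i)\<^sup>n\<close>, so if it does not vanish then for some \<open>n\<close> no power \<open>(x\<^sub>1 \<cdots> x\<^sub>i)\<^sup>s\<close> lies in
  \<open>(x\<^sub>1\<^sup>n\<^sup>+\<^sup>s, \<dots>, x\<^sub>i\<^sup>n\<^sup>+\<^sup>s)R\<close>. Hence the inverse polynomials that die in the top local cohomology of \<open>R\<close> form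
  a proper subspace of \<open>D = H\<^sup>i\<^sub>X(A)\<close>. Since \<open>A\<close> is the space of linear functionals on \<open>D\<close>, some
  \<open>f \<noteq> 0\<close> in \<open>A\<close> kills that subspace. If \<open>g(x) = 0\<close>, then \<open>gD\<close> dies in \<open>R\<close>, so \<open>fg = 0\<close> and \<open>g = 0\<close>; thus \<open>A\<close> is
  isomorphic to \<open>R\<^sub>0\<close>. If \<open>a(x) = r b(x)\<close>, then every element of \<open>a\<^sup>sD\<close> coming from the annihilator of
  \<open>b\<^sup>s\<close> dies in \<open>R\<close>, so \<open>b\<^sup>s\<close> divides \<open>f a\<^sup>s\<close> for all \<open>s\<close>, and \<open>b\<close> divides \<open>a\<close> because \<open>A\<close> is completely
  integrally closed.
\<close>

section \<open>Torsion submodules\<close>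

text \<open>The resolution in the statement is arbitrary, so neither Cech complexes nor
  localisations are formed. Over a noetherian ring an injective module maps onto its localisation at
  \<open>x j\<close>, and this persists for its torsion with respect to
  \<open>x 0, ..., x (j-1)\<close>. The zigzag consists of the connecting maps of the resulting
  short exact sequences, with fractions replaced by division modulo torsion. The series
  \<open>f\<close> has a module-theoretic origin: the Matlis dual of the top local cohomology of
  \<open>R\<close> is the module of \<open>A\<close>-linear maps \<phi> from \<open>R\<close> to
  \<open>A\<close>, and \<open>f\<close> plays the role of \<phi>(1). From
  \<open>a(x) = r b(x)\<close> such a map would give \<open>f a^s = \<phi>(r^s) b^s\<close>. Only
  its effect on the image of \<open>D\<close> is at hand, hence the detour through annihilators.
  Since \<open>R\<close> may be far from finite over the power series ring, \<open>r\<close> is not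
  known to be integral. The fixed factor \<open>f\<close> shows it to be almost integral, which is
  why complete integral closedness has to be used.\<close>

lemma (in abelian_group) minus_minus_cancel:
  assumes "a \<in> carrier G" "b \<in> carrier G" "c \<in> carrier G"
  shows "(a \<ominus> b) \<oplus> (b \<ominus> c) = a \<ominus> c"
proof -
  have "(a \<ominus> b) \<oplus> (b \<ominus> c) = a \<oplus> ((\<ominus> b) \<oplus> b \<oplus> (\<ominus> c))"
    using assms by (simp add: minus_eq a_assoc)
  thus ?thesis using assms by (simp add: l_neg minus_eq)
qed

lemma (in abelian_group) minus_swap:
  assumes "a \<in> carrier G" "b \<in> carrier G"
  shows "\<ominus> (a \<ominus> b) = b \<ominus> a"
  using assms by (simp add: minus_eq minus_add a_comm)

lemma (in module) smult_minus:
  assumes "a \<in> carrier R" "u \<in> carrier M" "v \<in> carrier M"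
  shows "a \<odot>\<^bsub>M\<^esub> (u \<ominus>\<^bsub>M\<^esub> v) = a \<odot>\<^bsub>M\<^esub> u \<ominus>\<^bsub>M\<^esub> a \<odot>\<^bsub>M\<^esub> v"
  using assms by (simp add: M.minus_eq smult_r_distr smult_r_minus)

lemma (in abelian_group) minus_zero': "\<ominus> \<zero> = \<zero>"
  using add.inv_one by (simp add: a_inv_def)

lemma (in abelian_group) add_minus_cancel:
  assumes "a \<in> carrier G" "b \<in> carrier G" "c \<in> carrier G"
  shows "(c \<oplus> a) \<ominus> b \<ominus> c = a \<ominus> b"
proof -
  have "(c \<oplus> a) \<ominus> b \<ominus> c = (c \<oplus> (a \<ominus> b)) \<ominus> c" using assms by (simp add: minus_eq a_assoc)
  also have "\<dots> = (a \<ominus> b) \<oplus> (c \<ominus> c)"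
    using assms a_comm[of c "a \<ominus> b"] by (simp add: minus_eq a_assoc)
  finally show ?thesis using assms by (simp add: minus_eq r_neg)
qed

section \<open>Congruence modulo a submodule\<close>

definition mod_cong :: "('a, 'b, 'm) module_scheme \<Rightarrow> 'b set \<Rightarrow> 'b \<Rightarrow> 'b \<Rightarrow> bool"
  where "mod_cong M H a b \<longleftrightarrow> a \<in> carrier M \<and> b \<in> carrier M \<and> a \<ominus>\<^bsub>M\<^esub> b \<in> H"

context module
begin

lemma mod_cong_refl: "submodule H R M \<Longrightarrow> a \<in> carrier M \<Longrightarrow> mod_cong M H a a"
  using submodule.axioms(1) subgroup.one_closed by (fastforce simp: mod_cong_def M.r_neg M.minus_eq)

lemma mod_cong_sym: "submodule H R M \<Longrightarrow> mod_cong M H a b \<Longrightarrow> mod_cong M H b a"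
  unfolding mod_cong_def using submoduleE(3) M.minus_swap by metis

lemma mod_cong_trans:
  "submodule H R M \<Longrightarrow> mod_cong M H a b \<Longrightarrow> mod_cong M H b c \<Longrightarrow> mod_cong M H a c"
  unfolding mod_cong_def using submoduleE(5) M.minus_minus_cancel by metis

lemma mod_cong_smult:
  "submodule H R M \<Longrightarrow> r \<in> carrier R \<Longrightarrow> mod_cong M H a b \<Longrightarrow> mod_cong M H (r \<odot>\<^bsub>M\<^esub> a) (r \<odot>\<^bsub>M\<^esub> b)"
  unfolding mod_cong_def using submoduleE(4) smult_minus by (metis smult_closed)

lemma mod_cong_add:
  assumes H: "submodule H R M" and "mod_cong M H a b" "mod_cong M H a' b'"
  shows "mod_cong M H (a \<oplus>\<^bsub>M\<^esub> a') (b \<oplus>\<^bsub>M\<^esub> b')"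
proof -
  have c: "a \<in> carrier M" "b \<in> carrier M" "a' \<in> carrier M" "b' \<in> carrier M"
    using assms by (auto simp: mod_cong_def)
  have "(a \<oplus>\<^bsub>M\<^esub> a') \<ominus>\<^bsub>M\<^esub> (b \<oplus>\<^bsub>M\<^esub> b') = (a \<ominus>\<^bsub>M\<^esub> b) \<oplus>\<^bsub>M\<^esub> (a' \<ominus>\<^bsub>M\<^esub> b')"
    using c by (simp add: M.minus_eq M.minus_add M.a_ac)
  thus ?thesis using assms c submoduleE(5)[OF H] by (auto simp: mod_cong_def)
qed

lemma mod_cong_zero: "a \<in> carrier M \<Longrightarrow> mod_cong M H a \<zero>\<^bsub>M\<^esub> \<longleftrightarrow> a \<in> H"
  by (simp add: mod_cong_def M.minus_eq M.minus_zero')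

lemma mod_cong_mem:
  assumes H: "submodule H R M" and "mod_cong M H a b" "b \<in> H"
  shows "a \<in> H"
  using assms mod_cong_trans[OF H assms(2)] mod_cong_zero by (metis mod_cong_def M.zero_closed)

end

section \<open>Torsion with respect to a sequence of elements\<close>

text \<open>Torsion is expressed through the elements separately, so that an induction on
  \<open>j\<close> can adjoin them one at a time. \<open>torsion_module_carrier\<close> identifies
  it with the torsion of the ideal that they generate.\<close>

definition elements_torsion ::
  "('a, 'r) ring_scheme \<Rightarrow> (nat \<Rightarrow> 'a) \<Rightarrow> nat \<Rightarrow> ('a, 'b, 'm) module_scheme \<Rightarrow> 'b set"
  where "elements_torsion R x j M =
    {u \<in> carrier M. \<forall>l<j. \<exists>N::nat. (x l [^]\<^bsub>R\<^esub> N) \<odot>\<^bsub>M\<^esub> u = \<zero>\<^bsub>M\<^esub>}"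

context module
begin

lemma pow_smult_zero_mono:
  assumes "y \<in> carrier R" "u \<in> carrier M" "(y [^] N) \<odot>\<^bsub>M\<^esub> u = \<zero>\<^bsub>M\<^esub>" "N \<le> (N'::nat)"
  shows "(y [^] N') \<odot>\<^bsub>M\<^esub> u = \<zero>\<^bsub>M\<^esub>"
proof -
  have "y [^] N' = y [^] (N' - N) \<otimes> y [^] N"
    using assms by (simp add: R.nat_pow_mult)
  thus ?thesis using assms by (simp add: smult_assoc1)
qed

lemma elements_torsion_submodule:
  assumes x: "\<And>l. x l \<in> carrier R"
  shows "submodule (elements_torsion R x j M) R M"
proof (rule submoduleI)
  show "elements_torsion R x j M \<subseteq> carrier M" by (auto simp: elements_torsion_def)
  show "\<zero>\<^bsub>M\<^esub> \<in> elements_torsion R x j M" using x by (auto simp: elements_torsion_def)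
next
  fix a assume a: "a \<in> elements_torsion R x j M"
  show "\<ominus>\<^bsub>M\<^esub> a \<in> elements_torsion R x j M"
    unfolding elements_torsion_def
  proof (safe)
    show "\<ominus>\<^bsub>M\<^esub> a \<in> carrier M" using a by (auto simp: elements_torsion_def)
    fix l assume "l < j"
    then obtain N where "(x l [^] (N::nat)) \<odot>\<^bsub>M\<^esub> a = \<zero>\<^bsub>M\<^esub>" using a by (auto simp: elements_torsion_def)
    then show "\<exists>N::nat. (x l [^] N) \<odot>\<^bsub>M\<^esub> (\<ominus>\<^bsub>M\<^esub> a) = \<zero>\<^bsub>M\<^esub>"
      using a x by (intro exI[of _ N]) (auto simp: elements_torsion_def smult_r_minus)
  qed
next
  fix a b assume ab: "a \<in> elements_torsion R x j M" "b \<in> elements_torsion R x j M"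
  show "a \<oplus>\<^bsub>M\<^esub> b \<in> elements_torsion R x j M"
    unfolding elements_torsion_def
  proof (safe)
    show "a \<oplus>\<^bsub>M\<^esub> b \<in> carrier M" using ab by (auto simp: elements_torsion_def)
    fix l assume "l < j"
    then obtain N N' where N: "(x l [^] (N::nat)) \<odot>\<^bsub>M\<^esub> a = \<zero>\<^bsub>M\<^esub>" "(x l [^] (N'::nat)) \<odot>\<^bsub>M\<^esub> b = \<zero>\<^bsub>M\<^esub>"
      using ab unfolding elements_torsion_def by blast
    have "(x l [^] (N + N')) \<odot>\<^bsub>M\<^esub> a = \<zero>\<^bsub>M\<^esub>" "(x l [^] (N + N')) \<odot>\<^bsub>M\<^esub> b = \<zero>\<^bsub>M\<^esub>"
      using pow_smult_zero_mono[OF x _ N(1)] pow_smult_zero_mono[OF x _ N(2)] ab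
      by (auto simp: elements_torsion_def)
    then show "\<exists>N::nat. (x l [^] N) \<odot>\<^bsub>M\<^esub> (a \<oplus>\<^bsub>M\<^esub> b) = \<zero>\<^bsub>M\<^esub>"
      using ab x by (intro exI[of _ "N + N'"]) (auto simp: elements_torsion_def smult_r_distr)
  qed
next
  fix r a assume r: "r \<in> carrier R" and a: "a \<in> elements_torsion R x j M"
  show "r \<odot>\<^bsub>M\<^esub> a \<in> elements_torsion R x j M"
    unfolding elements_torsion_def
  proof (safe)
    show "r \<odot>\<^bsub>M\<^esub> a \<in> carrier M" using a r by (auto simp: elements_torsion_def)
    fix l assume "l < j"
    then obtain N where N: "(x l [^] (N::nat)) \<odot>\<^bsub>M\<^esub> a = \<zero>\<^bsub>M\<^esub>" using a by (auto simp: elements_torsion_def)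
    have "(x l [^] N) \<odot>\<^bsub>M\<^esub> (r \<odot>\<^bsub>M\<^esub> a) = r \<odot>\<^bsub>M\<^esub> ((x l [^] N) \<odot>\<^bsub>M\<^esub> a)"
      using a r x by (simp add: elements_torsion_def smult_assoc1[symmetric] R.m_comm)
    then show "\<exists>N::nat. (x l [^] N) \<odot>\<^bsub>M\<^esub> (r \<odot>\<^bsub>M\<^esub> a) = \<zero>\<^bsub>M\<^esub>"
      using N r by (intro exI[of _ N]) auto
  qed
qed

lemma elements_torsion_Suc:
  "u \<in> elements_torsion R x (Suc j) M \<longleftrightarrow>
   u \<in> elements_torsion R x j M \<and> (\<exists>N::nat. (x j [^] N) \<odot>\<^bsub>M\<^esub> u = \<zero>\<^bsub>M\<^esub>)"
  unfolding elements_torsion_def by (auto simp: less_Suc_eq)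

text \<open>Powers of \<open>x j\<close> act injectively on the quotient of the
  \<open>j\<close>-torsion by the \<open>Suc j\<close>-torsion. For injective \<open>M\<close> they
  also act surjectively by \<open>elements_torsion_divide\<close>, so this quotient is the
  localisation of the \<open>j\<close>-torsion at \<open>x j\<close>.\<close>

lemma elements_torsion_cancel:
  assumes x: "\<And>l. x l \<in> carrier R" and u: "u \<in> elements_torsion R x j M"
    and "(x j [^] (t::nat)) \<odot>\<^bsub>M\<^esub> u \<in> elements_torsion R x (Suc j) M"
  shows "u \<in> elements_torsion R x (Suc j) M"
proof -
  obtain N where N: "(x j [^] (N::nat)) \<odot>\<^bsub>M\<^esub> ((x j [^] (t::nat)) \<odot>\<^bsub>M\<^esub> u) = \<zero>\<^bsub>M\<^esub>"
    using assms(3) elements_torsion_Suc by metis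
  have "(x j [^] (N + t)) \<odot>\<^bsub>M\<^esub> u = \<zero>\<^bsub>M\<^esub>"
    using N x u by (simp add: elements_torsion_def R.nat_pow_mult[symmetric] smult_assoc1)
  thus ?thesis using u elements_torsion_Suc by blast
qed

lemma mod_cong_torsion_cancel:
  assumes x: "\<And>l. x l \<in> carrier R"
    and u: "u \<in> elements_torsion R x j M" "v \<in> elements_torsion R x j M"
    and "mod_cong M (elements_torsion R x (Suc j) M) ((x j [^] (t::nat)) \<odot>\<^bsub>M\<^esub> u) ((x j [^] t) \<odot>\<^bsub>M\<^esub> v)"
  shows "mod_cong M (elements_torsion R x (Suc j) M) u v"
proof -
  have c: "u \<in> carrier M" "v \<in> carrier M" using u by (auto simp: elements_torsion_def)
  note sub = submoduleE[OF elements_torsion_submodule[of x j, OF x]]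
  have "u \<ominus>\<^bsub>M\<^esub> v \<in> elements_torsion R x j M"
    using u sub(3,5) by (simp add: M.minus_eq)
  moreover have "(x j [^] t) \<odot>\<^bsub>M\<^esub> (u \<ominus>\<^bsub>M\<^esub> v) \<in> elements_torsion R x (Suc j) M"
    using assms(4) c x by (simp add: smult_minus mod_cong_def)
  ultimately show ?thesis using elements_torsion_cancel[OF x] c by (auto simp: mod_cong_def)
qed

end

lemma module_hom_facts:
  assumes "module R M" "module R N" "f \<in> module_hom R M N"
  shows "\<And>u. u \<in> carrier M \<Longrightarrow> f u \<in> carrier N"
    and "\<And>u v. u \<in> carrier M \<Longrightarrow> v \<in> carrier M \<Longrightarrow> f (u \<oplus>\<^bsub>M\<^esub> v) = f u \<oplus>\<^bsub>N\<^esub> f v"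
    and "\<And>r u. r \<in> carrier R \<Longrightarrow> u \<in> carrier M \<Longrightarrow> f (r \<odot>\<^bsub>M\<^esub> u) = r \<odot>\<^bsub>N\<^esub> f u"
    and "f \<zero>\<^bsub>M\<^esub> = \<zero>\<^bsub>N\<^esub>"
    and "\<And>u v. u \<in> carrier M \<Longrightarrow> v \<in> carrier M \<Longrightarrow> f (u \<ominus>\<^bsub>M\<^esub> v) = f u \<ominus>\<^bsub>N\<^esub> f v"
proof -
  interpret M: module R M by fact
  interpret N: module R N by fact
  show c: "f u \<in> carrier N" if "u \<in> carrier M" for u using assms that by (auto simp: module_hom_def)
  show a: "f (u \<oplus>\<^bsub>M\<^esub> v) = f u \<oplus>\<^bsub>N\<^esub> f v" if "u \<in> carrier M" "v \<in> carrier M" for u v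
    using assms that by (auto simp: module_hom_def)
  show s: "f (r \<odot>\<^bsub>M\<^esub> u) = r \<odot>\<^bsub>N\<^esub> f u" if "r \<in> carrier R" "u \<in> carrier M" for r u
    using assms that by (auto simp: module_hom_def)
  have "f (\<zero>\<^bsub>R\<^esub> \<odot>\<^bsub>M\<^esub> \<zero>\<^bsub>M\<^esub>) = \<zero>\<^bsub>R\<^esub> \<odot>\<^bsub>N\<^esub> f \<zero>\<^bsub>M\<^esub>" by (rule s) auto
  then show "f \<zero>\<^bsub>M\<^esub> = \<zero>\<^bsub>N\<^esub>" using c by simp
  show "f (u \<ominus>\<^bsub>M\<^esub> v) = f u \<ominus>\<^bsub>N\<^esub> f v" if uv: "u \<in> carrier M" "v \<in> carrier M" for u v
  proof -
    have "f (\<ominus>\<^bsub>M\<^esub> v) = f ((\<ominus>\<^bsub>R\<^esub> \<one>\<^bsub>R\<^esub>) \<odot>\<^bsub>M\<^esub> v)" using uv by (simp add: M.smult_l_minus)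
    also have "\<dots> = \<ominus>\<^bsub>N\<^esub> f v" using uv c by (subst s) (auto simp: N.smult_l_minus)
    finally show ?thesis using uv a by (simp add: M.minus_eq N.minus_eq)
  qed
qed

lemma module_hom_elements_torsion:
  assumes "module R M" "module R N" "f \<in> module_hom R M N" "\<And>l. x l \<in> carrier R"
    "u \<in> elements_torsion R x j M"
  shows "f u \<in> elements_torsion R x j N"
proof -
  interpret R: cring R using assms(1) by (simp add: module_def)
  note f = module_hom_facts[OF assms(1-3)]
  show ?thesis unfolding elements_torsion_def
  proof safe
    show "f u \<in> carrier N" using f(1) assms(5) by (auto simp: elements_torsion_def)
    fix l assume "l < j"
    then obtain n where "(x l [^]\<^bsub>R\<^esub> (n::nat)) \<odot>\<^bsub>M\<^esub> u = \<zero>\<^bsub>M\<^esub>" using assms(5) by (auto simp: elements_torsion_def)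
    then show "\<exists>n::nat. (x l [^]\<^bsub>R\<^esub> n) \<odot>\<^bsub>N\<^esub> f u = \<zero>\<^bsub>N\<^esub>"
      using f(3,4) assms(4,5) by (metis (no_types, lifting) R.nat_pow_closed elements_torsion_def mem_Collect_eq)
  qed
qed

text \<open>Ideals are test modules of the kind that \<open>injective_module\<close> admits: their
  elements lie in the type of the ring.\<close>

lemma (in cring) ideal_module:
  assumes "ideal L R"
  shows "module R ((ring_module R)\<lparr>carrier := L\<rparr>)"
proof -
  interpret L: ideal L R by fact
  show ?thesis
  proof (rule moduleI)
    show "abelian_group ((ring_module R)\<lparr>carrier := L\<rparr>)"
    proof (rule abelian_groupI)
      fix a assume "a \<in> carrier (ring_module R\<lparr>carrier := L\<rparr>)"
      then show "\<exists>y\<in>carrier (ring_module R\<lparr>carrier := L\<rparr>). y \<oplus>\<^bsub>ring_module R\<lparr>carrier := L\<rparr>\<^esub> a = \<zero>\<^bsub>ring_module R\<lparr>carrier := L\<rparr>\<^esub>"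
        by (intro bexI[of _ "\<ominus> a"]) (auto simp: ring_module_def l_neg)
    qed (auto simp: ring_module_def a_ac)
  qed (auto simp: ring_module_def is_cring L.I_l_closed l_distr r_distr m_assoc)
qed

lemma (in cring) ring_module_module: "module R (ring_module R)"
proof -
  have "(ring_module R)\<lparr>carrier := carrier R\<rparr> = ring_module R" by (simp add: ring_module_def)
  then show ?thesis using ideal_module[OF oneideal] by metis
qed

section \<open>Division by a ring element in an injective module\<close>

lemma (in noetherian_ring) ascending_ideals_stabilize:
  assumes id: "\<And>n. ideal (C n) R" and mono: "\<And>n. C n \<subseteq> C (Suc n)"
  shows "\<exists>s::nat. \<forall>n\<ge>s. C n = C s"
proof -
  have m: "C n \<subseteq> C n'" if "n \<le> n'" for n n' using lift_Suc_mono_le[of C, OF mono that] .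
  have "\<Union>(range C) \<in> range C"
  proof (rule ideal_chain_is_trivial)
    show "subset.chain {I. ideal I R} (range C)"
      unfolding pred_on.chain_def using id m nat_le_linear by blast
  qed auto
  then obtain s where "\<Union>(range C) = C s" by auto
  then show ?thesis using m by (intro exI[of _ s]) blast
qed

text \<open>The quotient \<open>e'\<close> is the value at one of an extension to \<open>R\<close>
  of the homomorphism that sends \<open>y^(s+t)\<close> to \<open>y^s e\<close> and the annihilator
  of \<open>e\<close> to zero. The factor \<open>y^s\<close> is the price for that homomorphism to
  exist. Killing the annihilator keeps \<open>e'\<close> in every torsion submodule that contains
  \<open>e\<close>.\<close>

lemma (in module) injective_module_divide:
  assumes noeth: "noetherian_ring R" and inj: "injective_module R M"
    and e: "e \<in> carrier M" and y: "y \<in> carrier R"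
  shows "\<exists>e'\<in>carrier M. \<exists>s::nat. (\<forall>a\<in>carrier R. a \<odot>\<^bsub>M\<^esub> e = \<zero>\<^bsub>M\<^esub> \<longrightarrow> a \<odot>\<^bsub>M\<^esub> e' = \<zero>\<^bsub>M\<^esub>) \<and>
    (y [^] (s + t)) \<odot>\<^bsub>M\<^esub> e' = (y [^] s) \<odot>\<^bsub>M\<^esub> e"
proof -
  \<comment> \<open>\<open>C n\<close> is the annihilator of \<open>y^n e\<close>. These ideals
    ascend, and the exponent \<open>s\<close> is the place where they become stationary.\<close>
  define C where "C n = {r \<in> carrier R. (y [^] n \<otimes> r) \<odot>\<^bsub>M\<^esub> e = \<zero>\<^bsub>M\<^esub>}" for n :: nat
  have Cideal: "ideal (C n) R" for n
  proof (rule idealI[OF R.ring_axioms])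
    show "subgroup (C n) (add_monoid R)"
      using y e by (intro R.add.subgroupI)
        (auto simp: C_def r_distr smult_l_distr R.r_minus smult_l_minus a_inv_def[symmetric])
  next
    fix a r assume a: "a \<in> C n" and r: "r \<in> carrier R"
    then have ac: "a \<in> carrier R" "(y [^] n \<otimes> a) \<odot>\<^bsub>M\<^esub> e = \<zero>\<^bsub>M\<^esub>" by (auto simp: C_def)
    have "(y [^] n \<otimes> (r \<otimes> a)) \<odot>\<^bsub>M\<^esub> e = (r \<otimes> (y [^] n \<otimes> a)) \<odot>\<^bsub>M\<^esub> e"
      using ac r y by (simp add: R.m_ac)
    then show "r \<otimes> a \<in> C n" using ac r y e by (simp add: C_def smult_assoc1)
    then show "a \<otimes> r \<in> C n" using ac r by (simp add: R.m_comm)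
  qed
  have "\<exists>s::nat. \<forall>n\<ge>s. C n = C s"
  proof (rule noetherian_ring.ascending_ideals_stabilize[OF noeth Cideal], rule subsetI)
    fix n r assume r: "r \<in> C n"
    have "y [^] Suc n \<otimes> r = y \<otimes> (y [^] n \<otimes> r)" using r y by (simp add: C_def R.m_ac)
    then show "r \<in> C (Suc n)" using r y e by (simp add: C_def smult_assoc1)
  qed
  then obtain s where s: "C (s + t) = C s" by (metis le_add1)
  define L where "L = {y [^] (s + t) \<otimes> r \<oplus> a | r a. r \<in> carrier R \<and> a \<in> C 0}"
  define f where "f z = (THE w. \<exists>r\<in>carrier R. \<exists>a\<in>C 0. z = y [^] (s + t) \<otimes> r \<oplus> a \<and> w = r \<odot>\<^bsub>M\<^esub> (y [^] s \<odot>\<^bsub>M\<^esub> e))" for z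
  have LE: "\<exists>r c. r \<in> carrier R \<and> c \<in> C 0 \<and> z = y [^] (s + t) \<otimes> r \<oplus> c" if "z \<in> L" for z
    using that unfolding L_def by blast
  interpret C0: ideal "C 0" R by (rule Cideal)
  have yst: "y [^] (s + t) \<in> carrier R" "y [^] s \<in> carrier R" "y [^] s \<odot>\<^bsub>M\<^esub> e \<in> carrier M" using y e by auto
  have f: "f (y [^] (s + t) \<otimes> r \<oplus> a) = r \<odot>\<^bsub>M\<^esub> (y [^] s \<odot>\<^bsub>M\<^esub> e)" if ra: "r \<in> carrier R" "a \<in> C 0" for r a
    unfolding f_def
  proof (rule the_equality)
    show "\<exists>r'\<in>carrier R. \<exists>a'\<in>C 0. y [^] (s + t) \<otimes> r \<oplus> a = y [^] (s + t) \<otimes> r' \<oplus> a' \<and>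
        r \<odot>\<^bsub>M\<^esub> (y [^] s \<odot>\<^bsub>M\<^esub> e) = r' \<odot>\<^bsub>M\<^esub> (y [^] s \<odot>\<^bsub>M\<^esub> e)" using ra by blast
  next
    fix w assume "\<exists>r'\<in>carrier R. \<exists>a'\<in>C 0. y [^] (s + t) \<otimes> r \<oplus> a = y [^] (s + t) \<otimes> r' \<oplus> a' \<and>
        w = r' \<odot>\<^bsub>M\<^esub> (y [^] s \<odot>\<^bsub>M\<^esub> e)"
    then obtain r' a' where r': "r' \<in> carrier R" "a' \<in> C 0"
      and eq: "y [^] (s + t) \<otimes> r \<oplus> a = y [^] (s + t) \<otimes> r' \<oplus> a'" and w: "w = r' \<odot>\<^bsub>M\<^esub> (y [^] s \<odot>\<^bsub>M\<^esub> e)" by blast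
    have ac: "a \<in> carrier R" "a' \<in> carrier R" using ra r' by auto
    have "y [^] (s + t) \<otimes> (r \<ominus> r') = y [^] (s + t) \<otimes> r \<ominus> y [^] (s + t) \<otimes> r'"
      using yst ra r' by (simp add: R.minus_eq R.r_distr R.r_minus)
    also have "\<dots> = (y [^] (s + t) \<otimes> r \<oplus> a) \<ominus> a \<ominus> y [^] (s + t) \<otimes> r'"
      using yst ra r' ac by (simp add: R.minus_eq R.a_assoc R.r_neg)
    also have "\<dots> = a' \<ominus> a"
      unfolding eq using yst ra r' ac by (intro R.add_minus_cancel) auto
    finally have 1: "y [^] (s + t) \<otimes> (r \<ominus> r') = a' \<ominus> a" .
    \<comment> \<open>The two representations differ by an \<open>r - r'\<close> that is killed by
      \<open>y^(s+t) e\<close>. Stationarity of the annihilators improves this to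
      \<open>y^s e\<close>, so both representations give the same value.\<close>
    have "a' \<ominus> a \<in> C 0" unfolding R.minus_eq using ra r' by blast
    then have "y [^] (s + t) \<otimes> (r \<ominus> r') \<odot>\<^bsub>M\<^esub> e = \<zero>\<^bsub>M\<^esub>"
      unfolding 1[symmetric] C_def using yst ra r' by simp
    then have "r \<ominus> r' \<in> C (s + t)" unfolding C_def using ra r' by blast
    then have "r \<ominus> r' \<in> C s" by (simp only: s)
    then have "(y [^] s \<otimes> (r \<ominus> r')) \<odot>\<^bsub>M\<^esub> e = \<zero>\<^bsub>M\<^esub>" by (simp only: C_def mem_Collect_eq)
    then have "(r \<ominus> r') \<odot>\<^bsub>M\<^esub> (y [^] s \<odot>\<^bsub>M\<^esub> e) = \<zero>\<^bsub>M\<^esub>"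
      using yst ra r' e smult_assoc1[of "r \<ominus> r'" "y [^] s" e] R.m_comm[of "r \<ominus> r'" "y [^] s"] by simp
    then have "r \<odot>\<^bsub>M\<^esub> (y [^] s \<odot>\<^bsub>M\<^esub> e) \<oplus>\<^bsub>M\<^esub> \<ominus>\<^bsub>M\<^esub> (r' \<odot>\<^bsub>M\<^esub> (y [^] s \<odot>\<^bsub>M\<^esub> e)) = \<zero>\<^bsub>M\<^esub>"
      using yst ra r' by (simp add: R.minus_eq smult_l_distr smult_l_minus)
    then show "w = r \<odot>\<^bsub>M\<^esub> (y [^] s \<odot>\<^bsub>M\<^esub> e)"
      unfolding w using yst ra r' by (metis M.minus_equality M.minus_minus M.a_inv_closed smult_closed M.a_comm)
  qed
  have Lideal: "ideal L R"
  proof (rule idealI[OF R.ring_axioms])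
    have z: "y [^] (s + t) \<otimes> \<zero> \<oplus> \<zero> \<in> L"
      unfolding L_def using C0.zero_closed R.zero_closed by blast
    show "subgroup L (add_monoid R)"
    proof (rule R.add.subgroupI)
      show "L \<subseteq> carrier R" "L \<noteq> {}" using yst z by (auto simp: L_def)
    next
      fix a assume "a \<in> L"
      then obtain r c where rc: "r \<in> carrier R" "c \<in> C 0" "a = y [^] (s + t) \<otimes> r \<oplus> c" by (auto simp: L_def)
      then have "\<ominus> a = y [^] (s + t) \<otimes> (\<ominus> r) \<oplus> (\<ominus> c)"
        using yst by (simp add: R.minus_add R.r_minus)
      then show "\<ominus> a \<in> L" unfolding L_def using rc C0.a_inv_closed R.a_inv_closed by blast
      fix b assume "b \<in> L"
      then obtain r' c' where rc': "r' \<in> carrier R" "c' \<in> C 0" "b = y [^] (s + t) \<otimes> r' \<oplus> c'" by (auto simp: L_def)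
      have "a \<oplus> b = y [^] (s + t) \<otimes> (r \<oplus> r') \<oplus> (c \<oplus> c')"
        using rc rc' yst by (simp add: R.r_distr R.a_ac)
      then show "a \<oplus> b \<in> L" unfolding L_def using rc rc' by blast
    qed
  next
    fix a q assume "a \<in> L" and q: "q \<in> carrier R"
    then obtain r c where rc: "r \<in> carrier R" "c \<in> C 0" "a = y [^] (s + t) \<otimes> r \<oplus> c" by (auto simp: L_def)
    then have "q \<otimes> a = y [^] (s + t) \<otimes> (q \<otimes> r) \<oplus> (q \<otimes> c)"
      using yst q by (simp add: R.r_distr R.m_ac)
    then show "q \<otimes> a \<in> L" unfolding L_def using rc q C0.I_l_closed by blast
    moreover have "a \<otimes> q = q \<otimes> a" using q rc yst by (simp add: R.m_comm)
    ultimately show "a \<otimes> q \<in> L" by simp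
  qed
  let ?L = "(ring_module R)\<lparr>carrier := L\<rparr>"
  have "f \<in> module_hom R ?L M"
    unfolding module_hom_def
  proof (safe)
    fix z assume "z \<in> carrier ?L"
    then have "z \<in> L" by simp
    then obtain r c where rc: "r \<in> carrier R" "c \<in> C 0" "z = y [^] (s + t) \<otimes> r \<oplus> c" using LE by blast
    then show "f z \<in> carrier M" unfolding rc(3) f[OF rc(1,2)] using yst by blast
  next
    fix z z' assume "z \<in> carrier ?L" "z' \<in> carrier ?L"
    then have zL: "z \<in> L" "z' \<in> L" by auto
    then obtain r c where rc: "r \<in> carrier R" "c \<in> C 0" "z = y [^] (s + t) \<otimes> r \<oplus> c" using LE by blast
    from zL obtain r' c' where rc': "r' \<in> carrier R" "c' \<in> C 0" "z' = y [^] (s + t) \<otimes> r' \<oplus> c'" using LE by blast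
    have "z \<oplus> z' = y [^] (s + t) \<otimes> (r \<oplus> r') \<oplus> (c \<oplus> c')"
        using rc rc' yst by (simp add: R.r_distr R.a_ac)
    moreover have "f (y [^] (s + t) \<otimes> (r \<oplus> r') \<oplus> (c \<oplus> c')) = (r \<oplus> r') \<odot>\<^bsub>M\<^esub> (y [^] s \<odot>\<^bsub>M\<^esub> e)"
      using rc rc' by (intro f) auto
    moreover have "f z = r \<odot>\<^bsub>M\<^esub> (y [^] s \<odot>\<^bsub>M\<^esub> e)" "f z' = r' \<odot>\<^bsub>M\<^esub> (y [^] s \<odot>\<^bsub>M\<^esub> e)"
      unfolding rc(3) rc'(3) using rc(1,2) rc'(1,2) by (auto intro: f)
    ultimately have "f (z \<oplus> z') = f z \<oplus>\<^bsub>M\<^esub> f z'" using rc(1) rc'(1) yst by (metis smult_l_distr)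
    then show "f (z \<oplus>\<^bsub>?L\<^esub> z') = f z \<oplus>\<^bsub>M\<^esub> f z'" by (simp add: ring_module_def)
  next
    fix q z assume q: "q \<in> carrier R" and "z \<in> carrier ?L"
    then have "z \<in> L" by auto
    then obtain r c where rc: "r \<in> carrier R" "c \<in> C 0" "z = y [^] (s + t) \<otimes> r \<oplus> c" using LE by blast
    then have "q \<otimes> z = y [^] (s + t) \<otimes> (q \<otimes> r) \<oplus> (q \<otimes> c)"
      using yst q by (simp add: R.r_distr R.m_ac)
    moreover have "f (y [^] (s + t) \<otimes> (q \<otimes> r) \<oplus> (q \<otimes> c)) = (q \<otimes> r) \<odot>\<^bsub>M\<^esub> (y [^] s \<odot>\<^bsub>M\<^esub> e)"
      using rc q C0.I_l_closed by (intro f) auto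
    moreover have "f z = r \<odot>\<^bsub>M\<^esub> (y [^] s \<odot>\<^bsub>M\<^esub> e)"
      unfolding rc(3) using rc(1,2) by (intro f)
    ultimately have "f (q \<otimes> z) = q \<odot>\<^bsub>M\<^esub> f z" using rc(1) q yst by (metis smult_assoc1)
    then show "f (q \<odot>\<^bsub>?L\<^esub> z) = q \<odot>\<^bsub>M\<^esub> f z" by (simp add: ring_module_def)
  qed
  moreover have "id \<in> module_hom R ?L (ring_module R)" "inj_on id (carrier ?L)"
    using ideal.Icarr[OF Lideal] by (auto simp: module_hom_def ring_module_def)
  ultimately have "\<exists>g\<in>module_hom R (ring_module R) M. \<forall>z\<in>carrier ?L. g (id z) = f z"
    using inj R.ideal_module[OF Lideal] R.ring_module_module unfolding injective_module_def by blast
  then obtain g where g: "g \<in> module_hom R (ring_module R) M" and gf: "\<And>z. z \<in> L \<Longrightarrow> g z = f z" by auto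
  note gh = module_hom_facts[OF R.ring_module_module module_axioms g]
  have g1: "g \<one> \<in> carrier M" using gh(1)[of \<one>] by (simp add: ring_module_def)
  have gr: "g r = r \<odot>\<^bsub>M\<^esub> g \<one>" if "r \<in> carrier R" for r
    using gh(3)[of r \<one>] that by (simp add: ring_module_def)
  show ?thesis
  proof (intro bexI[OF _ g1] exI[of _ s] conjI ballI impI)
    fix a assume a: "a \<in> carrier R" "a \<odot>\<^bsub>M\<^esub> e = \<zero>\<^bsub>M\<^esub>"
    then have aC: "a \<in> C 0" unfolding C_def by simp
    have eq: "a = y [^] (s + t) \<otimes> \<zero> \<oplus> a" using a yst by simp
    then have "a \<in> L" unfolding L_def using aC by blast
    moreover have "f a = \<zero>\<^bsub>M\<^esub>" using f[OF R.zero_closed aC] eq yst by (metis smult_l_null)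
    ultimately show "a \<odot>\<^bsub>M\<^esub> g \<one> = \<zero>\<^bsub>M\<^esub>" using gf gr a by metis
  next
    have eq: "y [^] (s + t) = y [^] (s + t) \<otimes> \<one> \<oplus> \<zero>" using yst by simp
    moreover have "\<zero> \<in> C 0" by simp
    ultimately have "y [^] (s + t) \<in> L" unfolding L_def by blast
    moreover have "f (y [^] (s + t)) = (y [^] s) \<odot>\<^bsub>M\<^esub> e" using f[of \<one> \<zero>] yst by simp
    ultimately show "(y [^] (s + t)) \<odot>\<^bsub>M\<^esub> g \<one> = (y [^] s) \<odot>\<^bsub>M\<^esub> e" using gf gr yst by metis
  qed
qed

text \<open>The division of \<open>injective_module_divide\<close> is exact only after
  multiplication by \<open>x j ^ s\<close>. The error is therefore killed by a power of
  \<open>x j\<close>, which puts it into the \<open>Suc j\<close>-torsion.\<close>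

lemma (in module) elements_torsion_divide:
  assumes noeth: "noetherian_ring R" and inj: "injective_module R M" and x: "\<And>l. x l \<in> carrier R"
    and e: "e \<in> elements_torsion R x j M"
  shows "\<exists>e'\<in>elements_torsion R x j M.
    mod_cong M (elements_torsion R x (Suc j) M) ((x j [^] (t::nat)) \<odot>\<^bsub>M\<^esub> e') e"
proof -
  have ec: "e \<in> carrier M" using e by (auto simp: elements_torsion_def)
  obtain e' s where e': "e' \<in> carrier M" and ann: "\<forall>a\<in>carrier R. a \<odot>\<^bsub>M\<^esub> e = \<zero>\<^bsub>M\<^esub> \<longrightarrow> a \<odot>\<^bsub>M\<^esub> e' = \<zero>\<^bsub>M\<^esub>"
    and s: "(x j [^] (s + t)) \<odot>\<^bsub>M\<^esub> e' = (x j [^] s) \<odot>\<^bsub>M\<^esub> e"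
    using injective_module_divide[OF noeth inj ec x[of j], of t] by blast
  have e'G: "e' \<in> elements_torsion R x j M"
    using e e' ann x unfolding elements_torsion_def by (auto, meson R.nat_pow_closed)
  note sub = submoduleE[OF elements_torsion_submodule[of x j, OF x]]
  let ?u = "(x j [^] t) \<odot>\<^bsub>M\<^esub> e' \<ominus>\<^bsub>M\<^esub> e"
  have "?u \<in> elements_torsion R x j M" using e'G e x sub(3-5) by (simp add: M.minus_eq)
  moreover have "(x j [^] s) \<odot>\<^bsub>M\<^esub> ?u = \<zero>\<^bsub>M\<^esub>"
    using e' ec x s by (simp add: smult_minus smult_assoc1[symmetric] R.nat_pow_mult) (simp add: M.minus_eq M.r_neg)
  ultimately have "?u \<in> elements_torsion R x (Suc j) M" using elements_torsion_Suc by blast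
  then show ?thesis using e'G e' ec x by (auto simp: mod_cong_def)
qed

section \<open>The torsion subcomplexes of an injective resolution\<close>

locale resolved_ring = noetherian_ring R + cring R for R (structure) +
  fixes E :: "nat \<Rightarrow> ('a, 'e) module" and \<epsilon> :: "'a \<Rightarrow> 'e" and d :: "nat \<Rightarrow> 'e \<Rightarrow> 'e" and x :: "nat \<Rightarrow> 'a"
  assumes resolution: "injective_resolution R (ring_module R) E \<epsilon> d"
    and x_closed: "x l \<in> carrier R"
begin

definition tors :: "nat \<Rightarrow> nat \<Rightarrow> 'e set"
  where "tors j n = elements_torsion R x j (E n)"

definition bnd :: "nat \<Rightarrow> nat \<Rightarrow> 'e set"
  where "bnd j n = coboundaries (\<lambda>m. (E m)\<lparr>carrier := tors j m\<rparr>) d n"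

lemma E_inj: "injective_module R (E n)"
  using resolution by (auto simp: injective_resolution_def)

lemma E_module: "module R (E n)"
  using E_inj by (auto simp: injective_module_def)

lemma d_hom: "d n \<in> module_hom R (E n) (E (Suc n))"
  using resolution by (auto simp: injective_resolution_def)

lemmas d_facts = module_hom_facts[OF E_module E_module d_hom]

lemma d_exact: "d n ` carrier (E n) = {c \<in> carrier (E (Suc n)). d (Suc n) c = \<zero>\<^bsub>E (Suc (Suc n))\<^esub>}"
  using resolution by (auto simp: injective_resolution_def cocycles_def)

lemma d_d: "u \<in> carrier (E n) \<Longrightarrow> d (Suc n) (d n u) = \<zero>\<^bsub>E (Suc (Suc n))\<^esub>"
  using d_exact by blast

lemma tors_submodule: "submodule (tors j n) R (E n)"
  unfolding tors_def by (rule module.elements_torsion_submodule[OF E_module x_closed])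

lemmas tors_closed = module.submoduleE(3-5)[OF E_module tors_submodule]

lemma tors_carrier: "u \<in> tors j n \<Longrightarrow> u \<in> carrier (E n)"
  by (simp add: tors_def elements_torsion_def)

lemma tors_0: "tors 0 n = carrier (E n)"
  by (simp add: tors_def elements_torsion_def)

lemma tors_Suc:
  "u \<in> tors (Suc j) n \<longleftrightarrow> u \<in> tors j n \<and> (\<exists>N::nat. (x j [^] N) \<odot>\<^bsub>E n\<^esub> u = \<zero>\<^bsub>E n\<^esub>)"
  unfolding tors_def by (rule module.elements_torsion_Suc[OF E_module])

lemma tors_zero: "\<zero>\<^bsub>E n\<^esub> \<in> tors j n"
proof -
  interpret module R "E n" by (rule E_module)
  show ?thesis using x_closed by (auto simp: tors_def elements_torsion_def)
qed

lemma d_tors: "u \<in> tors j n \<Longrightarrow> d n u \<in> tors j (Suc n)"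
  unfolding tors_def by (rule module_hom_elements_torsion[OF E_module E_module d_hom x_closed])

lemma tors_divide:
  "e \<in> tors j n \<Longrightarrow> \<exists>e'\<in>tors j n. mod_cong (E n) (tors (Suc j) n) ((x j [^] (t::nat)) \<odot>\<^bsub>E n\<^esub> e') e"
  unfolding tors_def
  by (rule module.elements_torsion_divide[OF E_module noetherian_ring_axioms E_inj x_closed])

lemma bnd_0: "bnd j 0 = {\<zero>\<^bsub>E 0\<^esub>}"
  by (simp add: bnd_def coboundaries_def)

lemma bnd_Suc: "bnd j (Suc n) = d n ` tors j n"
  by (simp add: bnd_def coboundaries_def)

lemma bnd_tors: "bnd j n \<subseteq> tors j n"
  by (cases n) (auto simp: bnd_0 bnd_Suc tors_zero d_tors)

lemma d_bnd: "b \<in> bnd j n \<Longrightarrow> d n b = \<zero>\<^bsub>E (Suc n)\<^esub>"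
  by (cases n) (auto simp: bnd_0 bnd_Suc d_facts(4) d_d tors_carrier)

lemma bnd_submodule: "submodule (bnd j n) R (E n)"
proof (cases n)
  case 0
  interpret module R "E 0" by (rule E_module)
  show ?thesis unfolding 0 by (rule submoduleI) (auto simp: bnd_0 M.minus_zero')
next
  case (Suc m)
  interpret M: module R "E m" by (rule E_module)
  interpret N: module R "E (Suc m)" by (rule E_module)
  show ?thesis
    unfolding Suc bnd_Suc
  proof (rule N.submoduleI)
    show "d m ` tors j m \<subseteq> carrier (E (Suc m))" using d_facts(1) tors_carrier by auto
    show "\<zero>\<^bsub>E (Suc m)\<^esub> \<in> d m ` tors j m" using tors_zero d_facts(4) by (metis imageI)
  next
    fix a assume "a \<in> d m ` tors j m"
    then obtain u where u: "u \<in> tors j m" "a = d m u" by auto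
    have uc: "u \<in> carrier (E m)" using u tors_carrier by auto
    have "\<ominus>\<^bsub>E (Suc m)\<^esub> a = d m (\<ominus>\<^bsub>E m\<^esub> u)"
      using d_facts(3)[where r = "\<ominus> \<one>" and u = u and n = m] uc u d_facts(1)[OF uc] by (simp add: M.smult_l_minus N.smult_l_minus)
    then show "\<ominus>\<^bsub>E (Suc m)\<^esub> a \<in> d m ` tors j m" using u tors_closed by auto
    fix b assume "b \<in> d m ` tors j m"
    then obtain v where v: "v \<in> tors j m" "b = d m v" by auto
    then have "a \<oplus>\<^bsub>E (Suc m)\<^esub> b = d m (u \<oplus>\<^bsub>E m\<^esub> v)" using u uc d_facts(2) tors_carrier by simp
    then show "a \<oplus>\<^bsub>E (Suc m)\<^esub> b \<in> d m ` tors j m" using u v tors_closed by auto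
  next
    fix r a assume r: "r \<in> carrier R" and "a \<in> d m ` tors j m"
    then obtain u where u: "u \<in> tors j m" "a = d m u" by auto
    then have "r \<odot>\<^bsub>E (Suc m)\<^esub> a = d m (r \<odot>\<^bsub>E m\<^esub> u)" using r d_facts(3) tors_carrier by simp
    then show "r \<odot>\<^bsub>E (Suc m)\<^esub> a \<in> d m ` tors j m" using r u tors_closed by auto
  qed
qed

text \<open>A primitive of \<open>b\<close> is divided, and \<open>d\<close> carries the resulting
  congruence over because it is linear and preserves torsion. In degree 0 the only coboundary is
  zero.\<close>

lemma bnd_divide:
  assumes "b \<in> bnd j n"
  shows "\<exists>b'\<in>bnd j n. mod_cong (E n) (tors (Suc j) n) ((x j [^] (t::nat)) \<odot>\<^bsub>E n\<^esub> b') b"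
proof (cases n)
  case 0
  interpret module R "E 0" by (rule E_module)
  show ?thesis using assms mod_cong_refl[OF tors_submodule] x_closed unfolding 0 by (auto simp: bnd_0)
next
  case (Suc m)
  then obtain g where g: "g \<in> tors j m" "b = d m g" using assms by (auto simp: bnd_Suc)
  obtain g' where g': "g' \<in> tors j m" "mod_cong (E m) (tors (Suc j) m) ((x j [^] t) \<odot>\<^bsub>E m\<^esub> g') g"
    using tors_divide[OF g(1)] by blast
  interpret M: module R "E m" by (rule E_module)
  interpret N: module R "E (Suc m)" by (rule E_module)
  have c: "g \<in> carrier (E m)" "g' \<in> carrier (E m)" using g g' tors_carrier by auto
  have "d m ((x j [^] t) \<odot>\<^bsub>E m\<^esub> g' \<ominus>\<^bsub>E m\<^esub> g) \<in> tors (Suc j) (Suc m)"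
    using g'(2) d_tors by (simp add: mod_cong_def)
  then have "mod_cong (E (Suc m)) (tors (Suc j) (Suc m)) ((x j [^] t) \<odot>\<^bsub>E (Suc m)\<^esub> d m g') b"
    using c g x_closed d_facts(1,3,5) by (simp add: mod_cong_def)
  then show ?thesis using g' unfolding Suc bnd_Suc by blast
qed

section \<open>The connecting homomorphism\<close>

lemma d_mod_cong:
  assumes "u \<in> tors j n" "v \<in> tors j n"
    and "mod_cong (E n) (tors (Suc j) n) u v"
  shows "mod_cong (E (Suc n)) (bnd (Suc j) (Suc n)) (d n u) (d n v)"
proof -
  have "d n (u \<ominus>\<^bsub>E n\<^esub> v) \<in> d n ` tors (Suc j) n" using assms(3) by (auto simp: mod_cong_def)
  then show ?thesis using assms tors_carrier d_facts(1,5) by (simp add: mod_cong_def bnd_Suc)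
qed

text \<open>The quotient of the \<open>j\<close>-torsion complex by the \<open>Suc j\<close>-torsion
  complex is the localisation of the former at \<open>x j\<close>. The connecting map lifts a
  fraction \<open>w / x j ^ t\<close> to some \<open>u\<close> with \<open>x j ^ t u\<close>
  congruent to \<open>w\<close> and sends it to \<open>d n u\<close>. This is its well-definedness
  on cohomology classes, with a common exponent \<open>t\<close>.\<close>

lemma d_mod_cong_divide:
  fixes t :: nat
  assumes u: "u \<in> tors j n" and v: "v \<in> tors j n"
    and uw: "mod_cong (E n) (tors (Suc j) n) ((x j [^] t) \<odot>\<^bsub>E n\<^esub> u) w"
    and vw: "mod_cong (E n) (tors (Suc j) n) ((x j [^] t) \<odot>\<^bsub>E n\<^esub> v) w'"
    and ww: "mod_cong (E n) (bnd j n) w w'"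
  shows "mod_cong (E (Suc n)) (bnd (Suc j) (Suc n)) (d n u) (d n v)"
proof -
  interpret M: module R "E n" by (rule E_module)
  interpret N: module R "E (Suc n)" by (rule E_module)
  have c: "u \<in> carrier (E n)" "v \<in> carrier (E n)" "w \<in> carrier (E n)" "w' \<in> carrier (E n)"
    "x j [^] t \<in> carrier R"
    using assms x_closed by (auto simp: mod_cong_def tors_carrier)
  \<comment> \<open>Adding a coboundary \<open>b'\<close> with \<open>x j ^ t b'\<close> congruent
    to \<open>w - w'\<close> turns \<open>v\<close> into a second lift of the fraction of
    \<open>w\<close> without changing its differential.\<close>
  have "w \<ominus>\<^bsub>E n\<^esub> w' \<in> bnd j n" using ww by (simp add: mod_cong_def)
  from bnd_divide[OF this] obtain b' where b': "b' \<in> bnd j n"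
    "mod_cong (E n) (tors (Suc j) n) ((x j [^] t) \<odot>\<^bsub>E n\<^esub> b') (w \<ominus>\<^bsub>E n\<^esub> w')" by blast
  have b't: "b' \<in> tors j n" using b'(1) bnd_tors by blast
  then have b'c: "b' \<in> carrier (E n)" by (rule tors_carrier)
  note sub = tors_submodule[of "Suc j" n]
  have "mod_cong (E n) (tors (Suc j) n) ((x j [^] t) \<odot>\<^bsub>E n\<^esub> (v \<oplus>\<^bsub>E n\<^esub> b')) (w' \<oplus>\<^bsub>E n\<^esub> (w \<ominus>\<^bsub>E n\<^esub> w'))"
    using M.mod_cong_add[OF sub vw b'(2)] c b'c by (simp add: M.smult_r_distr)
  moreover have "w' \<oplus>\<^bsub>E n\<^esub> (w \<ominus>\<^bsub>E n\<^esub> w') = w"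
    using c by (simp add: M.minus_eq M.a_ac M.r_neg2 M.r_neg1 M.r_neg)
  ultimately have "mod_cong (E n) (tors (Suc j) n) ((x j [^] t) \<odot>\<^bsub>E n\<^esub> u) ((x j [^] t) \<odot>\<^bsub>E n\<^esub> (v \<oplus>\<^bsub>E n\<^esub> b'))"
    using M.mod_cong_trans[OF sub uw] M.mod_cong_sym[OF sub] by metis
  then have "mod_cong (E n) (tors (Suc j) n) u (v \<oplus>\<^bsub>E n\<^esub> b')"
    using M.mod_cong_torsion_cancel[where x = x and j = j and t = t, OF x_closed] u tors_closed(3)[OF v b't]
    unfolding tors_def by blast
  from d_mod_cong[OF u tors_closed(3)[OF v b't] this]
  show ?thesis using d_facts(2)[OF c(2) b'c] d_bnd[OF b'(1)] d_facts(1)[OF c(2)] by simp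
qed

text \<open>Surjectivity of the connecting map when the cohomology of the \<open>j\<close>-torsion
  vanishes in degree \<open>Suc n\<close>: the fraction mapped to \<open>c\<close> has
  \<open>x j ^ t e\<close> as numerator and \<open>x j ^ t\<close> as denominator, where
  \<open>x j ^ t\<close> kills \<open>c\<close>.\<close>

lemma cocycle_lift:
  assumes c: "c \<in> tors (Suc j) (Suc n)" "d (Suc n) c = \<zero>\<^bsub>E (Suc (Suc n))\<^esub>"
    and van: "\<And>c. c \<in> tors j (Suc n) \<Longrightarrow> d (Suc n) c = \<zero>\<^bsub>E (Suc (Suc n))\<^esub> \<Longrightarrow> c \<in> bnd j (Suc n)"
  obtains e and t :: nat where "e \<in> tors j n" "c = d n e" "(x j [^] t) \<odot>\<^bsub>E n\<^esub> e \<in> tors j n"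
    "d n ((x j [^] t) \<odot>\<^bsub>E n\<^esub> e) = \<zero>\<^bsub>E (Suc n)\<^esub>"
proof -
  obtain t :: nat where t: "(x j [^] t) \<odot>\<^bsub>E (Suc n)\<^esub> c = \<zero>\<^bsub>E (Suc n)\<^esub>" and "c \<in> tors j (Suc n)"
    using c tors_Suc by blast
  then obtain e where e: "e \<in> tors j n" "c = d n e" using van c(2) by (auto simp: bnd_Suc)
  have "d n ((x j [^] t) \<odot>\<^bsub>E n\<^esub> e) = \<zero>\<^bsub>E (Suc n)\<^esub>"
    using t e tors_carrier x_closed d_facts(3) by simp
  then show ?thesis using that e tors_closed(2) x_closed nat_pow_closed by metis
qed

text \<open>Without torsion conditions this is exactness of the resolution in positive degrees. To
  pass from \<open>j\<close> to \<open>Suc j\<close>, the cocycle is written as the image of a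
  fraction; its numerator is a coboundary by the induction hypothesis, so the fraction can be
  compared with zero.\<close>

lemma cohomology_above_vanishes:
  assumes "j < n" "c \<in> tors j n" "d n c = \<zero>\<^bsub>E (Suc n)\<^esub>"
  shows "c \<in> bnd j n"
  using assms
proof (induction j arbitrary: n c)
  case 0
  then obtain m where m: "n = Suc m" by (cases n) auto
  then show ?case using 0 d_exact[of m] by (auto simp: bnd_Suc tors_0)
next
  case (Suc j)
  then obtain m where m: "n = Suc m" "j < m" by (cases n) auto
  obtain e and t :: nat where e: "e \<in> tors j m" "c = d m e" "(x j [^] t) \<odot>\<^bsub>E m\<^esub> e \<in> tors j m"
    "d m ((x j [^] t) \<odot>\<^bsub>E m\<^esub> e) = \<zero>\<^bsub>E (Suc m)\<^esub>"
    using cocycle_lift[of c j m] Suc m by (metis less_Suc_eq)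
  interpret M: module R "E m" by (rule E_module)
  have "mod_cong (E m) (bnd j m) ((x j [^] t) \<odot>\<^bsub>E m\<^esub> e) \<zero>\<^bsub>E m\<^esub>"
    using Suc.IH[OF m(2) e(3,4)] tors_carrier[OF e(3)] M.mod_cong_zero by simp
  moreover have "mod_cong (E m) (tors (Suc j) m) ((x j [^] t) \<odot>\<^bsub>E m\<^esub> e) ((x j [^] t) \<odot>\<^bsub>E m\<^esub> e)"
    "mod_cong (E m) (tors (Suc j) m) ((x j [^] t) \<odot>\<^bsub>E m\<^esub> \<zero>\<^bsub>E m\<^esub>) \<zero>\<^bsub>E m\<^esub>"
    using M.mod_cong_refl[OF tors_submodule] tors_carrier[OF e(3)] x_closed by auto
  ultimately have "mod_cong (E n) (bnd (Suc j) n) (d m e) (d m \<zero>\<^bsub>E m\<^esub>)"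
    using d_mod_cong_divide[OF e(1) tors_zero] m(1) by blast
  then show ?case using e d_facts(4) module.mod_cong_zero[OF E_module] m by (auto simp: mod_cong_def)
qed

lemma tors_cancel:
  fixes t :: nat
  shows "u \<in> tors j n \<Longrightarrow> (x j [^] t) \<odot>\<^bsub>E n\<^esub> u \<in> tors (Suc j) n \<Longrightarrow> u \<in> tors (Suc j) n"
  unfolding tors_def by (rule module.elements_torsion_cancel[OF E_module, where x = x and t = t]) (auto simp: x_closed)

section \<open>Generators of the top cohomology\<close>

fun px :: "nat \<Rightarrow> 'a" where
  "px 0 = \<one>"
| "px (Suc j) = px j \<otimes> x j"

lemma px_closed [simp]: "px j \<in> carrier R"
  by (induction j) (auto simp: x_closed)

text \<open>
  The class of \<open>h n\<close> plays the role of the fraction with denominator \<open>(x\<^sub>1 \<cdots> x\<^sub>j)\<^sup>n\<close> in the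
  description of the top local cohomology by the Cech complex.
\<close>

definition fraction_classes :: "nat \<Rightarrow> (nat \<Rightarrow> 'e) \<Rightarrow> bool"
  where "fraction_classes j h \<longleftrightarrow>
    (\<forall>n. h n \<in> tors j j \<and> d j (h n) = \<zero>\<^bsub>E (Suc j)\<^esub>) \<and>
    (\<forall>n s. mod_cong (E j) (bnd j j) ((px j [^] (s::nat)) \<odot>\<^bsub>E j\<^esub> h (n + s)) (h n)) \<and>
    (\<forall>n. \<forall>l<j. (x l [^] n) \<odot>\<^bsub>E j\<^esub> h n \<in> bnd j j) \<and>
    (\<forall>c\<in>tors j j. d j c = \<zero>\<^bsub>E (Suc j)\<^esub> \<longrightarrow>
      (\<exists>r\<in>carrier R. \<exists>n. mod_cong (E j) (bnd j j) c (r \<odot>\<^bsub>E j\<^esub> h n)))"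

text \<open>In degree 0 the cocycles are the image of \<open>R\<close>, generated by the image of
  one, and all denominators are one. The connecting map for \<open>x j\<close> then sends the
  fraction \<open>h n / x j ^ n\<close> to the next class with index \<open>n\<close>.\<close>

lemma fraction_classes_exist: "\<exists>h. fraction_classes j h"
proof (induction j)
  case 0
  interpret M: module R "E 0" by (rule E_module)
  have eps: "\<epsilon> \<in> module_hom R (ring_module R) (E 0)"
    and im: "\<epsilon> ` carrier (ring_module R) = cocycles E d 0"
    using resolution by (auto simp: injective_resolution_def)
  note ef = module_hom_facts[OF ring_module_module E_module eps]
  have e1: "\<epsilon> \<one> \<in> carrier (E 0)" "d 0 (\<epsilon> \<one>) = \<zero>\<^bsub>E (Suc 0)\<^esub>"
    using im by (auto simp: ring_module_def cocycles_def)
  have "\<exists>r\<in>carrier R. c = r \<odot>\<^bsub>E 0\<^esub> \<epsilon> \<one>" if "c \<in> carrier (E 0)" "d 0 c = \<zero>\<^bsub>E (Suc 0)\<^esub>" for c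
  proof -
    have "c \<in> \<epsilon> ` carrier (ring_module R)" using that im by (auto simp: cocycles_def)
    then obtain r where "r \<in> carrier R" "c = \<epsilon> r" by (auto simp: ring_module_def)
    then show ?thesis using ef(3)[of r \<one>] by (intro bexI[of _ r]) (auto simp: ring_module_def)
  qed
  then have "fraction_classes 0 (\<lambda>_. \<epsilon> \<one>)"
    using e1 M.mod_cong_refl[OF bnd_submodule] by (fastforce simp: fraction_classes_def tors_0)
  then show ?case by blast
next
  case (Suc j)
  then obtain h where "fraction_classes j h" by blast
  then have h: "\<And>n. h n \<in> tors j j" "\<And>n. d j (h n) = \<zero>\<^bsub>E (Suc j)\<^esub>"
    and h_pow: "\<And>n s. mod_cong (E j) (bnd j j) ((px j [^] (s::nat)) \<odot>\<^bsub>E j\<^esub> h (n + s)) (h n)"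
    and h_ann: "\<And>n l. l < j \<Longrightarrow> (x l [^] n) \<odot>\<^bsub>E j\<^esub> h n \<in> bnd j j"
    and h_gen: "\<And>c. c \<in> tors j j \<Longrightarrow> d j c = \<zero>\<^bsub>E (Suc j)\<^esub> \<Longrightarrow>
       \<exists>r\<in>carrier R. \<exists>n. mod_cong (E j) (bnd j j) c (r \<odot>\<^bsub>E j\<^esub> h n)"
    unfolding fraction_classes_def by auto
  interpret M: module R "E j" by (rule E_module)
  interpret N: module R "E (Suc j)" by (rule E_module)
  note hc = tors_carrier[OF h(1)]
  note xp = nat_pow_closed[OF x_closed]
  \<comment> \<open>\<open>e n\<close> represents \<open>h n / x j ^ n\<close>; its differential is
    the new class.\<close>
  have "\<exists>e\<in>tors j j. mod_cong (E j) (tors (Suc j) j) ((x j [^] n) \<odot>\<^bsub>E j\<^esub> e) (h n)" for n :: nat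
    using tors_divide[OF h(1)] by blast
  then obtain e where e: "\<And>n::nat. e n \<in> tors j j"
    and eh: "\<And>n. mod_cong (E j) (tors (Suc j) j) ((x j [^] n) \<odot>\<^bsub>E j\<^esub> e n) (h n)" by metis
  note ec = tors_carrier[OF e]
  note sub = tors_submodule[of "Suc j" j]
  have de_ann: "(x j [^] n) \<odot>\<^bsub>E (Suc j)\<^esub> d j (e n) \<in> bnd (Suc j) (Suc j)" for n
    using d_mod_cong[OF tors_closed(2)[OF xp e] h(1) eh[of n]] h(2) ec xp
    by (simp add: d_facts(3) N.mod_cong_zero d_facts(1))
  have de: "d j (e n) \<in> tors (Suc j) (Suc j)" for n
    using tors_cancel[OF d_tors[OF e]] de_ann bnd_tors by blast
  have "fraction_classes (Suc j) (\<lambda>n. d j (e n))"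
    unfolding fraction_classes_def
  proof (intro conjI allI impI ballI)
    fix n show "d j (e n) \<in> tors (Suc j) (Suc j)" by (rule de)
    show "d (Suc j) (d j (e n)) = \<zero>\<^bsub>E (Suc (Suc j))\<^esub>" using ec by (rule d_d)
  next
    fix n s :: nat
    have pc: "px (Suc j) [^] s \<in> carrier R" "px j [^] s \<in> carrier R" "x j [^] n \<in> carrier R" "x j [^] s \<in> carrier R"
      using x_closed by (auto simp del: px.simps)
    \<comment> \<open>In terms of fractions, \<open>px (Suc j) ^ s / x j ^ (n+s)\<close> is
      \<open>px j ^ s / x j ^ n\<close>. Clearing the denominator \<open>x j ^ n\<close> reduces the
      relation for the new classes to the one for \<open>h\<close>.\<close>
    have "x j [^] n \<otimes> px (Suc j) [^] s = px j [^] s \<otimes> x j [^] (n + s)"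
      using x_closed pc by (simp add: nat_pow_distrib nat_pow_mult[symmetric] m_ac)
    then have "(x j [^] n) \<odot>\<^bsub>E j\<^esub> ((px (Suc j) [^] s) \<odot>\<^bsub>E j\<^esub> e (n + s)) =
        (px j [^] s) \<odot>\<^bsub>E j\<^esub> ((x j [^] (n + s)) \<odot>\<^bsub>E j\<^esub> e (n + s))"
      using pc ec xp by (simp add: M.smult_assoc1[symmetric] del: px.simps)
    then have 1: "mod_cong (E j) (tors (Suc j) j) ((x j [^] n) \<odot>\<^bsub>E j\<^esub> ((px (Suc j) [^] s) \<odot>\<^bsub>E j\<^esub> e (n + s)))
        ((px j [^] s) \<odot>\<^bsub>E j\<^esub> h (n + s))"
      using M.mod_cong_smult[OF sub pc(2) eh[of "n + s"]] by simp
    have "mod_cong (E (Suc j)) (bnd (Suc j) (Suc j)) (d j ((px (Suc j) [^] s) \<odot>\<^bsub>E j\<^esub> e (n + s))) (d j (e n))"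
      using d_mod_cong_divide[OF tors_closed(2)[OF pc(1) e] e 1 eh h_pow] .
    then show "mod_cong (E (Suc j)) (bnd (Suc j) (Suc j)) ((px (Suc j) [^] s) \<odot>\<^bsub>E (Suc j)\<^esub> d j (e (n + s))) (d j (e n))"
      using d_facts(3)[OF pc(1) ec] by simp
  next
    fix n l assume l: "l < Suc j"
    show "(x l [^] n) \<odot>\<^bsub>E (Suc j)\<^esub> d j (e n) \<in> bnd (Suc j) (Suc j)"
    proof (cases "l = j")
      case True then show ?thesis using de_ann by simp
    next
      \<comment> \<open>For \<open>l < j\<close> the power \<open>x l ^ n\<close> already makes the
        numerator \<open>h n\<close> a coboundary, so the fraction is compared with zero.\<close>
      case False
      then have lj: "l < j" using l by simp
      have "(x j [^] n) \<odot>\<^bsub>E j\<^esub> ((x l [^] n) \<odot>\<^bsub>E j\<^esub> e n) = (x l [^] n) \<odot>\<^bsub>E j\<^esub> ((x j [^] n) \<odot>\<^bsub>E j\<^esub> e n)"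
        using ec xp by (simp add: M.smult_assoc1[symmetric] m_comm)
      then have 1: "mod_cong (E j) (tors (Suc j) j) ((x j [^] n) \<odot>\<^bsub>E j\<^esub> ((x l [^] n) \<odot>\<^bsub>E j\<^esub> e n)) ((x l [^] n) \<odot>\<^bsub>E j\<^esub> h n)"
        using M.mod_cong_smult[OF sub xp eh] by simp
      have 2: "mod_cong (E j) (tors (Suc j) j) ((x j [^] n) \<odot>\<^bsub>E j\<^esub> \<zero>\<^bsub>E j\<^esub>) \<zero>\<^bsub>E j\<^esub>"
        using M.mod_cong_refl[OF sub] xp by auto
      have 3: "mod_cong (E j) (bnd j j) ((x l [^] n) \<odot>\<^bsub>E j\<^esub> h n) \<zero>\<^bsub>E j\<^esub>"
        using h_ann[OF lj] hc xp M.mod_cong_zero by simp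
      from d_mod_cong_divide[OF tors_closed(2)[OF xp e] tors_zero 1 2 3]
      show ?thesis using ec xp d_facts(1,3,4) by (simp add: N.mod_cong_zero)
    qed
  next
    fix c assume c: "c \<in> tors (Suc j) (Suc j)" "d (Suc j) c = \<zero>\<^bsub>E (Suc (Suc j))\<^esub>"
    obtain u and t :: nat where u: "u \<in> tors j j" "c = d j u" "(x j [^] t) \<odot>\<^bsub>E j\<^esub> u \<in> tors j j"
      "d j ((x j [^] t) \<odot>\<^bsub>E j\<^esub> u) = \<zero>\<^bsub>E (Suc j)\<^esub>"
      using cocycle_lift[OF c] cohomology_above_vanishes[of j "Suc j"] by (metis lessI)
    note uc = tors_carrier[OF u(1)]
    obtain r n where r: "r \<in> carrier R"
      and rn: "mod_cong (E j) (bnd j j) ((x j [^] t) \<odot>\<^bsub>E j\<^esub> u) (r \<odot>\<^bsub>E j\<^esub> h n)"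
      using h_gen[OF u(3,4)] by blast
    \<comment> \<open>The fraction \<open>r / (px j ^ n x j ^ t)\<close> is brought to the
      denominator \<open>px (Suc j) ^ (n+t)\<close>, and \<open>q\<close> is its new
      numerator.\<close>
    define q where "q = x j [^] n \<otimes> (r \<otimes> px j [^] t)"
    have q: "q \<in> carrier R" "px j [^] t \<in> carrier R" using r xp unfolding q_def by auto
    have "(x j [^] (n + t)) \<odot>\<^bsub>E j\<^esub> u = (x j [^] n) \<odot>\<^bsub>E j\<^esub> ((x j [^] t) \<odot>\<^bsub>E j\<^esub> u)"
      using uc xp x_closed by (simp add: M.smult_assoc1[symmetric] nat_pow_mult)
    then have 1: "mod_cong (E j) (bnd j j) ((x j [^] (n + t)) \<odot>\<^bsub>E j\<^esub> u) ((x j [^] n) \<odot>\<^bsub>E j\<^esub> (r \<odot>\<^bsub>E j\<^esub> h n))"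
      using M.mod_cong_smult[OF bnd_submodule xp rn] by simp
    have "mod_cong (E j) (bnd j j) ((x j [^] n) \<odot>\<^bsub>E j\<^esub> (r \<odot>\<^bsub>E j\<^esub> ((px j [^] t) \<odot>\<^bsub>E j\<^esub> h (n + t)))) ((x j [^] n) \<odot>\<^bsub>E j\<^esub> (r \<odot>\<^bsub>E j\<^esub> h n))"
      by (intro M.mod_cong_smult[OF bnd_submodule] xp r h_pow)
    moreover have "(x j [^] n) \<odot>\<^bsub>E j\<^esub> (r \<odot>\<^bsub>E j\<^esub> ((px j [^] t) \<odot>\<^bsub>E j\<^esub> h (n + t))) = q \<odot>\<^bsub>E j\<^esub> h (n + t)"
      unfolding q_def using hc xp r q by (simp add: M.smult_assoc1)
    ultimately have 2: "mod_cong (E j) (bnd j j) ((x j [^] (n + t)) \<odot>\<^bsub>E j\<^esub> u) (q \<odot>\<^bsub>E j\<^esub> h (n + t))"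
      using 1 M.mod_cong_trans[OF bnd_submodule] M.mod_cong_sym[OF bnd_submodule] by metis
    have 3: "mod_cong (E j) (tors (Suc j) j) ((x j [^] (n + t)) \<odot>\<^bsub>E j\<^esub> u) ((x j [^] (n + t)) \<odot>\<^bsub>E j\<^esub> u)"
      using M.mod_cong_refl[OF sub] uc xp by auto
    have "(x j [^] (n + t)) \<odot>\<^bsub>E j\<^esub> (q \<odot>\<^bsub>E j\<^esub> e (n + t)) = q \<odot>\<^bsub>E j\<^esub> ((x j [^] (n + t)) \<odot>\<^bsub>E j\<^esub> e (n + t))"
      using ec xp q by (simp add: M.smult_assoc1[symmetric] m_comm)
    then have 4: "mod_cong (E j) (tors (Suc j) j) ((x j [^] (n + t)) \<odot>\<^bsub>E j\<^esub> (q \<odot>\<^bsub>E j\<^esub> e (n + t))) (q \<odot>\<^bsub>E j\<^esub> h (n + t))"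
      using M.mod_cong_smult[OF sub q(1) eh] by simp
    have "mod_cong (E (Suc j)) (bnd (Suc j) (Suc j)) (d j u) (d j (q \<odot>\<^bsub>E j\<^esub> e (n + t)))"
      by (rule d_mod_cong_divide[OF u(1) tors_closed(2)[OF q(1) e] 3 4 2])
    then have "mod_cong (E (Suc j)) (bnd (Suc j) (Suc j)) c (q \<odot>\<^bsub>E (Suc j)\<^esub> d j (e (n + t)))"
      using u d_facts(3)[OF q(1) ec] by simp
    then show "\<exists>r\<in>carrier R. \<exists>n. mod_cong (E (Suc j)) (bnd (Suc j) (Suc j)) c (r \<odot>\<^bsub>E (Suc j)\<^esub> d j (e n))"
      using q by blast
  qed
  then show ?case by blast
qed

text \<open>Modulo coboundaries, \<open>h n\<close> is \<open>px j ^ s h (n+s)\<close>, and every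
  \<open>x l ^ (n+s)\<close> kills \<open>h (n+s)\<close>. The ideal membership therefore
  annihilates all generators.\<close>

lemma top_cohomology_vanishes:
  assumes van: "\<And>n. \<exists>s::nat. px j [^] s \<in> genideal R ((\<lambda>l. x l [^] (n + s)) ` {..<j})"
    and c: "c \<in> tors j j" "d j c = \<zero>\<^bsub>E (Suc j)\<^esub>"
  shows "c \<in> bnd j j"
proof -
  obtain h where "fraction_classes j h" using fraction_classes_exist by blast
  then have h: "\<And>n. h n \<in> tors j j"
    and h_pow: "\<And>n s. mod_cong (E j) (bnd j j) ((px j [^] (s::nat)) \<odot>\<^bsub>E j\<^esub> h (n + s)) (h n)"
    and h_ann: "\<And>n l. l < j \<Longrightarrow> (x l [^] n) \<odot>\<^bsub>E j\<^esub> h n \<in> bnd j j"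
    and h_gen: "\<And>c. c \<in> tors j j \<Longrightarrow> d j c = \<zero>\<^bsub>E (Suc j)\<^esub> \<Longrightarrow>
       \<exists>r\<in>carrier R. \<exists>n. mod_cong (E j) (bnd j j) c (r \<odot>\<^bsub>E j\<^esub> h n)"
    unfolding fraction_classes_def by auto
  interpret M: module R "E j" by (rule E_module)
  note hc = tors_carrier[OF h]
  note sub = M.submoduleE[OF bnd_submodule[of j j]]
  have hn: "h n \<in> bnd j j" for n
  proof -
    obtain s :: nat where s: "px j [^] s \<in> genideal R ((\<lambda>l. x l [^] (n + s)) ` {..<j})" using van by blast
    define K where "K = {z \<in> carrier R. z \<odot>\<^bsub>E j\<^esub> h (n + s) \<in> bnd j j}"
    have "ideal K R"
    proof (rule idealI[OF ring_axioms])
      have "\<zero> \<in> K" unfolding K_def using hc subgroup.one_closed[OF submodule.axioms(1)[OF bnd_submodule]] by auto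
      then show "subgroup K (add_monoid R)"
        using hc sub(3,5) by (intro add.subgroupI) 
          (auto simp: K_def M.smult_l_distr M.smult_l_minus a_inv_def[symmetric])
    next
      fix a r assume a: "a \<in> K" and r: "r \<in> carrier R"
      then show "r \<otimes> a \<in> K" using hc sub(4) by (auto simp: K_def M.smult_assoc1)
      then show "a \<otimes> r \<in> K" using a r by (simp add: m_comm K_def)
    qed
    moreover have "(\<lambda>l. x l [^] (n + s)) ` {..<j} \<subseteq> K" using x_closed h_ann by (auto simp: K_def)
    ultimately have "px j [^] s \<in> K" using genideal_minimal s by blast
    then have "(px j [^] s) \<odot>\<^bsub>E j\<^esub> h (n + s) \<in> bnd j j" by (simp add: K_def)
    then show ?thesis using M.mod_cong_mem[OF bnd_submodule M.mod_cong_sym[OF bnd_submodule h_pow]] by blast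
  qed
  obtain r n where "r \<in> carrier R" "mod_cong (E j) (bnd j j) c (r \<odot>\<^bsub>E j\<^esub> h n)" using h_gen[OF c] by blast
  then show ?thesis using M.mod_cong_mem[OF bnd_submodule] hn sub(4) by blast
qed

end

section \<open>Ideal powers and the comparison with local cohomology\<close>

lemma ideals_set_simps [simp]:
  "\<one>\<^bsub>ideals_set R\<^esub> = carrier R" "I \<otimes>\<^bsub>ideals_set R\<^esub> J = ideal_prod R I J"
  by (simp_all add: ideals_set_def)

lemma (in ring) ideal_power_0: "ideal_power R I 0 = carrier R"
  by simp

lemma (in ring) ideal_power_Suc: "ideal_power R I (Suc n) = ideal_prod R (ideal_power R I n) I"
  by simp

lemma (in ring) ideal_power_ideal: "ideal I R \<Longrightarrow> ideal (ideal_power R I n) R"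
  by (induction n) (auto simp: ideal_power_0 ideal_power_Suc oneideal ideal_prod_is_ideal)

lemma (in ring) ideal_power_antimono:
  assumes "ideal I R" "n \<le> n'"
  shows "ideal_power R I n' \<subseteq> ideal_power R I n"
  using assms(2) ideal_prod_inter[OF ideal_power_ideal[OF assms(1)] assms(1)]
  by (induction n' rule: dec_induct) (auto simp: ideal_power_Suc)

lemma (in ring) pow_in_ideal_power:
  "ideal I R \<Longrightarrow> y \<in> I \<Longrightarrow> y [^] n \<in> ideal_power R I n"
  by (induction n) (auto simp: ideal_power_0 ideal_power_Suc intro: ideal_prod.prod)

context module
begin

text \<open>Induction on the sum of the exponents: multiplying \<open>e\<close> by
  \<open>x l\<close> lowers the exponent at \<open>l\<close>. If \<open>I^N'\<close> kills every
  \<open>x l e\<close>, then \<open>I^(N'+1)\<close> kills \<open>e\<close>. An exponent zero means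
  that \<open>e\<close> vanishes.\<close>

lemma elements_torsion_bounded:
  fixes x :: "nat \<Rightarrow> 'a" and i :: nat
  assumes x: "\<And>l. x l \<in> carrier R"
  defines "I \<equiv> genideal R (x ` {..<i})"
  assumes "e \<in> carrier M" "\<And>l. l < i \<Longrightarrow> (x l [^] (n l :: nat)) \<odot>\<^bsub>M\<^esub> e = \<zero>\<^bsub>M\<^esub>"
  shows "\<exists>N. \<forall>a\<in>ideal_power R I N. a \<odot>\<^bsub>M\<^esub> e = \<zero>\<^bsub>M\<^esub>"
  using assms(3,4)
proof (induction "\<Sum>l<i. n l" arbitrary: n e rule: less_induct)
  case less
  have Iid: "ideal I R" unfolding I_def using x by (intro R.genideal_ideal) auto
  show ?case
  proof (cases "\<exists>l<i. n l = 0")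
    case True
    then have "e = \<zero>\<^bsub>M\<^esub>" using less.prems by (metis R.nat_pow_0 smult_one)
    then show ?thesis using R.ideal_power_0 by (intro exI[of _ 0]) simp
  next
    case False
    have "\<exists>N. \<forall>a\<in>ideal_power R I N. a \<odot>\<^bsub>M\<^esub> (x l \<odot>\<^bsub>M\<^esub> e) = \<zero>\<^bsub>M\<^esub>" if l: "l < i" for l
    proof -
      obtain p where p: "n l = Suc p" using False l by (meson not0_implies_Suc)
      show ?thesis
    proof (rule less.hyps)
      show "(\<Sum>k<i. (n(l := p)) k) < (\<Sum>k<i. n k)"
        using l p by (intro sum_strict_mono_ex1) auto
      show "x l \<odot>\<^bsub>M\<^esub> e \<in> carrier M" using x less.prems by auto
      fix k assume k: "k < i"
      show "(x k [^] (n(l := p)) k) \<odot>\<^bsub>M\<^esub> (x l \<odot>\<^bsub>M\<^esub> e) = \<zero>\<^bsub>M\<^esub>"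
      proof (cases "k = l")
        case True
        then show ?thesis using less.prems(1) less.prems(2)[OF l] x p
            smult_assoc1[of "x l [^] p" "x l" e] by simp
      next
        case False
        have "(x k [^] n k) \<odot>\<^bsub>M\<^esub> (x l \<odot>\<^bsub>M\<^esub> e) = x l \<odot>\<^bsub>M\<^esub> ((x k [^] n k) \<odot>\<^bsub>M\<^esub> e)"
          using less.prems(1) x R.m_comm[of "x k [^] n k" "x l"] smult_assoc1[of "x k [^] n k" "x l" e]
            smult_assoc1[of "x l" "x k [^] n k" e] by simp
        then show ?thesis using less.prems(2)[OF k] x False by simp
      qed
    qed
    qed
    then obtain N where N: "\<And>l a. l < i \<Longrightarrow> a \<in> ideal_power R I (N l) \<Longrightarrow> a \<odot>\<^bsub>M\<^esub> (x l \<odot>\<^bsub>M\<^esub> e) = \<zero>\<^bsub>M\<^esub>"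
      by metis
    define N' where "N' = (\<Sum>l<i. N l)"
    have N': "a \<odot>\<^bsub>M\<^esub> (x l \<odot>\<^bsub>M\<^esub> e) = \<zero>\<^bsub>M\<^esub>" if "l < i" "a \<in> ideal_power R I N'" for l a
    proof (rule N[OF that(1)])
      have "N l \<le> N'" unfolding N'_def using that(1) by (intro member_le_sum) auto
      then show "a \<in> ideal_power R I (N l)" using R.ideal_power_antimono[OF Iid] that(2) by blast
    qed
    have pc: "a \<in> carrier R" if "a \<in> ideal_power R I N'" for a
      using R.ideal_power_ideal[OF Iid] that ideal.Icarr by metis
    \<comment> \<open>The elements whose product with \<open>e\<close> is killed by
      \<open>I^N'\<close> form an ideal containing the generators of \<open>I\<close>, hence all of
      \<open>I\<close>.\<close>
    define K where "K = {c \<in> carrier R. \<forall>a\<in>ideal_power R I N'. a \<odot>\<^bsub>M\<^esub> (c \<odot>\<^bsub>M\<^esub> e) = \<zero>\<^bsub>M\<^esub>}"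
    have "ideal K R"
    proof (rule idealI[OF R.ring_axioms])
      have "\<zero> \<in> K" unfolding K_def using less.prems(1) pc by simp
      then show "subgroup K (add_monoid R)" using less.prems(1) pc
        by (intro R.add.subgroupI)
          (auto simp: K_def smult_l_distr smult_r_distr smult_l_minus smult_r_minus M.minus_zero')
    next
      fix a r assume a: "a \<in> K" and r: "r \<in> carrier R"
      have ac: "a \<in> carrier R" using a by (simp add: K_def)
      have "b \<odot>\<^bsub>M\<^esub> ((r \<otimes> a) \<odot>\<^bsub>M\<^esub> e) = \<zero>\<^bsub>M\<^esub>" if b: "b \<in> ideal_power R I N'" for b
      proof -
        have "b \<odot>\<^bsub>M\<^esub> ((r \<otimes> a) \<odot>\<^bsub>M\<^esub> e) = (b \<otimes> r) \<odot>\<^bsub>M\<^esub> (a \<odot>\<^bsub>M\<^esub> e)"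
          using pc[OF b] ac r less.prems(1) by (simp add: smult_assoc1)
        moreover have "b \<otimes> r \<in> ideal_power R I N'"
          using R.ideal_power_ideal[OF Iid] b r ideal.I_r_closed by metis
        ultimately show ?thesis using a by (simp add: K_def)
      qed
      then show "r \<otimes> a \<in> K" using ac r by (simp add: K_def)
      then show "a \<otimes> r \<in> K" using ac r by (simp add: R.m_comm)
    qed
    moreover have "x ` {..<i} \<subseteq> K" using x N' by (auto simp: K_def)
    ultimately have IK: "I \<subseteq> K" unfolding I_def using R.genideal_minimal by blast
    have "a \<odot>\<^bsub>M\<^esub> e = \<zero>\<^bsub>M\<^esub>" if "a \<in> ideal_power R I (Suc N')" for a
      using that unfolding R.ideal_power_Suc
    proof (induction rule: ideal_prod.induct)
      case (prod b c)
      then have "c \<in> K" using IK by blast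
      then show ?case using prod pc less.prems(1) by (simp add: K_def smult_assoc1)
    next
      case (sum s1 s2)
      have "s1 \<in> carrier R" "s2 \<in> carrier R"
        using sum R.ideal_prod_in_carrier[OF R.ideal_power_ideal[OF Iid] Iid] by auto
      then show ?case using sum less.prems(1) by (simp add: smult_l_distr)
    qed
    then show ?thesis by blast
  qed
qed

lemma torsion_module_carrier:
  assumes x: "\<And>l. x l \<in> carrier R"
  shows "carrier (torsion_module R (genideal R (x ` {..<i})) M) = elements_torsion R x i M"
proof (intro equalityI subsetI)
  have Iid: "ideal (genideal R (x ` {..<i})) R" using x by (intro R.genideal_ideal) auto
  fix e assume "e \<in> carrier (torsion_module R (genideal R (x ` {..<i})) M)"
  then obtain N where e: "e \<in> carrier M" and N: "\<And>a. a \<in> ideal_power R (genideal R (x ` {..<i})) N \<Longrightarrow> a \<odot>\<^bsub>M\<^esub> e = \<zero>\<^bsub>M\<^esub>"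
    by (auto simp: torsion_module_def)
  have "(x l [^] N) \<odot>\<^bsub>M\<^esub> e = \<zero>\<^bsub>M\<^esub>" if "l < i" for l
  proof (rule N[OF R.pow_in_ideal_power[OF Iid]])
    have "x ` {..<i} \<subseteq> genideal R (x ` {..<i})" using x by (intro R.genideal_self) auto
    then show "x l \<in> genideal R (x ` {..<i})" using that by auto
  qed
  then show "e \<in> elements_torsion R x i M" using e by (auto simp: elements_torsion_def)
next
  fix e assume e: "e \<in> elements_torsion R x i M"
  then have "\<forall>l. \<exists>n. l < i \<longrightarrow> (x l [^] (n::nat)) \<odot>\<^bsub>M\<^esub> e = \<zero>\<^bsub>M\<^esub>" unfolding elements_torsion_def by blast
  then obtain n where n: "\<And>l. l < i \<Longrightarrow> (x l [^] (n l::nat)) \<odot>\<^bsub>M\<^esub> e = \<zero>\<^bsub>M\<^esub>" by metis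
  have ec: "e \<in> carrier M" using e by (simp add: elements_torsion_def)
  show "e \<in> carrier (torsion_module R (genideal R (x ` {..<i})) M)"
    using elements_torsion_bounded[where x = x, OF x ec n] ec by (simp add: torsion_module_def)
qed

end

lemma quotient_module_self:
  assumes "module R M" "submodule N R M"
  shows "carrier (quotient_module (M\<lparr>carrier := N\<rparr>) N) = {\<zero>\<^bsub>quotient_module (M\<lparr>carrier := N\<rparr>) N\<^esub>}"
proof -
  interpret module R M by fact
  note sub = submoduleE[OF assms(2)]
  have "N +>\<^bsub>M\<lparr>carrier := N\<rparr>\<^esub> a = N" if a: "a \<in> N" for a
  proof -
    have "N +>\<^bsub>M\<lparr>carrier := N\<rparr>\<^esub> a = (\<lambda>h. h \<oplus>\<^bsub>M\<^esub> a) ` N" by (auto simp: a_r_coset_def')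
    also have "\<dots> = N"
    proof (intro equalityI subsetI)
      fix b assume b: "b \<in> N"
      have "b = (b \<oplus>\<^bsub>M\<^esub> (\<ominus>\<^bsub>M\<^esub> a)) \<oplus>\<^bsub>M\<^esub> a" using a b sub(1) by (auto simp: M.a_assoc M.l_neg subset_iff)
      then show "b \<in> (\<lambda>h. h \<oplus>\<^bsub>M\<^esub> a) ` N" using a b sub(3,5) by blast
    qed (use a sub(5) in auto)
    finally show ?thesis .
  qed
  then show ?thesis using sub(2) by (auto simp: quotient_module_def A_RCOSETS_def')
qed

lemma (in resolved_ring) px_finprod: "px i = (\<Otimes>l\<in>{..<i}. x l)"
  by (induction i) (auto simp: lessThan_Suc x_closed m_comm)

theorem (in resolved_ring) local_cohomology_nonzero:
  assumes "carrier (local_cohomology R (genideal R (x ` {..<i})) E d i) \<noteq>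
    {\<zero>\<^bsub>local_cohomology R (genideal R (x ` {..<i})) E d i\<^esub>}"
  obtains n where "\<And>s::nat. (\<Otimes>l\<in>{..<i}. x l) [^] s \<notin> genideal R ((\<lambda>l. x l [^] (n + s)) ` {..<i})"
proof -
  let ?C = "\<lambda>n. torsion_module R (genideal R (x ` {..<i})) (E n)"
  have C: "?C n = (E n)\<lparr>carrier := tors i n\<rparr>" for n
  proof -
    have "?C n = (E n)\<lparr>carrier := carrier (?C n)\<rparr>" by (simp add: torsion_module_def)
    then show ?thesis unfolding module.torsion_module_carrier[OF E_module x_closed] tors_def .
  qed
  have cb: "coboundaries ?C d i = bnd i i" by (simp add: C bnd_def)
  have cc: "cocycles ?C d i = {c \<in> tors i i. d i c = \<zero>\<^bsub>E (Suc i)\<^esub>}" by (simp add: C cocycles_def)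
  have "\<exists>n. \<forall>s::nat. px i [^] s \<notin> genideal R ((\<lambda>l. x l [^] (n + s)) ` {..<i})"
  proof (rule ccontr)
    assume "\<nexists>n. \<forall>s::nat. px i [^] s \<notin> genideal R ((\<lambda>l. x l [^] (n + s)) ` {..<i})"
    then have "c \<in> bnd i i" if "c \<in> tors i i" "d i c = \<zero>\<^bsub>E (Suc i)\<^esub>" for c
      using top_cohomology_vanishes[OF _ that] by blast
    \<comment> \<open>If every cocycle is a coboundary, the quotient module consists of its zero
      alone, contrary to the assumption on local cohomology.\<close>
    then have eq: "cocycles ?C d i = bnd i i" unfolding cc using bnd_tors d_bnd by blast
    have "local_cohomology R (genideal R (x ` {..<i})) E d i = quotient_module ((E i)\<lparr>carrier := bnd i i\<rparr>) (bnd i i)"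
      unfolding local_cohomology_def cohomology_def eq cb by (simp add: C)
    then show False using assms quotient_module_self[OF E_module bnd_submodule] by metis
  qed
  then show ?thesis using that unfolding px_finprod by blast
qed

section \<open>Formal power series rings\<close>

lemma (in abelian_monoid) finsum_Sigma:
  assumes "finite A" "\<And>a. a \<in> A \<Longrightarrow> finite (B a)"
    and "\<And>a b. a \<in> A \<Longrightarrow> b \<in> B a \<Longrightarrow> f a b \<in> carrier G"
  shows "(\<Oplus>a\<in>A. \<Oplus>b\<in>B a. f a b) = (\<Oplus>p\<in>Sigma A B. f (fst p) (snd p))"
  using assms
proof (induction A rule: finite_induct)
  case empty
  then show ?case by simp
next
  case (insert a A)
  have S: "Sigma (insert a A) B = Pair a ` B a \<union> Sigma A B" by auto
  have "(\<Oplus>p\<in>Pair a ` B a. f (fst p) (snd p)) = (\<Oplus>b\<in>B a. f a b)"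
    using insert.prems by (subst finsum_reindex) (auto simp: inj_on_def)
  moreover have "(\<Oplus>p\<in>Pair a ` B a \<union> Sigma A B. f (fst p) (snd p)) =
      (\<Oplus>p\<in>Pair a ` B a. f (fst p) (snd p)) \<oplus> (\<Oplus>p\<in>Sigma A B. f (fst p) (snd p))"
    using insert by (intro finsum_Un_disjoint) auto
  moreover have "(\<Oplus>a\<in>insert a A. \<Oplus>b\<in>B a. f a b) = (\<Oplus>b\<in>B a. f a b) \<oplus> (\<Oplus>a\<in>A. \<Oplus>b\<in>B a. f a b)"
    using insert by (intro finsum_insert) auto
  ultimately show ?case using insert S by simp
qed

text \<open>Exponents are extended by zero beyond \<open>i\<close>, unlike the functions in
  \<open>exponents\<close>, which are undefined there. Pointwise addition, subtraction and
  comparison of functions then apply directly; \<open>truncation_value_eq\<close> translates between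
  the two encodings.\<close>

definition exps :: "nat \<Rightarrow> (nat \<Rightarrow> nat) set"
  where "exps i = {\<nu>. \<forall>j\<ge>i. \<nu> j = 0}"

lemma exps_zero [simp]: "0 \<in> exps i"
  by (simp add: exps_def)

lemma exps_add_iff [simp]: "\<nu> + \<mu> \<in> exps i \<longleftrightarrow> \<nu> \<in> exps i \<and> \<mu> \<in> exps i"
  by (auto simp: exps_def)

lemma exps_diff [simp]: "\<nu> \<in> exps i \<Longrightarrow> \<nu> - \<mu> \<in> exps i"
  by (auto simp: exps_def)

lemma exps_le: "\<mu> \<le> \<nu> \<Longrightarrow> \<nu> \<in> exps i \<Longrightarrow> \<mu> \<in> exps i"
  by (simp add: exps_def le_fun_def) (metis le_zero_eq)

lemma fun_le_add [simp]: "(\<nu> :: nat \<Rightarrow> nat) \<le> \<nu> + \<mu>" "(\<nu> :: nat \<Rightarrow> nat) \<le> \<mu> + \<nu>"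
  by (simp_all add: le_fun_def)

lemma fun_le_addI: "(\<nu> :: nat \<Rightarrow> nat) \<le> T \<Longrightarrow> \<nu> \<le> T + T'" "(\<nu> :: nat \<Rightarrow> nat) \<le> T' \<Longrightarrow> \<nu> \<le> T + T'"
  by (simp_all add: le_fun_def trans_le_add1 trans_le_add2)

lemma fun_add_leD: "(\<nu> :: nat \<Rightarrow> nat) + \<mu> \<le> T \<Longrightarrow> \<nu> \<le> T" "(\<nu> :: nat \<Rightarrow> nat) + \<mu> \<le> T \<Longrightarrow> \<mu> \<le> T"
  by (meson fun_le_add order_trans)+

lemma fun_add_diff [simp]: "((\<nu> :: nat \<Rightarrow> nat) + \<mu>) - \<nu> = \<mu>" "(\<mu> + \<nu>) - \<nu> = \<mu>"
  by (simp_all add: fun_eq_iff)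

lemma fun_diff_add: "(\<mu> :: nat \<Rightarrow> nat) \<le> \<nu> \<Longrightarrow> \<mu> + (\<nu> - \<mu>) = \<nu>"
  by (simp add: fun_eq_iff le_fun_def)

lemma fun_diff_diff: "(\<nu> :: nat \<Rightarrow> nat) - \<mu> - \<kappa> = \<nu> - (\<mu> + \<kappa>)"
  by (simp add: fun_eq_iff)

lemma fun_diff_le [simp]: "(\<nu> :: nat \<Rightarrow> nat) - \<mu> \<le> \<nu>"
  by (simp add: le_fun_def)

lemma fun_diff_diff_cancel: "(\<mu> :: nat \<Rightarrow> nat) \<le> \<nu> \<Longrightarrow> \<nu> - (\<nu> - \<mu>) = \<mu>"
  by (simp add: fun_eq_iff le_fun_def)

lemma finite_exps_bounded: "finite {\<nu> \<in> exps i. \<forall>j<i. \<nu> j \<le> n}"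
proof -
  have "{\<nu> \<in> exps i. \<forall>j<i. \<nu> j \<le> n} \<subseteq>
      {f. \<forall>x. (x \<in> {..<i} \<longrightarrow> f x \<in> {..n}) \<and> (x \<notin> {..<i} \<longrightarrow> f x = 0)}"
    by (auto simp: exps_def)
  then show ?thesis using finite_set_of_finite_funs[of "{..<i}" "{..n}" 0] by (auto intro: finite_subset)
qed

lemma finite_atMost_exps [simp]: "\<nu> \<in> exps i \<Longrightarrow> finite {..\<nu>}"
proof (rule finite_subset[OF _ finite_exps_bounded[of i "\<Sum>j<i. \<nu> j"]], safe)
  fix \<mu> assume \<nu>: "\<nu> \<in> exps i" and \<mu>: "\<mu> \<le> \<nu>"
  then show "\<mu> \<in> exps i" by (rule exps_le[rotated])
  fix j assume "j < i"
  then have "\<nu> j \<le> (\<Sum>j<i. \<nu> j)" by (intro member_le_sum) auto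
  then show "\<mu> j \<le> (\<Sum>j<i. \<nu> j)" using le_funD[OF \<mu>, of j] by simp
qed

section \<open>The ring of formal power series\<close>

definition power_series_ring :: "('a, 'r) ring_scheme \<Rightarrow> nat \<Rightarrow> ((nat \<Rightarrow> nat) \<Rightarrow> 'a) ring"
  where "power_series_ring C i =
    \<lparr>carrier = {f. (\<forall>\<nu>. f \<nu> \<in> carrier C) \<and> (\<forall>\<nu>. \<nu> \<notin> exps i \<longrightarrow> f \<nu> = \<zero>\<^bsub>C\<^esub>)},
     monoid.mult = (\<lambda>f g \<nu>. if \<nu> \<in> exps i then \<Oplus>\<^bsub>C\<^esub>\<mu>\<in>{..\<nu>}. f \<mu> \<otimes>\<^bsub>C\<^esub> g (\<nu> - \<mu>) else \<zero>\<^bsub>C\<^esub>),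
     one = (\<lambda>\<nu>. if \<nu> = 0 then \<one>\<^bsub>C\<^esub> else \<zero>\<^bsub>C\<^esub>),
     ring.zero = (\<lambda>\<nu>. \<zero>\<^bsub>C\<^esub>),
     ring.add = (\<lambda>f g \<nu>. f \<nu> \<oplus>\<^bsub>C\<^esub> g \<nu>)\<rparr>"

locale power_series = cring C for C (structure) + fixes i :: nat
begin

abbreviation A :: "((nat \<Rightarrow> nat) \<Rightarrow> 'a) ring" where "A \<equiv> power_series_ring C i"

lemma A_carrierI:
  assumes "\<And>\<nu>. \<nu> \<in> exps i \<Longrightarrow> f \<nu> \<in> carrier C" "\<And>\<nu>. \<nu> \<notin> exps i \<Longrightarrow> f \<nu> = \<zero>"
  shows "f \<in> carrier A"
proof -
  have "f \<nu> \<in> carrier C" for \<nu> by (cases "\<nu> \<in> exps i") (use assms in auto)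
  then show ?thesis using assms(2) by (simp add: power_series_ring_def)
qed

lemma coeff_closed: "f \<in> carrier A \<Longrightarrow> f \<nu> \<in> carrier C"
  by (simp add: power_series_ring_def)

lemma coeff_out: "f \<in> carrier A \<Longrightarrow> \<nu> \<notin> exps i \<Longrightarrow> f \<nu> = \<zero>"
  by (simp add: power_series_ring_def)

lemma A_mult: "\<nu> \<in> exps i \<Longrightarrow> (f \<otimes>\<^bsub>A\<^esub> g) \<nu> = (\<Oplus>\<mu>\<in>{..\<nu>}. f \<mu> \<otimes> g (\<nu> - \<mu>))"
  by (simp add: power_series_ring_def)

lemma A_mult_out: "\<nu> \<notin> exps i \<Longrightarrow> (f \<otimes>\<^bsub>A\<^esub> g) \<nu> = \<zero>"
  by (simp add: power_series_ring_def)

lemma A_add [simp]: "(f \<oplus>\<^bsub>A\<^esub> g) \<nu> = f \<nu> \<oplus> g \<nu>"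
  by (simp add: power_series_ring_def)

lemma A_zero [simp]: "\<zero>\<^bsub>A\<^esub> \<nu> = \<zero>"
  by (simp add: power_series_ring_def)

lemma A_zero_eq: "\<zero>\<^bsub>A\<^esub> = (\<lambda>\<nu>. \<zero>)"
  by (simp add: power_series_ring_def)

lemma A_one: "\<one>\<^bsub>A\<^esub> \<nu> = (if \<nu> = 0 then \<one> else \<zero>)"
  by (simp add: power_series_ring_def)

lemma A_mult_closed:
  assumes "f \<in> carrier A" "g \<in> carrier A"
  shows "f \<otimes>\<^bsub>A\<^esub> g \<in> carrier A"
  using coeff_closed[OF assms(1)] coeff_closed[OF assms(2)]
  by (intro A_carrierI) (auto simp: A_mult A_mult_out intro!: finsum_closed)

lemma A_mult_comm:
  assumes "f \<in> carrier A" "g \<in> carrier A"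
  shows "f \<otimes>\<^bsub>A\<^esub> g = g \<otimes>\<^bsub>A\<^esub> f"
proof
  note [simp] = coeff_closed[OF assms(1)] coeff_closed[OF assms(2)]
  fix \<nu>
  show "(f \<otimes>\<^bsub>A\<^esub> g) \<nu> = (g \<otimes>\<^bsub>A\<^esub> f) \<nu>"
  proof (cases "\<nu> \<in> exps i")
    case True
    have im: "(\<lambda>\<mu>. \<nu> - \<mu>) ` {..\<nu>} = {..\<nu>}"
    proof (intro equalityI subsetI)
      fix \<mu> assume "\<mu> \<in> {..\<nu>}"
      then have "\<mu> = \<nu> - (\<nu> - \<mu>)" by (simp add: fun_diff_diff_cancel)
      then show "\<mu> \<in> (\<lambda>\<mu>. \<nu> - \<mu>) ` {..\<nu>}" by (metis imageI fun_diff_le atMost_iff)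
    qed auto
    have "(\<Oplus>\<mu>\<in>(\<lambda>\<mu>. \<nu> - \<mu>) ` {..\<nu>}. f \<mu> \<otimes> g (\<nu> - \<mu>)) = (\<Oplus>\<mu>\<in>{..\<nu>}. f (\<nu> - \<mu>) \<otimes> g (\<nu> - (\<nu> - \<mu>)))"
      using assms by (intro finsum_reindex) (auto simp: inj_on_def, metis fun_diff_diff_cancel)
    also have "\<dots> = (\<Oplus>\<mu>\<in>{..\<nu>}. g \<mu> \<otimes> f (\<nu> - \<mu>))"
      using assms by (intro finsum_cong') (auto simp: fun_diff_diff_cancel m_comm)
    finally show ?thesis using True by (simp add: A_mult im)
  qed (simp add: A_mult_out)
qed

lemma A_mult_assoc:
  assumes f: "f \<in> carrier A" and g: "g \<in> carrier A" and h: "h \<in> carrier A"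
  shows "(f \<otimes>\<^bsub>A\<^esub> g) \<otimes>\<^bsub>A\<^esub> h = f \<otimes>\<^bsub>A\<^esub> (g \<otimes>\<^bsub>A\<^esub> h)"
proof
  note [simp] = coeff_closed[OF assms(1)] coeff_closed[OF assms(2)] coeff_closed[OF assms(3)]
  fix \<nu>
  show "((f \<otimes>\<^bsub>A\<^esub> g) \<otimes>\<^bsub>A\<^esub> h) \<nu> = (f \<otimes>\<^bsub>A\<^esub> (g \<otimes>\<^bsub>A\<^esub> h)) \<nu>"
  proof (cases "\<nu> \<in> exps i")
    case True
    have sub: "\<mu> \<in> exps i" "finite {..\<mu>}" if "\<mu> \<le> \<nu>" for \<mu>
      using exps_le[OF that True] by auto
    let ?T = "Sigma {..\<nu>} (\<lambda>a. {..\<nu> - a})"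
    let ?h = "\<lambda>p. (fst p + snd p, fst p)"
    \<comment> \<open>Both triple products sum over decompositions of \<open>\<nu>\<close> into
      three exponents. One side is indexed by the first two, \<open>(a, b)\<close>, the other by
      \<open>(a + b, a)\<close>.\<close>
    have T: "Sigma {..\<nu>} (\<lambda>\<mu>. {..\<mu>}) = ?h ` ?T"
    proof (intro equalityI subsetI)
      fix p assume p: "p \<in> Sigma {..\<nu>} (\<lambda>\<mu>. {..\<mu>})"
      then obtain \<mu> a where "p = (\<mu>, a)" "\<mu> \<le> \<nu>" "a \<le> \<mu>" by auto
      then have "p = ?h (a, \<mu> - a)" "(a, \<mu> - a) \<in> ?T"
        by (auto simp: fun_diff_add) (auto simp: le_fun_def diff_le_mono intro: le_trans)
      then show "p \<in> ?h ` ?T" by blast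
    next
      fix p assume "p \<in> ?h ` ?T"
      then obtain a b where "p = (a + b, a)" "a \<le> \<nu>" "b \<le> \<nu> - a" by auto
      then show "p \<in> Sigma {..\<nu>} (\<lambda>\<mu>. {..\<mu>})"
        by (auto simp: le_fun_def) (metis (no_types) add.commute le_diff_conv2)
    qed
    have "((f \<otimes>\<^bsub>A\<^esub> g) \<otimes>\<^bsub>A\<^esub> h) \<nu> = (\<Oplus>\<mu>\<in>{..\<nu>}. (\<Oplus>a\<in>{..\<mu>}. f a \<otimes> g (\<mu> - a)) \<otimes> h (\<nu> - \<mu>))"
      unfolding A_mult[OF True] using assms sub by (intro finsum_cong') (auto simp: A_mult intro!: finsum_closed)
    also have "\<dots> = (\<Oplus>\<mu>\<in>{..\<nu>}. \<Oplus>a\<in>{..\<mu>}. f a \<otimes> g (\<mu> - a) \<otimes> h (\<nu> - \<mu>))"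
      using assms sub by (intro finsum_cong' finsum_ldistr) (auto intro!: finsum_closed)
    also have "\<dots> = (\<Oplus>p\<in>Sigma {..\<nu>} (\<lambda>\<mu>. {..\<mu>}). f (snd p) \<otimes> g (fst p - snd p) \<otimes> h (\<nu> - fst p))"
      using assms sub True by (intro finsum_Sigma) auto
    also have "\<dots> = (\<Oplus>p\<in>?T. f (fst p) \<otimes> g (snd p) \<otimes> h (\<nu> - (fst p + snd p)))"
      unfolding T using assms by (subst finsum_reindex) (auto simp: inj_on_def)
    also have "\<dots> = (\<Oplus>a\<in>{..\<nu>}. \<Oplus>b\<in>{..\<nu> - a}. f a \<otimes> g b \<otimes> h (\<nu> - (a + b)))"
      using assms True by (intro finsum_Sigma[symmetric]) (auto intro: finite_atMost_exps[of _ i])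
    also have "\<dots> = (\<Oplus>a\<in>{..\<nu>}. f a \<otimes> (\<Oplus>b\<in>{..\<nu> - a}. g b \<otimes> h (\<nu> - a - b)))"
      using assms True by (intro finsum_cong') (auto simp: finsum_rdistr finite_atMost_exps[of _ i] fun_diff_diff m_assoc intro!: finsum_closed)
    also have "\<dots> = (f \<otimes>\<^bsub>A\<^esub> (g \<otimes>\<^bsub>A\<^esub> h)) \<nu>"
      unfolding A_mult[OF True] using assms True by (intro finsum_cong') (auto simp: A_mult intro!: finsum_closed)
    finally show ?thesis .
  qed (simp add: A_mult_out)
qed

lemma A_one_mult:
  assumes "f \<in> carrier A"
  shows "\<one>\<^bsub>A\<^esub> \<otimes>\<^bsub>A\<^esub> f = f"
proof
  note [simp] = coeff_closed[OF assms]
  fix \<nu>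
  show "(\<one>\<^bsub>A\<^esub> \<otimes>\<^bsub>A\<^esub> f) \<nu> = f \<nu>"
  proof (cases "\<nu> \<in> exps i")
    case True
    have "(\<Oplus>\<mu>\<in>{..\<nu>}. \<one>\<^bsub>A\<^esub> \<mu> \<otimes> f (\<nu> - \<mu>)) = (\<Oplus>\<mu>\<in>{..\<nu>}. if 0 = \<mu> then f (\<nu> - \<mu>) else \<zero>)"
      using assms by (intro finsum_cong') (auto simp: A_one)
    also have "\<dots> = f (\<nu> - 0)"
      using assms True by (intro finsum_singleton) (auto simp: le_fun_def)
    finally show ?thesis using True by (simp add: A_mult fun_diff_def)
  qed (simp add: A_mult_out coeff_out assms)
qed

lemma A_distrib:
  assumes "f \<in> carrier A" "g \<in> carrier A" "h \<in> carrier A"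
  shows "(f \<oplus>\<^bsub>A\<^esub> g) \<otimes>\<^bsub>A\<^esub> h = f \<otimes>\<^bsub>A\<^esub> h \<oplus>\<^bsub>A\<^esub> g \<otimes>\<^bsub>A\<^esub> h"
proof
  note [simp] = coeff_closed[OF assms(1)] coeff_closed[OF assms(2)] coeff_closed[OF assms(3)]
  fix \<nu>
  show "((f \<oplus>\<^bsub>A\<^esub> g) \<otimes>\<^bsub>A\<^esub> h) \<nu> = (f \<otimes>\<^bsub>A\<^esub> h \<oplus>\<^bsub>A\<^esub> g \<otimes>\<^bsub>A\<^esub> h) \<nu>"
  proof (cases "\<nu> \<in> exps i")
    case True
    have "(\<Oplus>\<mu>\<in>{..\<nu>}. (f \<mu> \<oplus> g \<mu>) \<otimes> h (\<nu> - \<mu>)) = (\<Oplus>\<mu>\<in>{..\<nu>}. f \<mu> \<otimes> h (\<nu> - \<mu>) \<oplus> g \<mu> \<otimes> h (\<nu> - \<mu>))"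
      using assms by (intro finsum_cong') (auto simp: l_distr)
    also have "\<dots> = (\<Oplus>\<mu>\<in>{..\<nu>}. f \<mu> \<otimes> h (\<nu> - \<mu>)) \<oplus> (\<Oplus>\<mu>\<in>{..\<nu>}. g \<mu> \<otimes> h (\<nu> - \<mu>))"
      using assms by (intro finsum_addf) auto
    finally show ?thesis using True by (simp add: A_mult)
  qed (simp add: A_mult_out)
qed

lemma A_cring: "cring A"
proof (rule cringI)
  show "abelian_group A"
  proof (rule abelian_groupI)
    fix f assume f: "f \<in> carrier A"
    note [simp] = coeff_closed[OF f]
    have "(\<lambda>\<nu>. \<ominus> f \<nu>) \<in> carrier A" "(\<lambda>\<nu>. \<ominus> f \<nu>) \<oplus>\<^bsub>A\<^esub> f = \<zero>\<^bsub>A\<^esub>"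
      using f by (auto intro!: A_carrierI simp: fun_eq_iff l_neg coeff_out)
    then show "\<exists>g\<in>carrier A. g \<oplus>\<^bsub>A\<^esub> f = \<zero>\<^bsub>A\<^esub>" by blast
  qed (auto intro!: A_carrierI simp: fun_eq_iff coeff_out coeff_closed a_ac)
  show "comm_monoid A"
  proof (rule comm_monoidI)
    show "\<one>\<^bsub>A\<^esub> \<in> carrier A" by (auto intro!: A_carrierI simp: A_one)
  qed (auto simp: A_mult_closed A_mult_assoc A_one_mult intro: A_mult_comm)
qed (rule A_distrib)

end

sublocale power_series \<subseteq> A: cring "power_series_ring C i"
  by (rule A_cring)

context power_series
begin

lemma A_uminus [simp]: 
  assumes "f \<in> carrier A"
  shows "(\<ominus>\<^bsub>A\<^esub> f) \<nu> = \<ominus> f \<nu>"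
proof -
  have "(\<ominus>\<^bsub>A\<^esub> f \<oplus>\<^bsub>A\<^esub> f) \<nu> = \<zero>" using A.l_neg[OF assms] by simp
  then show ?thesis using assms coeff_closed[OF assms] coeff_closed[OF A.a_inv_closed[OF assms]]
    by (intro minus_equality[symmetric]) auto
qed

lemma A_minus [simp]: "f \<in> carrier A \<Longrightarrow> g \<in> carrier A \<Longrightarrow> (f \<ominus>\<^bsub>A\<^esub> g) \<nu> = f \<nu> \<ominus> g \<nu>"
  by (simp add: A.minus_eq minus_eq)

text \<open>Only coefficients below \<open>\<nu>\<close> enter, so a factor may be replaced by an
  approximation that agrees with it there.\<close>

lemma A_mult_cong:
  assumes "f \<in> carrier A" "g \<in> carrier A" "g' \<in> carrier A"
    and "\<And>\<mu>. \<mu> \<le> \<nu> \<Longrightarrow> g \<mu> = g' \<mu>"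
  shows "(f \<otimes>\<^bsub>A\<^esub> g) \<nu> = (f \<otimes>\<^bsub>A\<^esub> g') \<nu>"
  using assms coeff_closed[OF assms(1)] coeff_closed[OF assms(3)]
  by (cases "\<nu> \<in> exps i") (auto simp: A_mult A_mult_out intro!: finsum_cong')

definition monomial :: "'a \<Rightarrow> (nat \<Rightarrow> nat) \<Rightarrow> (nat \<Rightarrow> nat) \<Rightarrow> 'a"
  where "monomial c \<mu> = (\<lambda>\<nu>. if \<nu> = \<mu> then c else \<zero>)"

lemma monomial_closed [simp]: "c \<in> carrier C \<Longrightarrow> \<mu> \<in> exps i \<Longrightarrow> monomial c \<mu> \<in> carrier A"
  by (intro A_carrierI) (auto simp: monomial_def)

lemma monomial_mult:
  assumes "c \<in> carrier C" "\<mu> \<in> exps i" "f \<in> carrier A"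
  shows "(monomial c \<mu> \<otimes>\<^bsub>A\<^esub> f) \<nu> = (if \<mu> \<le> \<nu> then c \<otimes> f (\<nu> - \<mu>) else \<zero>)"
proof (cases "\<nu> \<in> exps i")
  note [simp] = assms(1) coeff_closed[OF assms(3)]
  case True
  have "(monomial c \<mu> \<otimes>\<^bsub>A\<^esub> f) \<nu> = (\<Oplus>\<kappa>\<in>{..\<nu>}. if \<mu> = \<kappa> then c \<otimes> f (\<nu> - \<kappa>) else \<zero>)"
    unfolding A_mult[OF True] using assms by (intro finsum_cong') (auto simp: monomial_def)
  also have "\<dots> = (if \<mu> \<le> \<nu> then c \<otimes> f (\<nu> - \<mu>) else \<zero>)"
  proof (cases "\<mu> \<le> \<nu>")
    case T: True
    have "(\<Oplus>\<kappa>\<in>{..\<nu>}. if \<mu> = \<kappa> then c \<otimes> f (\<nu> - \<kappa>) else \<zero>) = c \<otimes> f (\<nu> - \<mu>)"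
      using assms True T by (intro finsum_singleton) auto
    then show ?thesis using T by simp
  next
    case F: False
    have "(\<Oplus>\<kappa>\<in>{..\<nu>}. if \<mu> = \<kappa> then c \<otimes> f (\<nu> - \<kappa>) else \<zero>) = (\<Oplus>\<kappa>\<in>{..\<nu>}. \<zero>)"
      using F by (intro finsum_cong') auto
    then show ?thesis using F by simp
  qed
  finally show ?thesis .
next
  case False
  then have "\<mu> \<le> \<nu> \<Longrightarrow> \<nu> - \<mu> \<notin> exps i" using fun_diff_add[of \<mu> \<nu>] assms(2) exps_add_iff by metis
  then show ?thesis using False assms by (auto simp: A_mult_out coeff_out)
qed

end

section \<open>An additive order on exponents\<close>

text \<open>
  Sending an exponent to a product of prime powers embeds the exponents into the positive
  integers under multiplication. This pulls back a total order of type \<open>\<omega>\<close>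
  that is compatible with addition, and saves defining a monomial order.
\<close>

definition nth_prime :: "nat \<Rightarrow> nat" where "nth_prime = enumerate {p. Factorial_Ring.prime p}"

definition exp_key :: "nat \<Rightarrow> (nat \<Rightarrow> nat) \<Rightarrow> nat"
  where "exp_key i \<nu> = (\<Prod>j<i. nth_prime j ^ \<nu> j)"

lemma nth_prime_prime: "Factorial_Ring.prime (nth_prime j)"
  using enumerate_in_set[OF primes_infinite] by (simp add: nth_prime_def)

lemma nth_prime_inj: "inj nth_prime"
  using strict_mono_enumerate[OF primes_infinite] strict_mono_imp_inj_on unfolding nth_prime_def by blast

lemma exp_key_pos [simp]: "exp_key i \<nu> > 0"
  unfolding exp_key_def using nth_prime_prime by (intro prod_pos) (simp add: prime_gt_0_nat)

lemma exp_key_add: "exp_key i (\<nu> + \<mu>) = exp_key i \<nu> * exp_key i \<mu>"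
  by (simp add: exp_key_def power_add prod.distrib)

lemma exp_key_inj: "\<nu> \<in> exps i \<Longrightarrow> \<mu> \<in> exps i \<Longrightarrow> exp_key i \<nu> = exp_key i \<mu> \<Longrightarrow> \<nu> = \<mu>"
proof -
  have m: "multiplicity (nth_prime j) (exp_key i \<nu>) = \<nu> j" if "j < i" for j \<nu>
  proof -
    let ?h = "\<lambda>p. \<nu> (inv_into UNIV nth_prime p)"
    have "exp_key i \<nu> = (\<Prod>p\<in>nth_prime ` {..<i}. p ^ ?h p)"
      unfolding exp_key_def using nth_prime_inj
      by (subst prod.reindex) (auto intro: inj_on_subset simp: inv_f_f)
    also have "multiplicity (nth_prime j) \<dots> = ?h (nth_prime j)"
      using that nth_prime_prime by (subst multiplicity_prod_prime_powers) auto
    finally show ?thesis using nth_prime_inj by simp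
  qed
  assume \<nu>: "\<nu> \<in> exps i" and \<mu>: "\<mu> \<in> exps i" and eq: "exp_key i \<nu> = exp_key i \<mu>"
  show "\<nu> = \<mu>"
  proof
    fix j
    show "\<nu> j = \<mu> j" using m[of j \<nu>] m[of j \<mu>] eq \<nu> \<mu> by (cases "j < i") (auto simp: exps_def)
  qed
qed

lemma exp_key_mono: "\<mu> \<le> \<nu> \<Longrightarrow> exp_key i \<mu> \<le> exp_key i \<nu>"
  using exp_key_add[of i \<mu> "\<nu> - \<mu>"] by (simp add: fun_diff_add Suc_le_eq)

lemma finite_exp_key: "finite {\<mu> \<in> exps i. exp_key i \<mu> < N}"
  by (rule inj_on_finite[of "exp_key i" _ "{..<N}"]) (auto simp: inj_on_def exp_key_inj)

text \<open>Faces of the monoid of exponents. The series without terms in a face form a prime ideal,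
  so one argument with lowest terms along faces yields both that the power series form a domain and
  that the coordinate ideals are prime.\<close>

definition exp_face :: "nat \<Rightarrow> (nat \<Rightarrow> nat) set \<Rightarrow> bool"
  where "exp_face i F \<longleftrightarrow> F \<subseteq> exps i \<and> (\<forall>\<nu> \<mu>. \<nu> + \<mu> \<in> F \<longleftrightarrow> \<nu> \<in> F \<and> \<mu> \<in> F)"

lemma exp_face_exps: "exp_face i (exps i)"
  by (simp add: exp_face_def)

section \<open>Lowest terms along a face\<close>

locale field_power_series = field C for C (structure) + fixes i :: nat

sublocale field_power_series \<subseteq> power_series C i ..

context field_power_series
begin

abbreviation key :: "(nat \<Rightarrow> nat) \<Rightarrow> nat" where "key \<equiv> exp_key i"

text \<open>A power series need not have a highest term, so the leading term is the one of smallest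
  key.\<close>

definition is_lead :: "(nat \<Rightarrow> nat) set \<Rightarrow> ((nat \<Rightarrow> nat) \<Rightarrow> 'a) \<Rightarrow> (nat \<Rightarrow> nat) \<Rightarrow> bool"
  where "is_lead F f \<nu> \<longleftrightarrow> \<nu> \<in> F \<and> f \<nu> \<noteq> \<zero> \<and> (\<forall>\<mu>\<in>F. key \<mu> < key \<nu> \<longrightarrow> f \<mu> = \<zero>)"

lemma is_lead_exists:
  assumes "\<nu> \<in> F" "f \<nu> \<noteq> \<zero>"
  shows "\<exists>\<nu>. is_lead F f \<nu>"
proof -
  have "\<exists>\<nu>. (\<nu> \<in> F \<and> f \<nu> \<noteq> \<zero>) \<and> (\<forall>\<mu>. (\<mu> \<in> F \<and> f \<mu> \<noteq> \<zero>) \<longrightarrow> key \<nu> \<le> key \<mu>)"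
    using assms by (intro ex_has_least_nat) blast
  then show ?thesis unfolding is_lead_def by (meson leD)
qed

lemma is_lead_unique:
  assumes "F \<subseteq> exps i" "is_lead F f \<nu>" "is_lead F f \<mu>"
  shows "\<nu> = \<mu>"
proof -
  have "key \<nu> = key \<mu>" using assms unfolding is_lead_def by (metis linorder_neqE_nat)
  then show ?thesis using assms unfolding is_lead_def by (intro exp_key_inj[of _ i]) auto
qed

text \<open>A contribution to the coefficient at \<open>\<kappa>\<close> comes from a decomposition
  of \<open>\<kappa>\<close> into two exponents, both in the face by its defining property. Keys
  multiply, so either one of the two lies below the respective lead, where the coefficient vanishes,
  or both keys agree with those of the leads.\<close>

lemma mult_coeff_lead:
  assumes F: "exp_face i F" and f: "f \<in> carrier A" "is_lead F f \<nu>" and g: "g \<in> carrier A" "is_lead F g \<mu>"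
    and \<kappa>: "\<kappa> \<in> F" "key \<kappa> \<le> key (\<nu> + \<mu>)"
  shows "(f \<otimes>\<^bsub>A\<^esub> g) \<kappa> = (if \<kappa> = \<nu> + \<mu> then f \<nu> \<otimes> g \<mu> else \<zero>)"
proof -
  note [simp] = coeff_closed[OF f(1)] coeff_closed[OF g(1)]
  have Fe: "a \<in> exps i" if "a \<in> F" for a using F that by (auto simp: exp_face_def)
  have \<nu>\<mu>: "\<nu> \<in> F" "\<mu> \<in> F" using f g by (auto simp: is_lead_def)
  have z: "f a \<otimes> g (\<kappa> - a) = \<zero>" if a: "a \<le> \<kappa>" "\<not> (a = \<nu> \<and> \<kappa> = \<nu> + \<mu>)" for a
  proof -
    have s: "a + (\<kappa> - a) = \<kappa>" using a by (simp add: fun_diff_add)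
    then have aF: "a \<in> F" "\<kappa> - a \<in> F" using F \<kappa>(1) unfolding exp_face_def by metis+
    have k: "key a * key (\<kappa> - a) \<le> key \<nu> * key \<mu>" using \<kappa>(2) s exp_key_add by metis
    show ?thesis
    proof (cases "key a < key \<nu> \<or> key (\<kappa> - a) < key \<mu>")
      case True
      then show ?thesis using f g aF by (auto simp: is_lead_def)
    next
      case False
      then have ge: "key \<nu> \<le> key a" "key \<mu> \<le> key (\<kappa> - a)" by auto
      have "key a = key \<nu>"
      proof (rule ccontr)
        assume "key a \<noteq> key \<nu>"
        then have "key \<nu> * key \<mu> < key a * key (\<kappa> - a)" using ge by (intro mult_less_le_imp_less) auto
        then show False using k by simp
      qed
      moreover have "key (\<kappa> - a) = key \<mu>"
      proof (rule ccontr)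
        assume "key (\<kappa> - a) \<noteq> key \<mu>"
        then have "key \<nu> * key \<mu> < key a * key (\<kappa> - a)" using ge by (intro mult_le_less_imp_less) auto
        then show False using k by simp
      qed
      ultimately have "a = \<nu>" "\<kappa> - a = \<mu>" using exp_key_inj Fe aF \<nu>\<mu> by metis+
      then show ?thesis using a s by auto
    qed
  qed
  have "(f \<otimes>\<^bsub>A\<^esub> g) \<kappa> = (\<Oplus>a\<in>{..\<kappa>}. f a \<otimes> g (\<kappa> - a))" using \<kappa> Fe by (simp add: A_mult)
  also have "\<dots> = (\<Oplus>a\<in>{..\<kappa>}. if \<nu> = a then (if \<kappa> = \<nu> + \<mu> then f \<nu> \<otimes> g \<mu> else \<zero>) else \<zero>)"
    using z by (intro finsum_cong') auto
  also have "\<dots> = (if \<kappa> = \<nu> + \<mu> then f \<nu> \<otimes> g \<mu> else \<zero>)"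
  proof (cases "\<kappa> = \<nu> + \<mu>")
    case True
    then show ?thesis using \<kappa> finite_atMost_exps[OF Fe[OF \<kappa>(1)]] by (subst finsum_singleton) auto
  next
    case False
    then have "(\<Oplus>a\<in>{..\<kappa>}. if \<nu> = a then (if \<kappa> = \<nu> + \<mu> then f \<nu> \<otimes> g \<mu> else \<zero>) else \<zero>) = (\<Oplus>a\<in>{..\<kappa>}. \<zero>)"
      by (intro finsum_cong') auto
    then show ?thesis using False by simp
  qed
  finally show ?thesis .
qed

lemma is_lead_mult:
  assumes F: "exp_face i F" and f: "f \<in> carrier A" "is_lead F f \<nu>" and g: "g \<in> carrier A" "is_lead F g \<mu>"
  shows "is_lead F (f \<otimes>\<^bsub>A\<^esub> g) (\<nu> + \<mu>)"
proof -
  have m: "\<nu> + \<mu> \<in> F" using F f g by (auto simp: exp_face_def is_lead_def)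
  have nz: "f \<nu> \<otimes> g \<mu> \<noteq> \<zero>"
    using f g coeff_closed[OF f(1)] coeff_closed[OF g(1)] by (auto simp: is_lead_def integral_iff)
  show ?thesis unfolding is_lead_def
  proof (intro conjI ballI impI)
    show "\<nu> + \<mu> \<in> F" by (rule m)
    show "(f \<otimes>\<^bsub>A\<^esub> g) (\<nu> + \<mu>) \<noteq> \<zero>" using mult_coeff_lead[OF assms m] nz by simp
    fix \<kappa> assume "\<kappa> \<in> F" "key \<kappa> < key (\<nu> + \<mu>)"
    then show "(f \<otimes>\<^bsub>A\<^esub> g) \<kappa> = \<zero>" using mult_coeff_lead[OF assms, of \<kappa>] by auto
  qed
qed

lemma A_nonzero_lead: "f \<in> carrier A \<Longrightarrow> f \<noteq> \<zero>\<^bsub>A\<^esub> \<Longrightarrow> \<exists>\<nu>. is_lead (exps i) f \<nu>"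
  using is_lead_exists coeff_out by (metis A_zero_eq ext)

lemma is_lead_nonzero: "is_lead F f \<nu> \<Longrightarrow> f \<noteq> \<zero>\<^bsub>A\<^esub>"
  by (auto simp: is_lead_def)

lemma A_domain: "domain A"
proof (rule domain.intro[OF A_cring], unfold_locales)
  show "\<one>\<^bsub>A\<^esub> \<noteq> \<zero>\<^bsub>A\<^esub>" using A_one[of 0] by auto
  fix f g assume fg: "f \<otimes>\<^bsub>A\<^esub> g = \<zero>\<^bsub>A\<^esub>" "f \<in> carrier A" "g \<in> carrier A"
  show "f = \<zero>\<^bsub>A\<^esub> \<or> g = \<zero>\<^bsub>A\<^esub>"
    using A_nonzero_lead[OF fg(2)] A_nonzero_lead[OF fg(3)] is_lead_mult[OF exp_face_exps fg(2) _ fg(3)]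
      is_lead_nonzero fg(1) by metis
qed

end

sublocale field_power_series \<subseteq> A: domain "power_series_ring C i"
  by (rule A_domain)

section \<open>The dual of a power series ring\<close>

context field_power_series
begin

text \<open>
  \<open>dual\<close> is the injective hull of the residue field: the element \<open>e\<close> stands for the sum of
  \<open>e \<nu>\<close> times the inverse monomial with exponent \<open>-\<nu> - 1\<close>, and power series act by \<open>act\<close>.
  Unlike an arbitrary Matlis dual, it makes \<open>A\<close> literally its space of linear functionals.
\<close>

definition dual :: "((nat \<Rightarrow> nat) \<Rightarrow> 'a) set"
  where "dual = {e. (\<forall>\<nu>. e \<nu> \<in> carrier C) \<and> (\<exists>T\<in>exps i. \<forall>\<nu>. \<not> \<nu> \<le> T \<longrightarrow> e \<nu> = \<zero>)}"

definition pairing :: "((nat \<Rightarrow> nat) \<Rightarrow> 'a) \<Rightarrow> ((nat \<Rightarrow> nat) \<Rightarrow> 'a) \<Rightarrow> 'a"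
  where "pairing f e = (\<Oplus>\<nu>\<in>{\<nu>. e \<nu> \<noteq> \<zero>}. f \<nu> \<otimes> e \<nu>)"

definition act :: "((nat \<Rightarrow> nat) \<Rightarrow> 'a) \<Rightarrow> ((nat \<Rightarrow> nat) \<Rightarrow> 'a) \<Rightarrow> (nat \<Rightarrow> nat) \<Rightarrow> 'a"
  where "act b e \<nu> = pairing b (\<lambda>\<mu>. e (\<nu> + \<mu>))"

text \<open>If \<open>e\<close> is supported below \<open>T\<close>, this is its numerator over the
  common denominator with exponent \<open>T + 1\<close>. The bound \<open>T\<close> is explicit
  because elements have to be compared over common denominators.\<close>

definition reverse :: "(nat \<Rightarrow> nat) \<Rightarrow> ((nat \<Rightarrow> nat) \<Rightarrow> 'a) \<Rightarrow> (nat \<Rightarrow> nat) \<Rightarrow> 'a"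
  where "reverse T e \<kappa> = (if \<kappa> \<le> T then e (T - \<kappa>) else \<zero>)"

lemma dualI: "T \<in> exps i \<Longrightarrow> (\<And>\<nu>. e \<nu> \<in> carrier C) \<Longrightarrow> (\<And>\<nu>. \<not> \<nu> \<le> T \<Longrightarrow> e \<nu> = \<zero>) \<Longrightarrow> e \<in> dual"
  unfolding dual_def by blast

lemma dualE:
  assumes "e \<in> dual"
  obtains T where "T \<in> exps i" "\<And>\<nu>. \<not> \<nu> \<le> T \<Longrightarrow> e \<nu> = \<zero>"
  using assms unfolding dual_def by blast

lemma dual_coeff: "e \<in> dual \<Longrightarrow> e \<nu> \<in> carrier C"
  unfolding dual_def by blast

lemma dual_A: "e \<in> dual \<Longrightarrow> e \<in> carrier A"
  using dual_coeff exps_le by (metis A_carrierI dualE)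

lemma pairing_sum:
  assumes "finite S" "f \<in> carrier A" "\<And>\<nu>. e \<nu> \<in> carrier C" "\<And>\<nu>. \<nu> \<notin> S \<Longrightarrow> e \<nu> = \<zero>"
  shows "pairing f e = (\<Oplus>\<nu>\<in>S. f \<nu> \<otimes> e \<nu>)"
  unfolding pairing_def using assms coeff_closed[OF assms(2)]
  by (intro add.finprod_mono_neutral_cong_left) auto

lemma reverse_closed:
  assumes "T \<in> exps i" "\<And>\<nu>. e \<nu> \<in> carrier C"
  shows "reverse T e \<in> carrier A"
  using assms exps_le by (intro A_carrierI) (auto simp: reverse_def)

lemma pairing_reverse:
  assumes T: "T \<in> exps i" and f: "f \<in> carrier A" and e: "\<And>\<nu>. e \<nu> \<in> carrier C" "\<And>\<nu>. \<not> \<nu> \<le> T \<Longrightarrow> e \<nu> = \<zero>"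
  shows "pairing f e = (f \<otimes>\<^bsub>A\<^esub> reverse T e) T"
proof -
  have "pairing f e = (\<Oplus>\<nu>\<in>{..T}. f \<nu> \<otimes> e \<nu>)"
    using assms by (intro pairing_sum) auto
  also have "\<dots> = (\<Oplus>\<nu>\<in>{..T}. f \<nu> \<otimes> reverse T e (T - \<nu>))"
    using e coeff_closed[OF f] by (intro finsum_cong') (auto simp: reverse_def fun_diff_diff_cancel)
  finally show ?thesis using T by (simp add: A_mult)
qed

lemma pairing_closed: "f \<in> carrier A \<Longrightarrow> e \<in> dual \<Longrightarrow> pairing f e \<in> carrier C"
  unfolding pairing_def using coeff_closed[of f] dual_coeff[of e] by (intro finsum_closed) auto

text \<open>Acting by \<open>b\<close> multiplies numerators; what falls outside the exponents below
  \<open>T\<close> is lost.\<close>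

lemma act_reverse:
  assumes T: "T \<in> exps i" and b: "b \<in> carrier A" and e: "\<And>\<nu>. e \<nu> \<in> carrier C" "\<And>\<nu>. \<not> \<nu> \<le> T \<Longrightarrow> e \<nu> = \<zero>"
    and \<nu>: "\<nu> \<le> T"
  shows "act b e \<nu> = (b \<otimes>\<^bsub>A\<^esub> reverse T e) (T - \<nu>)"
proof -
  have le: "\<nu> + \<mu> \<le> T \<longleftrightarrow> \<mu> \<le> T - \<nu>" for \<mu>
    using le_funD[OF \<nu>] unfolding le_fun_def by (simp add: le_diff_conv2 add.commute)
  have sub: "T - (T - \<nu> - \<mu>) = \<nu> + \<mu>" if "\<mu> \<le> T - \<nu>" for \<mu>
    using that le fun_diff_diff_cancel[of "\<nu> + \<mu>" T] by (simp add: fun_diff_diff)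
  have "act b e \<nu> = (\<Oplus>\<mu>\<in>{..T - \<nu>}. b \<mu> \<otimes> e (\<nu> + \<mu>))"
    unfolding act_def using T b e le by (intro pairing_sum) (auto intro: finite_atMost_exps[of _ i])
  also have "\<dots> = (\<Oplus>\<mu>\<in>{..T - \<nu>}. b \<mu> \<otimes> reverse T e (T - \<nu> - \<mu>))"
    using e coeff_closed[OF b] sub by (intro finsum_cong') (auto simp: reverse_def fun_diff_diff)
  finally show ?thesis using T by (simp add: A_mult)
qed

lemma act_out:
  assumes "\<And>\<nu>. \<not> \<nu> \<le> T \<Longrightarrow> e \<nu> = \<zero>" "\<not> \<nu> \<le> T"
  shows "act b e \<nu> = \<zero>"
proof -
  have "e (\<nu> + \<mu>) = \<zero>" for \<mu>
    using assms(2) fun_add_leD by (intro assms(1)) blast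
  then show ?thesis by (simp add: act_def pairing_def)
qed

lemma act_coeff:
  assumes "b \<in> carrier A" "e \<in> dual"
  shows "act b e \<nu> \<in> carrier C"
  unfolding act_def pairing_def using coeff_closed[OF assms(1)] dual_coeff[OF assms(2)] by (intro finsum_closed) auto

lemma act_closed:
  assumes "b \<in> carrier A" "e \<in> dual"
  shows "act b e \<in> dual"
proof -
  obtain T where T: "T \<in> exps i" "\<And>\<nu>. \<not> \<nu> \<le> T \<Longrightarrow> e \<nu> = \<zero>" using dualE assms by metis
  then show ?thesis using act_coeff[OF assms] act_out[OF T(2)] by (intro dualI[of T]) auto
qed

lemma reverse_act:
  assumes "T \<in> exps i" "b \<in> carrier A" "e \<in> dual" "\<And>\<nu>. \<not> \<nu> \<le> T \<Longrightarrow> e \<nu> = \<zero>" "\<kappa> \<le> T"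
  shows "reverse T (act b e) \<kappa> = (b \<otimes>\<^bsub>A\<^esub> reverse T e) \<kappa>"
  using assms act_reverse[of T b e "T - \<kappa>"] dual_coeff[OF assms(3)]
  by (simp add: reverse_def fun_diff_diff_cancel)

text \<open>Written with \<open>reverse\<close>, both sides are the coefficient at \<open>T\<close>
  of the product of \<open>f\<close>, \<open>b\<close> and the numerator of
  \<open>e\<close>.\<close>

lemma pairing_act:
  assumes f: "f \<in> carrier A" and b: "b \<in> carrier A" and e: "e \<in> dual"
  shows "pairing f (act b e) = pairing (f \<otimes>\<^bsub>A\<^esub> b) e"
proof -
  obtain T where T: "T \<in> exps i" "\<And>\<nu>. \<not> \<nu> \<le> T \<Longrightarrow> e \<nu> = \<zero>" using dualE e by metis
  note ec = dual_coeff[OF e] act_coeff[OF b e]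
  have "pairing f (act b e) = (f \<otimes>\<^bsub>A\<^esub> reverse T (act b e)) T"
    using T f ec act_out[OF T(2)] by (intro pairing_reverse) auto
  also have "\<dots> = (f \<otimes>\<^bsub>A\<^esub> (b \<otimes>\<^bsub>A\<^esub> reverse T e)) T"
    using T f b e ec by (intro A_mult_cong) (auto simp: reverse_act reverse_closed)
  also have "\<dots> = ((f \<otimes>\<^bsub>A\<^esub> b) \<otimes>\<^bsub>A\<^esub> reverse T e) T"
    using T f b ec by (simp add: A.m_assoc reverse_closed)
  also have "\<dots> = pairing (f \<otimes>\<^bsub>A\<^esub> b) e"
    using T f b ec by (intro pairing_reverse[symmetric]) auto
  finally show ?thesis .
qed

definition scale :: "'a \<Rightarrow> ((nat \<Rightarrow> nat) \<Rightarrow> 'a) \<Rightarrow> (nat \<Rightarrow> nat) \<Rightarrow> 'a"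
  where "scale c e = (\<lambda>\<nu>. c \<otimes> e \<nu>)"

lemma dual_scale: "c \<in> carrier C \<Longrightarrow> e \<in> dual \<Longrightarrow> scale c e \<in> dual"
  using dual_coeff[of e] by (auto elim!: dualE intro!: dualI simp: scale_def)

lemma dual_zero: "\<zero>\<^bsub>A\<^esub> \<in> dual"
  by (auto intro!: dualI[of 0])

lemma dual_minus:
  assumes "e \<in> dual" "e' \<in> dual"
  shows "e \<ominus>\<^bsub>A\<^esub> e' \<in> dual"
proof -
  obtain T where T: "T \<in> exps i" "\<And>\<nu>. \<not> \<nu> \<le> T \<Longrightarrow> e \<nu> = \<zero>" using dualE assms by metis
  obtain T' where T': "T' \<in> exps i" "\<And>\<nu>. \<not> \<nu> \<le> T' \<Longrightarrow> e' \<nu> = \<zero>" using dualE assms by metis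
  show ?thesis
  proof (rule dualI[of "T + T'"])
    fix \<nu> assume "\<not> \<nu> \<le> T + T'"
    then have "\<not> \<nu> \<le> T" "\<not> \<nu> \<le> T'" using fun_le_addI by blast+
    then show "(e \<ominus>\<^bsub>A\<^esub> e') \<nu> = \<zero>" using T T' assms by (simp add: dual_A)
  qed (use T T' assms dual_coeff in \<open>auto simp: dual_A\<close>)
qed

lemma pairing_minus:
  assumes f: "f \<in> carrier A" and e: "e \<in> dual" and e': "e' \<in> dual"
  shows "pairing f (e \<ominus>\<^bsub>A\<^esub> e') = pairing f e \<ominus> pairing f e'"
proof -
  obtain T where T: "T \<in> exps i" "\<And>\<nu>. \<not> \<nu> \<le> T \<Longrightarrow> e \<nu> = \<zero>" using dualE e by metis
  obtain T' where T': "T' \<in> exps i" "\<And>\<nu>. \<not> \<nu> \<le> T' \<Longrightarrow> e' \<nu> = \<zero>" using dualE e' by metis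
  have le: "\<not> \<nu> \<le> T \<and> \<not> \<nu> \<le> T'" if "\<not> \<nu> \<le> T + T'" for \<nu> 
    using that fun_le_addI by blast
  note [simp] = coeff_closed[OF f] dual_coeff[OF e] dual_coeff[OF e'] dual_coeff[OF dual_minus[OF e e']]
  have S: "finite {..T + T'}" using T T' by (intro finite_atMost_exps[of _ i]) auto
  have "pairing f (e \<ominus>\<^bsub>A\<^esub> e') = (\<Oplus>\<nu>\<in>{..T + T'}. f \<nu> \<otimes> (e \<ominus>\<^bsub>A\<^esub> e') \<nu>)"
    using S f le T T' e e' by (intro pairing_sum) (auto simp: dual_A)
  also have "\<dots> = (\<Oplus>\<nu>\<in>{..T + T'}. f \<nu> \<otimes> e \<nu> \<oplus> (\<ominus> \<one>) \<otimes> (f \<nu> \<otimes> e' \<nu>))"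
    using e e' by (intro finsum_cong') (auto simp: dual_A minus_eq r_distr r_minus l_minus)
  also have "\<dots> = (\<Oplus>\<nu>\<in>{..T + T'}. f \<nu> \<otimes> e \<nu>) \<oplus> (\<Oplus>\<nu>\<in>{..T + T'}. (\<ominus> \<one>) \<otimes> (f \<nu> \<otimes> e' \<nu>))"
    by (intro finsum_addf) auto
  also have "\<dots> = (\<Oplus>\<nu>\<in>{..T + T'}. f \<nu> \<otimes> e \<nu>) \<oplus> (\<ominus> \<one>) \<otimes> (\<Oplus>\<nu>\<in>{..T + T'}. f \<nu> \<otimes> e' \<nu>)"
    using S by (subst finsum_rdistr) auto
  also have "(\<Oplus>\<nu>\<in>{..T + T'}. f \<nu> \<otimes> e \<nu>) = pairing f e"
    using S f le T by (intro pairing_sum[symmetric]) auto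
  also have "(\<Oplus>\<nu>\<in>{..T + T'}. f \<nu> \<otimes> e' \<nu>) = pairing f e'"
    using S f le T' by (intro pairing_sum[symmetric]) auto
  finally show ?thesis using pairing_closed[OF f e] pairing_closed[OF f e'] by (simp add: minus_eq l_minus)
qed

lemma pairing_scale:
  assumes f: "f \<in> carrier A" and e: "e \<in> dual" and c: "c \<in> carrier C"
  shows "pairing f (scale c e) = c \<otimes> pairing f e"
proof -
  obtain T where T: "T \<in> exps i" "\<And>\<nu>. \<not> \<nu> \<le> T \<Longrightarrow> e \<nu> = \<zero>" using dualE e by metis
  note [simp] = coeff_closed[OF f] dual_coeff[OF e] 
  have S: "finite {..T}" using T by auto
  have "pairing f (scale c e) = (\<Oplus>\<nu>\<in>{..T}. f \<nu> \<otimes> scale c e \<nu>)"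
    using S f T c by (intro pairing_sum) (auto simp: scale_def)
  also have "\<dots> = (\<Oplus>\<nu>\<in>{..T}. c \<otimes> (f \<nu> \<otimes> e \<nu>))"
    using c by (intro finsum_cong') (auto simp: scale_def m_ac)
  also have "\<dots> = c \<otimes> (\<Oplus>\<nu>\<in>{..T}. f \<nu> \<otimes> e \<nu>)" using S c by (subst finsum_rdistr) auto
  also have "(\<Oplus>\<nu>\<in>{..T}. f \<nu> \<otimes> e \<nu>) = pairing f e"
    using S f T by (intro pairing_sum[symmetric]) auto
  finally show ?thesis .
qed

lemma dual_shift:
  assumes "e \<in> dual" "\<nu> \<in> exps i"
  shows "(\<lambda>\<mu>. e (\<nu> + \<mu>)) \<in> dual"
proof -
  obtain T where T: "T \<in> exps i" "\<And>\<nu>. \<not> \<nu> \<le> T \<Longrightarrow> e \<nu> = \<zero>" using dualE assms by metis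
  have "\<not> \<mu> \<le> T \<Longrightarrow> \<not> \<nu> + \<mu> \<le> T" for \<mu> using fun_add_leD by blast
  then show ?thesis using T dual_coeff[OF assms(1)] by (intro dualI[of T]) auto
qed

lemma act_minus:
  assumes b: "b \<in> carrier A" and e: "e \<in> dual" and e': "e' \<in> dual"
  shows "act b (e \<ominus>\<^bsub>A\<^esub> e') = act b e \<ominus>\<^bsub>A\<^esub> act b e'"
proof
  fix \<nu>
  note c = act_closed[OF b e] act_closed[OF b e'] act_closed[OF b dual_minus[OF e e']]
  show "act b (e \<ominus>\<^bsub>A\<^esub> e') \<nu> = (act b e \<ominus>\<^bsub>A\<^esub> act b e') \<nu>"
  proof (cases "\<nu> \<in> exps i")
    case True
    have "(\<lambda>\<mu>. (e \<ominus>\<^bsub>A\<^esub> e') (\<nu> + \<mu>)) = (\<lambda>\<mu>. e (\<nu> + \<mu>)) \<ominus>\<^bsub>A\<^esub> (\<lambda>\<mu>. e' (\<nu> + \<mu>))"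
      using e e' dual_shift[OF e True] dual_shift[OF e' True] by (simp add: fun_eq_iff dual_A)
    then show ?thesis
      unfolding act_def[of b "e \<ominus>\<^bsub>A\<^esub> e'"] using c b dual_shift[OF e True] dual_shift[OF e' True]
      by (simp add: pairing_minus dual_A act_def[symmetric])
  next
    case False
    then show ?thesis using c by (simp add: dual_A coeff_out[OF dual_A] minus_eq)
  qed
qed

lemma act_scale:
  assumes b: "b \<in> carrier A" and e: "e \<in> dual" and c: "c \<in> carrier C"
  shows "act b (scale c e) = scale c (act b e)"
proof
  fix \<nu>
  show "act b (scale c e) \<nu> = scale c (act b e) \<nu>"
  proof (cases "\<nu> \<in> exps i")
    case True
    have "(\<lambda>\<mu>. scale c e (\<nu> + \<mu>)) = scale c (\<lambda>\<mu>. e (\<nu> + \<mu>))" by (simp add: scale_def)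
    then show ?thesis
      unfolding act_def[of b "scale c e"] using b c dual_shift[OF e True]
      by (simp add: pairing_scale) (simp add: scale_def act_def)
  next
    case False
    then show ?thesis
      using c coeff_out[OF dual_A[OF act_closed[OF b e]]] coeff_out[OF dual_A[OF act_closed[OF b dual_scale[OF c e]]]]
      by (simp add: scale_def)
  qed
qed

lemma dual_monomial: "\<nu> \<in> exps i \<Longrightarrow> monomial \<one> \<nu> \<in> dual"
  by (intro dualI[of \<nu>]) (auto simp: monomial_def)

lemma pairing_monomial:
  assumes f: "f \<in> carrier A" and "\<nu> \<in> exps i"
  shows "pairing f (monomial \<one> \<nu>) = f \<nu>"
proof -
  have "pairing f (monomial \<one> \<nu>) = (\<Oplus>\<mu>\<in>{\<nu>}. f \<mu> \<otimes> monomial \<one> \<nu> \<mu>)"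
    using f by (intro pairing_sum) (auto simp: monomial_def)
  then show ?thesis using coeff_closed[OF f] by (simp add: monomial_def)
qed

lemma pairing_zero_imp_zero:
  assumes f: "f \<in> carrier A" and "\<And>e. e \<in> dual \<Longrightarrow> pairing f e = \<zero>"
  shows "f = \<zero>\<^bsub>A\<^esub>"
proof
  fix \<nu>
  show "f \<nu> = \<zero>\<^bsub>A\<^esub> \<nu>"
    using pairing_monomial[OF f, of \<nu>] assms(2)[OF dual_monomial, of \<nu>] coeff_out[OF f, of \<nu>]
    by (cases "\<nu> \<in> exps i") auto
qed

section \<open>Linear functionals and divisibility in the dual\<close>

text \<open>The filtration of \<open>dual\<close> by keys. It exhausts \<open>dual\<close>, and
  since keys are injective each step adds at most one coordinate, so an induction on
  \<open>N\<close> is Gaussian elimination.\<close>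

definition below :: "nat \<Rightarrow> ((nat \<Rightarrow> nat) \<Rightarrow> 'a) \<Rightarrow> bool"
  where "below N e \<longleftrightarrow> (\<forall>\<nu>. e \<nu> \<noteq> \<zero> \<longrightarrow> key \<nu> < N)"

lemma below_exists:
  assumes "e \<in> dual" shows "\<exists>N. below N e"
proof -
  obtain T where T: "T \<in> exps i" "\<And>\<nu>. \<not> \<nu> \<le> T \<Longrightarrow> e \<nu> = \<zero>" using dualE assms by metis
  then have "below (Suc (key T)) e" unfolding below_def using exp_key_mono le_imp_less_Suc by blast
  then show ?thesis by blast
qed

lemma below_zero: "e \<in> dual \<Longrightarrow> below 0 e \<Longrightarrow> e = \<zero>\<^bsub>A\<^esub>"
  by (auto simp: below_def A_zero_eq)

lemma below_reduce:
  assumes e: "e \<in> dual" "below (Suc N) e" and w: "w \<in> dual" "w \<mu> = \<one>" "below (Suc N) w"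
    and \<mu>: "\<mu> \<in> exps i" "key \<mu> = N"
  shows "below N (e \<ominus>\<^bsub>A\<^esub> scale (e \<mu>) w)"
  unfolding below_def
proof (intro allI impI)
  fix \<nu> assume nz: "(e \<ominus>\<^bsub>A\<^esub> scale (e \<mu>) w) \<nu> \<noteq> \<zero>"
  note c = dual_coeff[OF e(1)] dual_coeff[OF w(1)]
  have eq: "(e \<ominus>\<^bsub>A\<^esub> scale (e \<mu>) w) \<nu> = e \<nu> \<ominus> e \<mu> \<otimes> w \<nu>"
    using e w c dual_scale[of "e \<mu>" w] by (simp add: dual_A scale_def)
  have \<nu>: "\<nu> \<in> exps i"
    using nz coeff_out[OF dual_A[OF dual_minus[OF e(1) dual_scale[OF c(1) w(1)]]]] by metis
  have "key \<nu> < Suc N"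
  proof (rule ccontr)
    assume "\<not> key \<nu> < Suc N"
    then have "e \<nu> = \<zero>" "w \<nu> = \<zero>" using e(2) w(3) unfolding below_def by auto
    then show False using nz eq c by (simp add: minus_eq)
  qed
  moreover have "key \<nu> \<noteq> N"
  proof
    assume "key \<nu> = N"
    then have "\<nu> = \<mu>" using exp_key_inj \<nu> \<mu> by metis
    then show False using nz eq w(2) c by (simp add: minus_eq r_neg)
  qed
  ultimately show "key \<nu> < N" by simp
qed

end

context field_power_series
begin

lemma below_cases:
  assumes "e \<in> dual" "below (Suc N) e"
  shows "below N e \<or> (\<exists>\<mu>\<in>exps i. key \<mu> = N \<and> e \<mu> \<noteq> \<zero>)"
  using assms coeff_out[OF dual_A[OF assms(1)]] unfolding below_def by (metis less_Suc_eq)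

text \<open>
  Solve for the coefficients of \<open>f\<close> recursively: the leading exponents occurring in \<open>W\<close>
  determine equations in echelon form, and a missing leading exponent is a free variable.
\<close>

lemma separating_functional:
  assumes W: "W \<subseteq> dual" "\<zero>\<^bsub>A\<^esub> \<in> W"
    and W_minus: "\<And>w w'. w \<in> W \<Longrightarrow> w' \<in> W \<Longrightarrow> w \<ominus>\<^bsub>A\<^esub> w' \<in> W"
    and W_scale: "\<And>c w. c \<in> carrier C \<Longrightarrow> w \<in> W \<Longrightarrow> scale c w \<in> W"
    and "W \<noteq> dual"
  shows "\<exists>f\<in>carrier A. f \<noteq> \<zero>\<^bsub>A\<^esub> \<and> (\<forall>w\<in>W. pairing f w = \<zero>)"
proof -
  \<comment> \<open>The highest exponents of elements of \<open>W\<close>, here highest with respect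
    to the key since elements of \<open>dual\<close> have finite support; the highest coefficient is
    normalised to one.\<close>
  define S where "S = {\<nu> \<in> exps i. \<exists>w\<in>W. w \<nu> = \<one> \<and> below (Suc (key \<nu>)) w}"
  then have "\<forall>\<nu>\<in>S. \<exists>w. w \<in> W \<and> w \<nu> = \<one> \<and> below (Suc (key \<nu>)) w" by blast
  then obtain v where v: "\<And>\<nu>. \<nu> \<in> S \<Longrightarrow> v \<nu> \<in> W \<and> v \<nu> \<nu> = \<one> \<and> below (Suc (key \<nu>)) (v \<nu>)" by metis
  have vd: "v \<nu> \<in> dual" "\<nu> \<in> exps i" if "\<nu> \<in> S" for \<nu> using that v W S_def by auto
  have vc: "v \<nu> \<mu> \<in> carrier C" if "\<nu> \<in> S" for \<nu> \<mu> using that vd dual_coeff by blast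
  have "S \<noteq> exps i"
  proof
    assume S: "S = exps i"
    \<comment> \<open>If every exponent were the highest one of some element of \<open>W\<close>,
      elimination would exhaust all of \<open>dual\<close>.\<close>
    have "e \<in> W" if "e \<in> dual" "below N e" for N e
      using that
    proof (induction N arbitrary: e)
      case 0
      then show ?case using below_zero W by metis
    next
      case (Suc N)
      show ?case
      proof (cases "below N e")
        case False
        then obtain \<mu> where \<mu>: "\<mu> \<in> exps i" "key \<mu> = N" using below_cases Suc.prems by blast
        then have \<mu>v: "v \<mu> \<in> W" "v \<mu> \<mu> = \<one>" "below (Suc N) (v \<mu>)" "v \<mu> \<in> dual" using v S vd by auto
        have ec: "e \<mu> \<in> carrier C" using dual_coeff Suc.prems by blast
        let ?s = "scale (e \<mu>) (v \<mu>)"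
        have s: "?s \<in> W" "?s \<in> dual" using W_scale ec \<mu>v dual_scale by auto
        have "e \<ominus>\<^bsub>A\<^esub> ?s \<in> W"
          using Suc below_reduce[OF Suc.prems \<mu>v(4,2,3) \<mu>] dual_minus s by blast
        \<comment> \<open>Sums are written as iterated differences, because \<open>W\<close> is only
          assumed closed under differences.\<close>
        then have "(e \<ominus>\<^bsub>A\<^esub> ?s) \<ominus>\<^bsub>A\<^esub> (\<zero>\<^bsub>A\<^esub> \<ominus>\<^bsub>A\<^esub> ?s) \<in> W" using W_minus W s by blast
        moreover have "(e \<ominus>\<^bsub>A\<^esub> ?s) \<ominus>\<^bsub>A\<^esub> (\<zero>\<^bsub>A\<^esub> \<ominus>\<^bsub>A\<^esub> ?s) = e"
          using dual_A[OF Suc.prems(1)] dual_A[OF s(2)] by (simp add: A.minus_eq A.a_assoc A.l_neg)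
        ultimately show ?thesis by simp
      qed (use Suc in blast)
    qed
    then show False using assms(5) W below_exists by blast
  qed
  then obtain \<nu>\<^sub>0 where \<nu>\<^sub>0: "\<nu>\<^sub>0 \<in> exps i" "\<nu>\<^sub>0 \<notin> S" unfolding S_def by blast
  define L where "L \<nu> = {\<mu> \<in> exps i. key \<mu> < key \<nu>}" for \<nu>
  have Lfin: "finite (L \<nu>)" for \<nu> unfolding L_def by (rule finite_exp_key)
  define H where "H g \<nu> = (if \<nu> = \<nu>\<^sub>0 then \<one> else if \<nu> \<in> S then \<ominus> (\<Oplus>\<mu>\<in>L \<nu>. g \<mu> \<otimes> v \<nu> \<mu>) else \<zero>)" for g \<nu>
  define f where "f = wfrec (measure key) H"
  have f_rec: "f \<nu> = H (cut f (measure key) \<nu>) \<nu>" for \<nu>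
    unfolding f_def by (rule wfrec) simp
  have f_cl: "f \<nu> \<in> carrier C" for \<nu>
  proof (induction "key \<nu>" arbitrary: \<nu> rule: less_induct)
    case less
    then have c: "cut f (measure key) \<nu> \<mu> \<in> carrier C" if "\<mu> \<in> L \<nu>" for \<mu>
      using that by (simp add: cut_def L_def)
    have "\<nu> \<in> S \<Longrightarrow> (\<Oplus>\<mu>\<in>L \<nu>. cut f (measure key) \<nu> \<mu> \<otimes> v \<nu> \<mu>) \<in> carrier C"
      using c vc by (intro finsum_closed) auto
    then show ?case unfolding f_rec[of \<nu>] H_def by simp
  qed
  have fS: "f \<nu> = \<ominus> (\<Oplus>\<mu>\<in>L \<nu>. f \<mu> \<otimes> v \<nu> \<mu>)" if "\<nu> \<in> S" for \<nu>
  proof -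
    have "(\<Oplus>\<mu>\<in>L \<nu>. cut f (measure key) \<nu> \<mu> \<otimes> v \<nu> \<mu>) = (\<Oplus>\<mu>\<in>L \<nu>. f \<mu> \<otimes> v \<nu> \<mu>)"
      using f_cl vc[OF that] by (intro finsum_cong') (auto simp: cut_def L_def)
    then show ?thesis unfolding f_rec[of \<nu>] using that \<nu>\<^sub>0 by (auto simp: H_def)
  qed
  have "f \<nu> = \<zero>" if "\<nu> \<notin> exps i" for \<nu>
    using that \<nu>\<^sub>0 unfolding f_rec[of \<nu>] H_def S_def by auto
  then have fA: "f \<in> carrier A" using f_cl by (intro A_carrierI) auto
  have f0: "f \<nu>\<^sub>0 = \<one>" unfolding f_rec[of \<nu>\<^sub>0] H_def by simp
  have fv: "pairing f (v \<nu>) = \<zero>" if \<nu>: "\<nu> \<in> S" for \<nu>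
  proof -
    have "pairing f (v \<nu>) = (\<Oplus>\<mu>\<in>insert \<nu> (L \<nu>). f \<mu> \<otimes> v \<nu> \<mu>)"
    proof (rule pairing_sum)
      fix \<mu> assume \<mu>: "\<mu> \<notin> insert \<nu> (L \<nu>)"
      show "v \<nu> \<mu> = \<zero>"
      proof (rule ccontr)
        assume nz: "v \<nu> \<mu> \<noteq> \<zero>"
        then have "\<mu> \<in> exps i" using coeff_out[OF dual_A[OF vd(1)[OF \<nu>]]] by blast
        moreover have "key \<mu> < Suc (key \<nu>)" using v[OF \<nu>] nz unfolding below_def by blast
        ultimately show False using \<mu> exp_key_inj[of \<mu> i \<nu>] vd(2)[OF \<nu>] by (auto simp: L_def less_Suc_eq)
      qed
    qed (use Lfin fA vc[OF \<nu>] in auto)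
    also have "\<dots> = f \<nu> \<otimes> v \<nu> \<nu> \<oplus> (\<Oplus>\<mu>\<in>L \<nu>. f \<mu> \<otimes> v \<nu> \<mu>)"
      using Lfin f_cl vc[OF \<nu>] by (intro finsum_insert) (auto simp: L_def)
    also have "\<dots> = \<zero>"
      unfolding fS[OF \<nu>] using v[OF \<nu>] f_cl vc[OF \<nu>] by (simp add: l_neg finsum_closed Pi_def)
    finally show ?thesis .
  qed
  \<comment> \<open>The functional kills the chosen \<open>v \<nu>\<close> by construction.
    Elimination extends this to \<open>W\<close>, since a nonzero highest coefficient of an element
    of \<open>W\<close> can be normalised and so has its exponent in \<open>S\<close>.\<close>
  have "pairing f w = \<zero>" if "w \<in> W" "below N w" for N w
    using that
  proof (induction N arbitrary: w)
    case 0
    then have "w = \<zero>\<^bsub>A\<^esub>" using W below_zero by blast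
    then show ?case by (simp add: pairing_def)
  next
    case (Suc N)
    have wd: "w \<in> dual" using Suc W by blast
    show ?case
    proof (cases "below N w")
      case False
      then obtain \<mu> where \<mu>: "\<mu> \<in> exps i" "key \<mu> = N" "w \<mu> \<noteq> \<zero>" using below_cases[OF wd Suc.prems(2)] by blast
      have wc: "w \<mu> \<in> carrier C" "w \<mu> \<in> Units C" using dual_coeff[OF wd] \<mu>(3) field_Units by auto
      have "scale (inv (w \<mu>)) w \<in> W" using W_scale wc Suc.prems by simp
      moreover have "scale (inv (w \<mu>)) w \<mu> = \<one>" using wc by (simp add: scale_def)
      moreover have "below (Suc (key \<mu>)) (scale (inv (w \<mu>)) w)"
        unfolding below_def scale_def
      proof (intro allI impI)
        fix \<nu> assume "inv (w \<mu>) \<otimes> w \<nu> \<noteq> \<zero>"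
        then have "w \<nu> \<noteq> \<zero>" using wc by auto
        then show "key \<nu> < Suc (key \<mu>)" using Suc.prems(2) \<mu>(2) unfolding below_def by simp
      qed
      ultimately have \<mu>S: "\<mu> \<in> S" using \<mu> S_def by blast
      let ?s = "scale (w \<mu>) (v \<mu>)"
      have s: "?s \<in> W" "?s \<in> dual" using W_scale wc v[OF \<mu>S] vd[OF \<mu>S] dual_scale by auto
      have "pairing f (w \<ominus>\<^bsub>A\<^esub> ?s) = \<zero>"
        using Suc.IH[OF W_minus[OF Suc.prems(1) s(1)]] below_reduce[OF wd Suc.prems(2) vd(1)[OF \<mu>S]] v[OF \<mu>S] \<mu> by blast
      then have "pairing f w \<ominus> w \<mu> \<otimes> pairing f (v \<mu>) = \<zero>"
        using fA wd s vd(1)[OF \<mu>S] wc by (simp add: pairing_minus pairing_scale)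
      then show ?thesis using fv[OF \<mu>S] wc pairing_closed[OF fA wd] by (simp add: minus_eq)
    qed (use Suc in blast)
  qed
  moreover have "f \<noteq> \<zero>\<^bsub>A\<^esub>" using f0 by auto
  ultimately show ?thesis using fA below_exists W by blast
qed

text \<open>Divisibility of \<open>dual\<close> by duality: otherwise some nonzero \<open>f\<close>
  kills the image of the action of \<open>b\<close>, which means \<open>f b = 0\<close> in a
  domain.\<close>

lemma act_surjective:
  assumes b: "b \<in> carrier A" "b \<noteq> \<zero>\<^bsub>A\<^esub>" and "e \<in> dual"
  shows "\<exists>e'\<in>dual. act b e' = e"
proof (rule ccontr)
  assume n: "\<not> ?thesis"
  have "\<exists>f\<in>carrier A. f \<noteq> \<zero>\<^bsub>A\<^esub> \<and> (\<forall>w\<in>act b ` dual. pairing f w = \<zero>)"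
  proof (rule separating_functional)
    show "act b ` dual \<subseteq> dual" using act_closed b by auto
    have "act b \<zero>\<^bsub>A\<^esub> = \<zero>\<^bsub>A\<^esub>" by (simp add: fun_eq_iff act_def pairing_def)
    then show "\<zero>\<^bsub>A\<^esub> \<in> act b ` dual" using dual_zero by (metis imageI)
    show "w \<ominus>\<^bsub>A\<^esub> w' \<in> act b ` dual" if w: "w \<in> act b ` dual" "w' \<in> act b ` dual" for w w'
    proof -
      obtain u u' where u: "u \<in> dual" "w = act b u" "u' \<in> dual" "w' = act b u'" using w by blast
      then have "w \<ominus>\<^bsub>A\<^esub> w' = act b (u \<ominus>\<^bsub>A\<^esub> u')" using act_minus[OF b(1)] by simp
      then show ?thesis using dual_minus u by blast
    qed
    show "scale c w \<in> act b ` dual" if c: "c \<in> carrier C" and w: "w \<in> act b ` dual" for c w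
    proof -
      obtain u where u: "u \<in> dual" "w = act b u" using w by blast
      then have "scale c w = act b (scale c u)" using act_scale[OF b(1)] c by simp
      then show ?thesis using dual_scale u c by blast
    qed
    have "e \<notin> act b ` dual" using n by auto
    then show "act b ` dual \<noteq> dual" using assms(3) by metis
  qed
  then obtain f where f: "f \<in> carrier A" "f \<noteq> \<zero>\<^bsub>A\<^esub>" "\<And>e. e \<in> dual \<Longrightarrow> pairing f (act b e) = \<zero>" by blast
  then have "f \<otimes>\<^bsub>A\<^esub> b = \<zero>\<^bsub>A\<^esub>" using b pairing_act by (intro pairing_zero_imp_zero) auto
  then show False using f b A.integral by blast
qed

text \<open>
  By surjectivity of the action of \<open>b\<close>, the functional \<open>\<eta> \<mapsto> pairing g \<xi>\<close> with \<open>b \<cdot> \<xi> = \<eta>\<close>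
  is well defined; the power series representing it is the quotient.
\<close>

lemma divides_if_annihilator:
  assumes b: "b \<in> carrier A" "b \<noteq> \<zero>\<^bsub>A\<^esub>" and g: "g \<in> carrier A"
    and ann: "\<And>e. e \<in> dual \<Longrightarrow> act b e = \<zero>\<^bsub>A\<^esub> \<Longrightarrow> pairing g e = \<zero>"
  shows "\<exists>h\<in>carrier A. g = h \<otimes>\<^bsub>A\<^esub> b"
proof -
  have "\<forall>\<nu>\<in>exps i. \<exists>e. e \<in> dual \<and> act b e = monomial \<one> \<nu>" using act_surjective[OF b dual_monomial] by blast
  then obtain \<xi> where \<xi>: "\<And>\<nu>. \<nu> \<in> exps i \<Longrightarrow> \<xi> \<nu> \<in> dual \<and> act b (\<xi> \<nu>) = monomial \<one> \<nu>" by metis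
  define h where "h \<nu> = (if \<nu> \<in> exps i then pairing g (\<xi> \<nu>) else \<zero>)" for \<nu>
  have h: "h \<in> carrier A" using \<xi> g by (intro A_carrierI) (auto simp: h_def intro: pairing_closed)
  have hb: "h \<otimes>\<^bsub>A\<^esub> b \<in> carrier A" using h b by auto
  have "pairing (h \<otimes>\<^bsub>A\<^esub> b) e = pairing g e" if "e \<in> dual" "below N (act b e)" for N e
    using that
  proof (induction N arbitrary: e)
    case 0
    \<comment> \<open>Here alone the hypothesis on annihilators enters: it makes the values of
      \<open>g\<close> independent of the chosen preimages.\<close>
    then have "act b e = \<zero>\<^bsub>A\<^esub>" using below_zero act_closed b by blast
    then show ?case using 0 ann pairing_act[OF h b(1), of e] by (simp add: pairing_def[of h])
  next
    case (Suc N)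
    have ad: "act b e \<in> dual" using Suc act_closed b by blast
    show ?case
    proof (cases "below N (act b e)")
      case False
      then obtain \<mu> where \<mu>: "\<mu> \<in> exps i" "key \<mu> = N" using below_cases[OF ad Suc.prems(2)] by blast
      have \<xi>\<mu>: "\<xi> \<mu> \<in> dual" "act b (\<xi> \<mu>) = monomial \<one> \<mu>" using \<xi> \<mu> by auto
      let ?c = "act b e \<mu>"
      have c: "?c \<in> carrier C" using dual_coeff[OF ad] .
      let ?e = "e \<ominus>\<^bsub>A\<^esub> scale ?c (\<xi> \<mu>)"
      have e: "?e \<in> dual" using Suc.prems dual_minus dual_scale c \<xi>\<mu> by blast
      have "act b ?e = act b e \<ominus>\<^bsub>A\<^esub> scale ?c (monomial \<one> \<mu>)"
        using Suc.prems b c \<xi>\<mu> by (simp add: act_minus act_scale dual_scale)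
      moreover have "below N \<dots>"
        using \<mu> by (intro below_reduce[OF ad Suc.prems(2) dual_monomial]) (auto simp: monomial_def below_def)
      ultimately have IH: "pairing (h \<otimes>\<^bsub>A\<^esub> b) ?e = pairing g ?e" using Suc.IH[OF e] by simp
      have "pairing (h \<otimes>\<^bsub>A\<^esub> b) (\<xi> \<mu>) = pairing h (monomial \<one> \<mu>)"
        using pairing_act[OF h b(1) \<xi>\<mu>(1)] \<xi>\<mu>(2) by simp
      also have "\<dots> = pairing g (\<xi> \<mu>)" using pairing_monomial[OF h] \<mu> by (simp add: h_def)
      finally have eq: "pairing (h \<otimes>\<^bsub>A\<^esub> b) (\<xi> \<mu>) = pairing g (\<xi> \<mu>)" .
      have "pairing (h \<otimes>\<^bsub>A\<^esub> b) e \<ominus> ?c \<otimes> pairing g (\<xi> \<mu>) = pairing g e \<ominus> ?c \<otimes> pairing g (\<xi> \<mu>)"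
        using IH Suc.prems c \<xi>\<mu> g hb eq by (simp add: pairing_minus pairing_scale dual_scale)
      then show ?thesis
        using pairing_closed[OF hb Suc.prems(1)] pairing_closed[OF g Suc.prems(1)] pairing_closed[OF g \<xi>\<mu>(1)] c
        by (simp add: minus_eq)
    qed (use Suc in blast)
  qed
  then have eq: "pairing (h \<otimes>\<^bsub>A\<^esub> b) e = pairing g e" if "e \<in> dual" for e
    using that below_exists[OF act_closed[OF b(1) that]] by blast
  have "h \<otimes>\<^bsub>A\<^esub> b = g"
  proof
    fix \<nu> show "(h \<otimes>\<^bsub>A\<^esub> b) \<nu> = g \<nu>"
      using eq[OF dual_monomial, of \<nu>] pairing_monomial[OF g, of \<nu>] pairing_monomial[OF hb, of \<nu>]
        coeff_out[OF g, of \<nu>] coeff_out[OF hb, of \<nu>] by (cases "\<nu> \<in> exps i") auto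
  qed
  then show ?thesis using h by blast
qed

end

section \<open>Division with remainder zero\<close>

lemma nat_mono_subseq:
  fixes a :: "nat \<Rightarrow> nat"
  shows "\<exists>r :: nat \<Rightarrow> nat. strict_mono r \<and> mono (\<lambda>n. a (r n))"
proof -
  \<comment> \<open>Each next index is a position where the remaining tail attains its
    minimum.\<close>
  have "\<exists>m>n. \<forall>m'>n. a m \<le> a m'" for n
    using ex_has_least_nat[of "\<lambda>m. n < m" "Suc n" a] by blast
  then obtain F where F: "\<And>n. F n > n" "\<And>n m'. m' > n \<Longrightarrow> a (F n) \<le> a m'" by metis
  define r where "r = rec_nat (F 0) (\<lambda>_. F)"
  have r: "r 0 = F 0" "\<And>n. r (Suc n) = F (r n)" by (simp_all add: r_def)
  have sm: "strict_mono r" using F by (simp add: strict_mono_Suc_iff r)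
  have "a (r n) \<le> a (r (Suc n))" for n
  proof (cases n)
    case 0
    show ?thesis unfolding 0 r using F(1) by (intro F(2)) (meson less_trans)
  next
    case (Suc m)
    show ?thesis unfolding Suc r using F(1) by (intro F(2)) (meson less_trans)
  qed
  then have "mono (\<lambda>n. a (r n))" by (simp add: mono_iff_le_Suc)
  then show ?thesis using sm by blast
qed

text \<open>Subsequences are refined one coordinate at a time; a coordinate that is already monotone
  stays so.\<close>

lemma exps_mono_subseq:
  fixes s :: "nat \<Rightarrow> nat \<Rightarrow> nat"
  assumes "\<And>n. s n \<in> exps i"
  shows "\<exists>r :: nat \<Rightarrow> nat. strict_mono r \<and> mono (\<lambda>n. s (r n))"
proof -
  have "\<exists>r :: nat \<Rightarrow> nat. strict_mono r \<and> (\<forall>j<l. mono (\<lambda>n. s (r n) j))" for l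
  proof (induction l)
    case 0
    show ?case using strict_mono_id by auto
  next
    case (Suc l)
    then obtain r :: "nat \<Rightarrow> nat" where r: "strict_mono r" "\<And>j. j < l \<Longrightarrow> mono (\<lambda>n. s (r n) j)" by blast
    obtain r' :: "nat \<Rightarrow> nat" where r': "strict_mono r'" "mono (\<lambda>n. s (r (r' n)) l)"
      using nat_mono_subseq[of "\<lambda>n. s (r n) l"] by blast
    have "mono (\<lambda>n. s (r (r' n)) j)" if "j < l" for j
      using r(2)[OF that] r'(1) unfolding mono_def by (simp add: strict_mono_less_eq)
    then have "\<forall>j<Suc l. mono (\<lambda>n. s ((r \<circ> r') n) j)" using r'(2) by (auto simp: less_Suc_eq)
    then show ?case using strict_mono_o[OF r(1) r'(1)] by blast
  qed
  then obtain r :: "nat \<Rightarrow> nat" where r: "strict_mono r" "\<And>j. j < i \<Longrightarrow> mono (\<lambda>n. s (r n) j)" by blast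
  have "s (r m) j \<le> s (r n) j" if "m \<le> n" for m n j
    using r(2)[of j] that assms by (cases "j < i") (auto simp: mono_def exps_def)
  then have "mono (\<lambda>n. s (r n))" by (simp add: mono_def le_fun_def)
  then show ?thesis using r by blast
qed

lemma dickson:
  assumes S: "S \<subseteq> exps i"
  shows "\<exists>G\<subseteq>S. finite G \<and> (\<forall>\<nu>\<in>S. \<exists>\<mu>\<in>G. \<mu> \<le> \<nu>)"
proof (rule ccontr)
  assume n: "\<not> ?thesis"
  have "\<exists>\<nu>. \<nu> \<in> S \<and> (\<forall>\<mu>\<in>G. \<not> \<mu> \<le> \<nu>)" if "finite G" "G \<subseteq> S" for G
    using n that by (metis (no_types))
  then have "\<forall>G. \<exists>\<nu>. finite G \<longrightarrow> G \<subseteq> S \<longrightarrow> \<nu> \<in> S \<and> (\<forall>\<mu>\<in>G. \<not> \<mu> \<le> \<nu>)" by (metis (no_types))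
  from choice[OF this] obtain c where c: "\<And>G. finite G \<Longrightarrow> G \<subseteq> S \<Longrightarrow> c G \<in> S \<and> (\<forall>\<mu>\<in>G. \<not> \<mu> \<le> c G)" by (metis (no_types))
  \<comment> \<open>A greedy sequence in which no member lies above an earlier one; a monotone
    subsequence contradicts this at its first two members.\<close>
  define H where "H = rec_nat {} (\<lambda>_ G. insert (c G) G)"
  have H: "H 0 = {}" "\<And>n. H (Suc n) = insert (c (H n)) (H n)" by (simp_all add: H_def)
  have HS: "finite (H n) \<and> H n \<subseteq> S" for n by (induction n) (use c in \<open>auto simp: H\<close>)
  have cS: "c (H n) \<in> exps i" for n using c[of "H n"] HS[of n] S by blast
  have Hm: "c (H m) \<in> H n" if "m < n" for m n
    using that by (induction n) (auto simp: H less_Suc_eq)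
  obtain r :: "nat \<Rightarrow> nat" where r: "strict_mono r" "mono (\<lambda>n. c (H (r n)))"
    using exps_mono_subseq[where s = "\<lambda>n. c (H n)" and i = i] cS by (metis (no_types, lifting))
  have "c (H (r 0)) \<le> c (H (r 1))" using r(2) by (simp add: mono_def)
  moreover have "c (H (r 0)) \<in> H (r 1)" using r(1) by (intro Hm) (simp add: strict_mono_less)
  ultimately show False using c[of "H (r 1)"] HS[of "r 1"] by blast
qed

section \<open>Division of power series\<close>

lemma (in ring) finsum_in_ideal:
  assumes I: "ideal I R" and f: "\<And>a. a \<in> S \<Longrightarrow> f a \<in> I"
  shows "finsum R f S \<in> I"
proof (cases "finite S")
  case True
  then show ?thesis using f
  proof (induction S rule: finite_induct)
    case empty
    then show ?case using additive_subgroup.zero_closed[OF ideal.axioms(1)[OF I]] by simp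
  next
    case (insert a S)
    have "finsum R f (insert a S) = f a \<oplus> finsum R f S"
      using insert ideal.Icarr[OF I] by (intro finsum_insert) auto
    then show ?case using insert additive_subgroup.a_closed[OF ideal.axioms(1)[OF I]] by simp
  qed
qed (use additive_subgroup.zero_closed[OF ideal.axioms(1)[OF I]] in \<open>simp add: finsum_infinite\<close>)

context field_power_series
begin

definition lead :: "((nat \<Rightarrow> nat) \<Rightarrow> 'a) \<Rightarrow> nat \<Rightarrow> nat"
  where "lead f = (SOME \<nu>. is_lead (exps i) f \<nu>)"

lemma lead_is: "f \<in> carrier A \<Longrightarrow> f \<noteq> \<zero>\<^bsub>A\<^esub> \<Longrightarrow> is_lead (exps i) f (lead f)"
  unfolding lead_def using A_nonzero_lead by (rule someI_ex)

lemma lead_eqI: "is_lead (exps i) f \<nu> \<Longrightarrow> lead f = \<nu>"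
  unfolding lead_def using is_lead_unique[OF subset_refl] by (intro some_equality) auto

lemma lead_exps: "f \<in> carrier A \<Longrightarrow> f \<noteq> \<zero>\<^bsub>A\<^esub> \<Longrightarrow> lead f \<in> exps i"
  using lead_is by (simp add: is_lead_def)

lemma lead_mult:
  "f \<in> carrier A \<Longrightarrow> f \<noteq> \<zero>\<^bsub>A\<^esub> \<Longrightarrow> g \<in> carrier A \<Longrightarrow> g \<noteq> \<zero>\<^bsub>A\<^esub> \<Longrightarrow> lead (f \<otimes>\<^bsub>A\<^esub> g) = lead f + lead g"
  using is_lead_mult[OF exp_face_exps _ lead_is _ lead_is] by (intro lead_eqI) auto

lemma is_lead_monomial: "c \<noteq> \<zero> \<Longrightarrow> \<mu> \<in> exps i \<Longrightarrow> is_lead (exps i) (monomial c \<mu>) \<mu>"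
  by (auto simp: is_lead_def monomial_def)

lemma coeff_finsum:
  assumes "finite G" "\<And>g. g \<in> G \<Longrightarrow> h g \<in> carrier A"
  shows "(\<Oplus>\<^bsub>A\<^esub>g\<in>G. h g) \<nu> = (\<Oplus>g\<in>G. h g \<nu>)"
  using assms
proof (induction G rule: finite_induct)
  case (insert g G)
  have "(\<Oplus>\<^bsub>A\<^esub>g\<in>insert g G. h g) = h g \<oplus>\<^bsub>A\<^esub> (\<Oplus>\<^bsub>A\<^esub>g\<in>G. h g)"
    using insert by (intro A.finsum_insert) auto
  moreover have "(\<Oplus>g\<in>insert g G. h g \<nu>) = h g \<nu> \<oplus> (\<Oplus>g\<in>G. h g \<nu>)"
    using insert coeff_closed by (intro finsum_insert) auto
  ultimately show ?case using insert by simp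
qed simp

lemma cancel_lead:
  assumes h: "h \<in> carrier A" "h \<noteq> \<zero>\<^bsub>A\<^esub>" and g: "g \<in> carrier A" "g \<noteq> \<zero>\<^bsub>A\<^esub>" and le: "lead g \<le> lead h"
  shows "\<exists>c\<in>carrier C. \<exists>\<mu>\<in>exps i. \<mu> + lead g = lead h \<and>
    (\<forall>\<kappa>\<in>exps i. key \<kappa> \<le> key (lead h) \<longrightarrow> (h \<ominus>\<^bsub>A\<^esub> monomial c \<mu> \<otimes>\<^bsub>A\<^esub> g) \<kappa> = \<zero>)"
proof -
  have lh: "is_lead (exps i) h (lead h)" and lg: "is_lead (exps i) g (lead g)" using lead_is h g by auto
  define \<mu> where "\<mu> = lead h - lead g"
  have \<mu>: "\<mu> \<in> exps i" "\<mu> + lead g = lead h"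
    using lead_exps h le fun_diff_add[OF le] by (auto simp: \<mu>_def add.commute)
  have nz: "h (lead h) \<in> carrier C - {\<zero>}" "g (lead g) \<in> Units C"
    using lh lg coeff_closed h g field_Units by (auto simp: is_lead_def)
  define c where "c = h (lead h) \<otimes> inv (g (lead g))"
  have c1: "c \<in> carrier C" "c \<otimes> g (lead g) = h (lead h)"
    using nz by (auto simp: c_def m_assoc Units_closed)
  have "c \<noteq> \<zero>" using c1 nz Units_closed by fastforce
  note c = c1(1) this c1(2)
  have mA: "monomial c \<mu> \<in> carrier A" using c \<mu> by simp
  have "(h \<ominus>\<^bsub>A\<^esub> monomial c \<mu> \<otimes>\<^bsub>A\<^esub> g) \<kappa> = \<zero>" if \<kappa>: "\<kappa> \<in> exps i" "key \<kappa> \<le> key (lead h)" for \<kappa>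
  proof -
    have "(monomial c \<mu> \<otimes>\<^bsub>A\<^esub> g) \<kappa> = (if \<kappa> = \<mu> + lead g then monomial c \<mu> \<mu> \<otimes> g (lead g) else \<zero>)"
      using \<kappa> \<mu> c g lg mA by (intro mult_coeff_lead[OF exp_face_exps]) (auto simp: is_lead_monomial)
    then have 1: "(monomial c \<mu> \<otimes>\<^bsub>A\<^esub> g) \<kappa> = (if \<kappa> = lead h then h (lead h) else \<zero>)"
      using \<mu> c by (simp add: monomial_def)
    have "h \<kappa> = (if \<kappa> = lead h then h (lead h) else \<zero>)"
    proof (cases "key \<kappa> < key (lead h)")
      case True
      then show ?thesis using lh \<kappa> by (auto simp: is_lead_def)
    next
      case False
      then show ?thesis using exp_key_inj[OF \<kappa>(1) lead_exps[OF h]] \<kappa>(2) by auto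
    qed
    then show ?thesis using 1 h g mA coeff_closed[OF h(1)] by (simp add: minus_eq r_neg)
  qed
  then show ?thesis using c \<mu> by blast
qed

text \<open>Lowest terms are cancelled by multiples of elements of \<open>G\<close> in an infinite
  process that converges coefficientwise. \<open>J\<close> need not be an ideal: besides ideals
  above \<open>I\<close>, the lemma is applied to the set of almost integral numerators in
  \<open>almost_integral_divides\<close>.\<close>

lemma division:
  assumes I: "ideal I A" and G: "G \<subseteq> I" "finite G" "\<zero>\<^bsub>A\<^esub> \<notin> G"
    and J: "J \<subseteq> carrier A" and le: "\<And>h. h \<in> J \<Longrightarrow> h \<noteq> \<zero>\<^bsub>A\<^esub> \<Longrightarrow> \<exists>g\<in>G. lead g \<le> lead h"
    and JI: "\<And>h u. h \<in> J \<Longrightarrow> u \<in> I \<Longrightarrow> h \<ominus>\<^bsub>A\<^esub> u \<in> J"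
  shows "J \<subseteq> I"
proof
  fix f assume f: "f \<in> J"
  have GA: "g \<in> carrier A" "g \<noteq> \<zero>\<^bsub>A\<^esub>" if "g \<in> G" for g using that G ideal.Icarr[OF I] by auto
  have "\<exists>g c \<mu>. g \<in> G \<and> c \<in> carrier C \<and> \<mu> \<in> exps i \<and> \<mu> + lead g = lead h \<and>
    (\<forall>\<kappa>\<in>exps i. key \<kappa> \<le> key (lead h) \<longrightarrow> (h \<ominus>\<^bsub>A\<^esub> monomial c \<mu> \<otimes>\<^bsub>A\<^esub> g) \<kappa> = \<zero>)"
    if "h \<in> J" "h \<noteq> \<zero>\<^bsub>A\<^esub>" for h
    using le[OF that] cancel_lead[OF _ that(2)] that J GA by (meson subsetD)
  then obtain gg cc mm where st: "\<And>h. h \<in> J \<Longrightarrow> h \<noteq> \<zero>\<^bsub>A\<^esub> \<Longrightarrow> gg h \<in> G \<and> cc h \<in> carrier C \<and> mm h \<in> exps i \<and>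
      mm h + lead (gg h) = lead h \<and>
      (\<forall>\<kappa>\<in>exps i. key \<kappa> \<le> key (lead h) \<longrightarrow> (h \<ominus>\<^bsub>A\<^esub> monomial (cc h) (mm h) \<otimes>\<^bsub>A\<^esub> gg h) \<kappa> = \<zero>)"
    by metis
  define F where "F = rec_nat f (\<lambda>_ h. if h = \<zero>\<^bsub>A\<^esub> then h else h \<ominus>\<^bsub>A\<^esub> monomial (cc h) (mm h) \<otimes>\<^bsub>A\<^esub> gg h)"
  have F0: "F 0 = f" and FS: "\<And>n. F (Suc n) = (if F n = \<zero>\<^bsub>A\<^esub> then F n else F n \<ominus>\<^bsub>A\<^esub> monomial (cc (F n)) (mm (F n)) \<otimes>\<^bsub>A\<^esub> gg (F n))"
    by (simp_all add: F_def)
  have FJ: "F n \<in> J" for n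
  proof (induction n)
    case (Suc n)
    show ?case
    proof (cases "F n = \<zero>\<^bsub>A\<^esub>")
      case False
      have "monomial (cc (F n)) (mm (F n)) \<otimes>\<^bsub>A\<^esub> gg (F n) \<in> I"
        using st[OF Suc False] G ideal.I_l_closed[OF I] by auto
      then show ?thesis using False JI[OF Suc] by (simp add: FS)
    qed (use Suc in \<open>simp add: FS\<close>)
  qed (simp add: F0 f)
  have FA: "F n \<in> carrier A" for n using FJ J by blast
  \<comment> \<open>Each step raises the key of the lowest term by at least one. The induction can
    start at 0 because keys are positive.\<close>
  have F_low: "F n \<kappa> = \<zero>" if "\<kappa> \<in> exps i" "key \<kappa> \<le> n" for n \<kappa>
    using that
  proof (induction n arbitrary: \<kappa>)
    case 0
    then show ?case using exp_key_pos[of i \<kappa>] by simp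
  next
    case (Suc n)
    show ?case
    proof (cases "F n = \<zero>\<^bsub>A\<^esub>")
      case False
      have l: "is_lead (exps i) (F n) (lead (F n))" using lead_is FA False by blast
      then have "\<not> key (lead (F n)) \<le> n" using Suc.IH by (auto simp: is_lead_def)
      then show ?thesis using Suc.prems st[OF FJ False] False by (auto simp: FS)
    qed (simp add: FS)
  qed
  define q where "q g n = (if F n \<noteq> \<zero>\<^bsub>A\<^esub> \<and> gg (F n) = g then monomial (cc (F n)) (mm (F n)) else \<zero>\<^bsub>A\<^esub>)" for g n
  have qA: "q g n \<in> carrier A" for g n using st[OF FJ, of n] by (auto simp: q_def)
  define P where "P g = rec_nat \<zero>\<^bsub>A\<^esub> (\<lambda>n p. p \<oplus>\<^bsub>A\<^esub> q g n)" for g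
  have P0: "P g 0 = \<zero>\<^bsub>A\<^esub>" and PS: "P g (Suc n) = P g n \<oplus>\<^bsub>A\<^esub> q g n" for g n by (simp_all add: P_def)
  have PA: "P g n \<in> carrier A" for g n by (induction n) (simp_all add: P0 PS qA del: A_add A_zero)
  \<comment> \<open>\<open>K\<close> bounds the key of the lead of every divisor. A monomial used at
    step \<open>n\<close> with exponent \<open>\<nu>\<close> satisfies
    \<open>n < key \<nu> * K\<close>, since its key times that of the divisor's lead is the key of
    the lead of \<open>F n\<close>. So the coefficient of each quotient at \<open>\<nu>\<close> is
    final from step \<open>key \<nu> * K\<close> on.\<close>
  define K where "K = (\<Sum>g\<in>G. key (lead g))"
  have q_low: "q g n \<nu> = \<zero>" if g: "g \<in> G" and n: "key \<nu> * K \<le> n" for g n \<nu>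
  proof (rule ccontr)
    assume nz: "q g n \<nu> \<noteq> \<zero>"
    then have Fn: "F n \<noteq> \<zero>\<^bsub>A\<^esub>" "gg (F n) = g" "\<nu> = mm (F n)" by (auto simp: q_def monomial_def split: if_splits)
    then have "key (lead (F n)) = key \<nu> * key (lead g)" using st[OF FJ Fn(1)] exp_key_add by metis
    also have "\<dots> \<le> key \<nu> * K" unfolding K_def using G(2) g by (intro mult_le_mono2 member_le_sum) auto
    finally have "key (lead (F n)) \<le> n" using n by simp
    moreover have "is_lead (exps i) (F n) (lead (F n))" using lead_is FA Fn(1) by blast
    ultimately show False using F_low by (auto simp: is_lead_def)
  qed
  define c where "c g \<nu> = P g (key \<nu> * K) \<nu>" for g \<nu>
  have cP: "P g n \<nu> = c g \<nu>" if "g \<in> G" "key \<nu> * K \<le> n" for g n \<nu>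
    using that(2) unfolding c_def
  proof (induction n rule: dec_induct)
    case (step n)
    then show ?case using q_low[OF that(1)] coeff_closed[OF PA] by (simp add: PS)
  qed simp
  have cA: "c g \<in> carrier A" for g
    using coeff_closed[OF PA] coeff_out[OF PA] unfolding c_def by (intro A_carrierI) auto
  have "F n \<oplus>\<^bsub>A\<^esub> (\<Oplus>\<^bsub>A\<^esub>g\<in>G. P g n \<otimes>\<^bsub>A\<^esub> g) = f" for n
  proof (induction n)
    case 0
    have "(\<Oplus>\<^bsub>A\<^esub>g\<in>G. P g 0 \<otimes>\<^bsub>A\<^esub> g) = (\<Oplus>\<^bsub>A\<^esub>g\<in>G. \<zero>\<^bsub>A\<^esub>)"
      using GA by (intro A.finsum_cong') (auto simp: P0)
    then show ?case using FA[of 0] by (simp add: F0 del: A_add A_zero)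
  next
    case (Suc n)
    let ?P = "\<Oplus>\<^bsub>A\<^esub>g\<in>G. P g n \<otimes>\<^bsub>A\<^esub> g" and ?q = "\<Oplus>\<^bsub>A\<^esub>g\<in>G. q g n \<otimes>\<^bsub>A\<^esub> g"
    have cl: "?P \<in> carrier A" "?q \<in> carrier A" using GA PA qA by (auto intro!: A.finsum_closed)
    have "(\<Oplus>\<^bsub>A\<^esub>g\<in>G. P g (Suc n) \<otimes>\<^bsub>A\<^esub> g) = (\<Oplus>\<^bsub>A\<^esub>g\<in>G. P g n \<otimes>\<^bsub>A\<^esub> g \<oplus>\<^bsub>A\<^esub> q g n \<otimes>\<^bsub>A\<^esub> g)"
      using GA PA qA by (intro A.finsum_cong') (auto simp: PS A.l_distr simp del: A_add)
    also have "\<dots> = ?P \<oplus>\<^bsub>A\<^esub> ?q"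
      using GA PA qA by (intro A.finsum_addf) auto
    finally have 1: "(\<Oplus>\<^bsub>A\<^esub>g\<in>G. P g (Suc n) \<otimes>\<^bsub>A\<^esub> g) = ?P \<oplus>\<^bsub>A\<^esub> ?q" .
    have 2: "F (Suc n) \<oplus>\<^bsub>A\<^esub> ?q = F n"
    proof (cases "F n = \<zero>\<^bsub>A\<^esub>")
      case True
      have "?q = (\<Oplus>\<^bsub>A\<^esub>g\<in>G. \<zero>\<^bsub>A\<^esub>)" using GA True by (intro A.finsum_cong') (auto simp: q_def)
      then show ?thesis using True by (simp add: FS del: A_add A_zero)
    next
      case False
      let ?m = "monomial (cc (F n)) (mm (F n))"
      have m: "?m \<in> carrier A" "gg (F n) \<in> G" using st[OF FJ False] by auto
      have "?q = (\<Oplus>\<^bsub>A\<^esub>g\<in>G. if gg (F n) = g then ?m \<otimes>\<^bsub>A\<^esub> g else \<zero>\<^bsub>A\<^esub>)"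
        using GA False m by (intro A.finsum_cong') (auto simp: q_def)
      also have "\<dots> = ?m \<otimes>\<^bsub>A\<^esub> gg (F n)"
        using GA m G(2) by (intro A.finsum_singleton) auto
      finally show ?thesis using False m GA FA by (simp add: FS A.minus_eq A.a_assoc A.l_neg del: A_add A_zero)
    qed
    have "F (Suc n) \<oplus>\<^bsub>A\<^esub> (?P \<oplus>\<^bsub>A\<^esub> ?q) = (F (Suc n) \<oplus>\<^bsub>A\<^esub> ?q) \<oplus>\<^bsub>A\<^esub> ?P"
      using FA cl by (simp add: A.a_ac del: A_add)
    then show ?case unfolding 1 2 using Suc by (simp only:)
  qed
  note sum = this
  have SA: "(\<Oplus>\<^bsub>A\<^esub>g\<in>G. c g \<otimes>\<^bsub>A\<^esub> g) \<in> carrier A"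
    using GA cA by (intro A.finsum_closed) auto
  have "f = (\<Oplus>\<^bsub>A\<^esub>g\<in>G. c g \<otimes>\<^bsub>A\<^esub> g)"
  proof
    fix \<nu>
    show "f \<nu> = (\<Oplus>\<^bsub>A\<^esub>g\<in>G. c g \<otimes>\<^bsub>A\<^esub> g) \<nu>"
    proof (cases "\<nu> \<in> exps i")
      case True
      \<comment> \<open>Late enough for the remainder to vanish at \<open>\<nu>\<close> and for all
        quotients to be final at every exponent below \<open>\<nu>\<close>.\<close>
      define n where "n = key \<nu> * K + key \<nu>"
      have Pc: "(P g n \<otimes>\<^bsub>A\<^esub> g) \<nu> = (c g \<otimes>\<^bsub>A\<^esub> g) \<nu>" if g: "g \<in> G" for g
      proof -
        have "(g \<otimes>\<^bsub>A\<^esub> P g n) \<nu> = (g \<otimes>\<^bsub>A\<^esub> c g) \<nu>"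
        proof (rule A_mult_cong[OF GA(1)[OF g] PA cA])
          fix \<mu> assume "\<mu> \<le> \<nu>"
          then have "key \<mu> * K \<le> key \<nu> * K" by (intro mult_le_mono1 exp_key_mono)
          then have "key \<mu> * K \<le> n" unfolding n_def by (rule trans_le_add1)
          then show "P g n \<mu> = c g \<mu>" using g by (intro cP)
        qed
        then show ?thesis using GA[OF g] PA cA by (simp add: A.m_comm)
      qed
      have "f \<nu> = F n \<nu> \<oplus> (\<Oplus>\<^bsub>A\<^esub>g\<in>G. P g n \<otimes>\<^bsub>A\<^esub> g) \<nu>" using fun_cong[OF sum[of n], of \<nu>, symmetric] by simp
      also have "F n \<nu> = \<zero>" using True by (intro F_low) (auto simp: n_def)
      also have "(\<Oplus>\<^bsub>A\<^esub>g\<in>G. P g n \<otimes>\<^bsub>A\<^esub> g) \<nu> = (\<Oplus>g\<in>G. (P g n \<otimes>\<^bsub>A\<^esub> g) \<nu>)"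
        using G GA PA by (intro coeff_finsum) auto
      also have "\<dots> = (\<Oplus>g\<in>G. (c g \<otimes>\<^bsub>A\<^esub> g) \<nu>)"
        using Pc coeff_closed[OF A.m_closed[OF cA GA(1)]] by (intro finsum_cong') auto
      also have "\<dots> = (\<Oplus>\<^bsub>A\<^esub>g\<in>G. c g \<otimes>\<^bsub>A\<^esub> g) \<nu>"
        using G GA cA by (intro coeff_finsum[symmetric]) auto
      finally show ?thesis using coeff_closed[OF SA] by simp
    next
      case False
      then show ?thesis using coeff_out[OF SA] coeff_out[of f] f J by auto
    qed
  qed
  moreover have "(\<Oplus>\<^bsub>A\<^esub>g\<in>G. c g \<otimes>\<^bsub>A\<^esub> g) \<in> I"
    using G cA ideal.I_l_closed[OF I] by (intro A.finsum_in_ideal[OF I]) auto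
  ultimately show "f \<in> I" by simp
qed

end

section \<open>Chains of order type \<open>\<omega>\<^sup>d\<close>\<close>

text \<open>
  A descending chain from \<open>U\<close> to \<open>V\<close> of length \<open>\<omega>\<^sup>d\<close>. A power series ring in \<open>i\<close>
  indeterminates has only short such chains of ideals, while a chain of \<open>d + 1\<close> primes yields
  one of length \<open>\<omega>\<^sup>d\<close>; this bounds the dimension without Krull's height theorem.
\<close>

fun omega_chain :: "('x set \<Rightarrow> bool) \<Rightarrow> nat \<Rightarrow> 'x set \<Rightarrow> 'x set \<Rightarrow> bool" where
  "omega_chain P 0 U V \<longleftrightarrow> P U \<and> P V \<and> V \<subset> U"
| "omega_chain P (Suc d) U V \<longleftrightarrow> P U \<and> P V \<and>
     (\<exists>s :: nat \<Rightarrow> 'x set. s 0 \<subseteq> U \<and> (\<forall>n. V \<subseteq> s n \<and> omega_chain P d (s n) (s (Suc n))))"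

lemma omega_chain_ends: "omega_chain P d U V \<Longrightarrow> P U \<and> P V"
  by (cases d) auto

lemma omega_chain_mono: "omega_chain P d U V \<Longrightarrow> V' \<subseteq> V \<Longrightarrow> P V' \<Longrightarrow> omega_chain P d U V'"
proof (cases d)
  case (Suc e)
  assume c: "omega_chain P d U V" and V: "V' \<subseteq> V" "P V'"
  from c[unfolded Suc omega_chain.simps] obtain s where s: "P U" "s 0 \<subseteq> U" 
    "\<And>n. V \<subseteq> s n" "\<And>n. omega_chain P e (s n) (s (Suc n))" by (elim conjE exE) simp
  have "V' \<subseteq> s n" for n using V(1) s(3)[of n] by blast
  then show ?thesis unfolding Suc omega_chain.simps using V s by (intro conjI exI[of _ s] allI)
qed auto

lemma omega_chain_map:
  assumes "\<And>U. P U \<Longrightarrow> P' (\<phi> U)" "\<And>U V. P U \<Longrightarrow> P V \<Longrightarrow> V \<subset> U \<Longrightarrow> \<phi> V \<subset> \<phi> U"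
  shows "omega_chain P d U V \<Longrightarrow> omega_chain P' d (\<phi> U) (\<phi> V)"
proof (induction d arbitrary: U V)
  case 0
  then show ?case using assms(1)[of U] assms(1)[of V] assms(2)[of U V] by simp
next
  case (Suc d)
  from Suc.prems[unfolded omega_chain.simps] obtain s where P: "P U" "P V" and s: "s 0 \<subseteq> U"
    "\<And>n. V \<subseteq> s n" "\<And>n. omega_chain P d (s n) (s (Suc n))" by (elim conjE exE) simp
  have Ps: "P (s n)" for n using s(3) omega_chain_ends by blast
  have m: "\<phi> V \<subseteq> \<phi> U" if "P U" "P V" "V \<subseteq> U" for U V
    using assms(2)[OF that(1,2)] that(3) by (cases "U = V") auto
  have "\<phi> (s 0) \<subseteq> \<phi> U" using m[OF P(1) Ps s(1)] .
  moreover have "\<phi> V \<subseteq> \<phi> (s n)" for n using m[OF Ps P(2) s(2)] .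
  moreover have "omega_chain P' d (\<phi> (s n)) (\<phi> (s (Suc n)))" for n using Suc.IH[OF s(3)] .
  moreover have "P' (\<phi> U)" "P' (\<phi> V)" using assms(1) P by blast+
  ultimately show ?case unfolding omega_chain.simps by (intro conjI exI[of _ "\<lambda>n. \<phi> (s n)"]) auto
qed

section \<open>Chains of up-closed sets of exponents\<close>

definition orthant :: "nat \<Rightarrow> nat set \<Rightarrow> (nat \<Rightarrow> nat) \<Rightarrow> (nat \<Rightarrow> nat) set"
  where "orthant i S v = {v + u | u. u \<in> exps i \<and> (\<forall>j. j \<notin> S \<longrightarrow> u j = 0)}"

definition upset :: "nat \<Rightarrow> (nat \<Rightarrow> nat) set \<Rightarrow> bool"
  where "upset i U \<longleftrightarrow> U \<subseteq> exps i \<and> (\<forall>\<nu>\<in>U. \<forall>\<mu>\<in>exps i. \<nu> + \<mu> \<in> U)"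

lemma upset_le: "upset i U \<Longrightarrow> \<nu> \<in> U \<Longrightarrow> \<nu> \<le> \<mu> \<Longrightarrow> \<mu> \<in> exps i \<Longrightarrow> \<mu> \<in> U"
  unfolding upset_def using fun_diff_add[of \<nu> \<mu>] exps_diff[of \<mu> i \<nu>] by metis

text \<open>Each link of the chain contributes an orthant of dimension one less. Infinitely many
  have the same directions \<open>S\<close>, and their corners can be made monotone in the other
  coordinates. One of those coordinates is unbounded, and it supplies the additional
  direction.\<close>

lemma omega_chain_upset_orthant:
  "omega_chain (upset i) d U V \<Longrightarrow> \<exists>S v. S \<subseteq> {..<i} \<and> card S = d \<and> v \<in> exps i \<and> orthant i S v \<subseteq> U - V"
proof (induction d arbitrary: U V)
  case 0
  then obtain v where v: "v \<in> U - V" "v \<in> exps i" by (auto simp: upset_def)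
  have "u = 0" if "\<forall>j. u j = (0::nat)" for u :: "nat \<Rightarrow> nat" using that by (simp add: fun_eq_iff)
  then have "orthant i {} v = {v}" by (auto simp: orthant_def)
  then show ?case using v by (intro exI[of _ "{}"] exI[of _ v]) auto
next
  case (Suc d)
  then obtain s where U: "upset i U" "upset i V" and s: "s 0 \<subseteq> U" "\<And>n. V \<subseteq> s n"
    and sc: "\<And>n. omega_chain (upset i) d (s n) (s (Suc n))" unfolding omega_chain.simps by blast
  have su: "upset i (s n)" for n using sc omega_chain_ends by blast
  have "\<forall>n. \<exists>p. fst p \<subseteq> {..<i} \<and> card (fst p) = d \<and> snd p \<in> exps i \<and> orthant i (fst p) (snd p) \<subseteq> s n - s (Suc n)"
    using Suc.IH[OF sc] by simp
  from choice[OF this] obtain p where p: "\<And>n. fst (p n) \<subseteq> {..<i}" "\<And>n. card (fst (p n)) = d"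
    "\<And>n. snd (p n) \<in> exps i" "\<And>n. orthant i (fst (p n)) (snd (p n)) \<subseteq> s n - s (Suc n)" by blast
  have "finite ((\<lambda>n. fst (p n)) ` UNIV)"
    by (rule finite_subset[of _ "Pow {..<i}"]) (use p(1) in auto)
  then obtain S where "infinite {n. fst (p n) = S}"
    using inf_img_fin_dom[of "\<lambda>n. fst (p n)" UNIV] by (auto simp: vimage_def)
  define e where "e = enumerate {n. fst (p n) = S}"
  have e: "strict_mono e" "\<And>k. fst (p (e k)) = S"
    using \<open>infinite _\<close> enumerate_in_set[of "{n. fst (p n) = S}"] by (auto simp: e_def strict_mono_enumerate)
  \<comment> \<open>Coordinates in \<open>S\<close> are set to zero, as the orthants are unbounded
    in these directions anyway; monotonicity is only wanted outside \<open>S\<close>.\<close>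
  define w where "w k j = (if j \<in> S then 0 else snd (p (e k)) j)" for k j
  have w: "w k \<in> exps i" for k using p(3)[of "e k"] by (auto simp: exps_def w_def)
  obtain r :: "nat \<Rightarrow> nat" where r: "strict_mono r" "mono (\<lambda>k. w (r k))" using exps_mono_subseq[of w i] w by auto
  define N where "N k = e (r k)" for k
  define v where "v k = snd (p (N k))" for k
  have N: "strict_mono N" unfolding N_def using e(1) r(1) by (simp add: strict_mono_def)
  have S: "S \<subseteq> {..<i}" "card S = d" using p e(2) by metis+
  have vE: "v k \<in> exps i" for k using p by (simp add: v_def)
  have orth: "orthant i S (v k) \<subseteq> s (N k) - s (Suc (N k))" for k
    using p(4)[of "N k"] e(2) by (simp add: v_def N_def)
  have vv: "v k \<in> s (N k)" for k
    using orth[of k] unfolding orthant_def by (auto dest!: subsetD intro!: exI[of _ 0])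
  have wv: "w (r k) j = v k j" if "j \<notin> S" for k j using that by (simp add: w_def v_def N_def)
  have wm: "v k j \<le> v l j" if "k \<le> l" "j \<notin> S" for k l j
    using monoD[OF r(2) that(1)] wv[OF that(2)] by (metis le_fun_def)
  have sm: "s n \<subseteq> s m" if "m \<le> n" for m n
  proof -
    have "omega_chain P d U V \<Longrightarrow> V \<subseteq> U" for P :: "(nat \<Rightarrow> nat) set \<Rightarrow> bool" and d U V
    proof (induction d arbitrary: U V)
      case (Suc d)
      then obtain s :: "nat \<Rightarrow> (nat \<Rightarrow> nat) set" where "s 0 \<subseteq> U" "V \<subseteq> s 0" by auto
      then show ?case by blast
    qed auto
    then have "s (Suc n) \<subseteq> s n" for n using sc by blast
    then show ?thesis using lift_Suc_antimono_le[of s] that by blast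
  qed
  \<comment> \<open>Moving from the corner \<open>v k\<close> along \<open>S\<close> reaches a point
    above \<open>z\<close> that lies in the orthant and hence outside \<open>s (Suc (N k))\<close>,
    whereas that set is up-closed and contains \<open>z\<close>.\<close>
  have escape: False if "z \<in> s (Suc (N k))" and "z \<in> exps i" and "\<And>j. j \<notin> S \<Longrightarrow> z j \<le> v k j" for z k
  proof -
    let ?u = "\<lambda>j. if j \<in> S then z j else 0"
    have u: "?u \<in> exps i" using that(2) by (auto simp: exps_def)
    then have "v k + ?u \<in> orthant i S (v k)" unfolding orthant_def by auto
    then have "v k + ?u \<notin> s (Suc (N k))" using orth by blast
    moreover have "z \<le> v k + ?u" using that(3) by (auto simp: le_fun_def)
    ultimately show False using upset_le[OF su that(1)] u vE exps_add_iff by blast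
  qed
  \<comment> \<open>If all coordinates outside \<open>S\<close> were bounded, so would be their sum.
    It increases strictly, for otherwise two consecutive corners agree outside \<open>S\<close> and
    the later one contradicts \<open>escape\<close>.\<close>
  have "\<exists>j\<in>{..<i} - S. \<forall>B. \<exists>k. v k j > B"
  proof (rule ccontr)
    assume "\<not> ?thesis"
    then have "\<forall>j\<in>{..<i} - S. \<exists>B. \<forall>k. v k j \<le> B" by (simp add: not_less)
    then obtain B where B: "\<And>j k. j \<in> {..<i} - S \<Longrightarrow> v k j \<le> B j" by metis
    define t where "t k = (\<Sum>j\<in>{..<i} - S. v k j)" for k
    have "t k < t (Suc k)" for k
    proof (rule ccontr)
      assume nt: "\<not> t k < t (Suc k)"
      have le: "v k j \<le> v (Suc k) j" if "j \<notin> S" for j using wm that by simp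
      have eq: "v (Suc k) j = v k j" if "j \<in> {..<i} - S" for j
      proof (rule ccontr)
        assume "v (Suc k) j \<noteq> v k j"
        then have "v k j < v (Suc k) j" using le[of j] that by simp
        then have "t k < t (Suc k)"
          unfolding t_def using that le by (intro sum_strict_mono_ex1) auto
        then show False using nt by simp
      qed
      have "v (Suc k) j \<le> v k j" if "j \<notin> S" for j
        using eq[of j] that vE[of k] vE[of "Suc k"] by (cases "j < i") (auto simp: exps_def)
      moreover have "v (Suc k) \<in> s (Suc (N k))"
        using vv[of "Suc k"] sm[of "Suc (N k)" "N (Suc k)"] strict_monoD[OF N, of k "Suc k"] by auto
      ultimately show False using escape vE by blast
    qed
    then have "strict_mono t" by (simp add: strict_mono_Suc_iff)
    then have "k \<le> t k" for k by (rule strict_mono_imp_increasing)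
    moreover have "t k \<le> (\<Sum>j\<in>{..<i} - S. B j)" for k unfolding t_def using B by (intro sum_mono) auto
    ultimately show False using not_less_eq_eq order_trans by blast
  qed
  then obtain j where j: "j < i" "j \<notin> S" "\<And>B. \<exists>k. v k j > B" by auto
  have "orthant i (insert j S) (v 0) \<subseteq> U - V"
  proof
    fix z assume "z \<in> orthant i (insert j S) (v 0)"
    then obtain u where u: "u \<in> exps i" "\<And>l. l \<notin> insert j S \<Longrightarrow> u l = 0" "z = v 0 + u" by (auto simp: orthant_def)
    have zE: "z \<in> exps i" using u vE by simp
    have "v 0 \<in> U" using vv[of 0] sm[of 0 "N 0"] s(1) by auto
    then have "z \<in> U" using U(1) u by (simp add: upset_def)
    moreover have "z \<notin> V"
    proof
      assume zV: "z \<in> V"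
      \<comment> \<open>A point of the large orthant lying in \<open>V\<close> would belong to all
        \<open>s n\<close>. Once \<open>v k\<close> exceeds it in coordinate \<open>j\<close>, it is
        bounded by \<open>v k\<close> outside \<open>S\<close>.\<close>
      obtain k where k: "v k j > z j" using j(3) by blast
      show False
      proof (rule escape[of z k])
        show "z \<in> s (Suc (N k))" using zV s(2) by blast
        show "z l \<le> v k l" if "l \<notin> S" for l
          using that k u(2)[of l] wm[of 0 k l] u(3) by (cases "l = j") auto
      qed (rule zE)
    qed
    ultimately show "z \<in> U - V" by blast
  qed
  moreover have "insert j S \<subseteq> {..<i}" "card (insert j S) = Suc d"
    using S j finite_subset[OF S(1)] by auto
  ultimately show ?case using vE by blast
qed

section \<open>Chains of ideals from chains of primes\<close>

text \<open>A chain of ideals down to \<open>p 1\<close> is copied infinitely often by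
  multiplication with powers of an element \<open>a\<close> of \<open>p 1\<close> outside
  \<open>p 0\<close>, each time adding \<open>p 0\<close>. The lower bound \<open>q\<close> is
  carried along because the copies stay strict only for ideals that contain
  \<open>p 0\<close>.\<close>

lemma (in cring) primes_omega_chain:
  assumes "\<And>j. j \<le> d \<Longrightarrow> primeideal (p j) R" "\<And>j. j < d \<Longrightarrow> p j \<subset> p (Suc j)"
    and "ideal q R" "q \<subseteq> p 0"
  shows "omega_chain (\<lambda>J. ideal J R \<and> q \<subseteq> J) d (carrier R) (p 0)"
  using assms
proof (induction d arbitrary: p q)
  case 0
  interpret p: primeideal "p 0" R using 0 by simp
  have "p 0 \<subset> carrier R" using p.a_subset p.I_notcarr by auto
  then show ?case using 0 oneideal p.is_ideal by auto
next
  case (Suc d)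
  interpret p: primeideal "p 0" R using Suc.prems by simp
  interpret p1: primeideal "p 1" R using Suc.prems by simp
  let ?P = "\<lambda>J. ideal J R \<and> p 0 \<subseteq> J"
  obtain a where a: "a \<in> p 1" "a \<notin> p 0" using Suc.prems(2)[of 0] by auto
  have ac: "a \<in> carrier R" using a by auto
  have chain: "omega_chain ?P d (carrier R) (p 1)"
    using Suc.IH[of "\<lambda>j. p (Suc j)" "p 0"] Suc.prems p.is_ideal by auto
  have an: "a [^] n \<notin> p 0" for n :: nat
  proof (induction n)
    case 0
    then show ?case using p.I_notcarr p.one_imp_carrier by auto
  next
    case (Suc n)
    then show ?case using p.I_prime[of "a [^] n" a] a ac by auto
  qed
  define \<phi> where "\<phi> n J = {a [^] n \<otimes> z \<oplus> t | z t. z \<in> J \<and> t \<in> p 0}" for n :: nat and J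
  have \<phi>_ideal: "ideal (\<phi> n J) R \<and> p 0 \<subseteq> \<phi> n J" if J: "ideal J R" for n J
  proof -
    interpret J: ideal J R by fact
    have pc: "a [^] n \<in> carrier R" using ac by simp
    have "ideal (\<phi> n J) R"
    proof (rule idealI[OF ring_axioms])
      show "subgroup (\<phi> n J) (add_monoid R)"
      proof (rule add.subgroupI)
        show "\<phi> n J \<subseteq> carrier R" using pc by (auto simp: \<phi>_def)
        have "a [^] n \<otimes> \<zero> \<oplus> \<zero> \<in> \<phi> n J" unfolding \<phi>_def using J.zero_closed p.zero_closed by blast
        then show "\<phi> n J \<noteq> {}" by blast
      next
        fix b assume "b \<in> \<phi> n J"
        then obtain z t where b: "b = a [^] n \<otimes> z \<oplus> t" "z \<in> J" "t \<in> p 0" unfolding \<phi>_def by blast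
        have "\<ominus> b = a [^] n \<otimes> (\<ominus> z) \<oplus> (\<ominus> t)" using b pc by (simp add: minus_add r_minus)
        then show "\<ominus> b \<in> \<phi> n J" unfolding \<phi>_def using b J.a_inv_closed p.a_inv_closed by blast
      next
        fix b b' assume "b \<in> \<phi> n J" "b' \<in> \<phi> n J"
        then obtain z t z' t' where b: "b = a [^] n \<otimes> z \<oplus> t" "z \<in> J" "t \<in> p 0" "b' = a [^] n \<otimes> z' \<oplus> t'" "z' \<in> J" "t' \<in> p 0"
          unfolding \<phi>_def by blast
        have "b \<oplus> b' = a [^] n \<otimes> (z \<oplus> z') \<oplus> (t \<oplus> t')" using b pc by (simp add: r_distr a_ac)
        then show "b \<oplus> b' \<in> \<phi> n J" unfolding \<phi>_def using b J.a_closed p.a_closed by blast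
      qed
    next
      fix b r assume "b \<in> \<phi> n J" and r: "r \<in> carrier R"
      then obtain z t where b: "b = a [^] n \<otimes> z \<oplus> t" "z \<in> J" "t \<in> p 0" unfolding \<phi>_def by blast
      have "r \<otimes> b = a [^] n \<otimes> (r \<otimes> z) \<oplus> (r \<otimes> t)" using b pc r by (simp add: r_distr m_ac)
      then show "r \<otimes> b \<in> \<phi> n J" unfolding \<phi>_def using b r J.I_l_closed p.I_l_closed by blast
      then show "b \<otimes> r \<in> \<phi> n J" using b r pc by (simp add: m_comm)
    qed
    moreover have "t \<in> \<phi> n J" if "t \<in> p 0" for t
    proof -
      have "t = a [^] n \<otimes> \<zero> \<oplus> t" using that pc by simp
      then show ?thesis unfolding \<phi>_def using that J.zero_closed by blast
    qed
    ultimately show ?thesis by blast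
  qed
  \<comment> \<open>Modulo the prime \<open>p 0\<close> multiplication by \<open>a^n\<close> is
    injective, so inclusions among ideals containing \<open>p 0\<close> stay strict.\<close>
  have \<phi>_strict: "\<phi> n V \<subset> \<phi> n U" if UV: "?P U" "?P V" "V \<subset> U" for n U V
  proof -
    interpret V: ideal V R using UV by blast
    interpret U: ideal U R using UV by blast
    obtain z where z: "z \<in> U" "z \<notin> V" using UV by blast
    have zc: "z \<in> carrier R" "a [^] n \<in> carrier R" using z ac by auto
    have "a [^] n \<otimes> z \<oplus> \<zero> \<in> \<phi> n U" unfolding \<phi>_def using z p.zero_closed by blast
    moreover have "a [^] n \<otimes> z \<oplus> \<zero> \<notin> \<phi> n V"
    proof
      assume "a [^] n \<otimes> z \<oplus> \<zero> \<in> \<phi> n V"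
      then obtain z' t where t: "a [^] n \<otimes> z \<oplus> \<zero> = a [^] n \<otimes> z' \<oplus> t" "z' \<in> V" "t \<in> p 0" unfolding \<phi>_def by blast
      have z'c: "z' \<in> carrier R" "t \<in> carrier R" using t by auto
      have "a [^] n \<otimes> (z \<ominus> z') = (a [^] n \<otimes> z \<oplus> \<zero>) \<ominus> a [^] n \<otimes> z'"
        using zc z'c by (simp add: minus_eq r_distr r_minus)
      also have "\<dots> = t" unfolding t(1) using zc z'c a_comm[of "a [^] n \<otimes> z'" t] by (simp add: minus_eq a_assoc r_neg)
      finally have "z \<ominus> z' \<in> p 0" using p.I_prime[of "a [^] n" "z \<ominus> z'"] an t zc z'c by auto
      then have "z \<ominus> z' \<in> V" using UV by blast
      then have "(z \<ominus> z') \<oplus> z' \<in> V" using t by simp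
      then show False using z zc z'c by (simp add: minus_eq a_assoc l_neg)
    qed
    moreover have "\<phi> n V \<subseteq> \<phi> n U" using UV unfolding \<phi>_def by blast
    ultimately show ?thesis by blast
  qed
  define s where "s n = \<phi> n (carrier R)" for n
  have "omega_chain (\<lambda>J. ideal J R \<and> q \<subseteq> J) d (s n) (s (Suc n))" for n
  proof -
    have "omega_chain (\<lambda>J. ideal J R \<and> q \<subseteq> J) d (s n) (\<phi> n (p 1))"
      unfolding s_def
    proof (rule omega_chain_map[OF _ _ chain])
      show "ideal (\<phi> n U) R \<and> q \<subseteq> \<phi> n U" if "?P U" for U using \<phi>_ideal that Suc.prems by blast
    qed (rule \<phi>_strict)
    \<comment> \<open>Consecutive copies fit together since \<open>a\<close> lies in
      \<open>p 1\<close>: the next copy begins inside the end of the previous one.\<close>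
    moreover have "s (Suc n) \<subseteq> \<phi> n (p 1)"
    proof
      fix b assume "b \<in> s (Suc n)"
      then obtain z t where b: "b = a [^] Suc n \<otimes> z \<oplus> t" "z \<in> carrier R" "t \<in> p 0" unfolding s_def \<phi>_def by blast
      then have "b = a [^] n \<otimes> (a \<otimes> z) \<oplus> t" using ac by (simp add: m_assoc)
      then show "b \<in> \<phi> n (p 1)" unfolding \<phi>_def using b a p1.I_r_closed by blast
    qed
    moreover have "ideal (s (Suc n)) R \<and> q \<subseteq> s (Suc n)" unfolding s_def using \<phi>_ideal[OF oneideal] Suc.prems by blast
    ultimately show ?thesis by (rule omega_chain_mono)
  qed
  note c = this
  have ps: "p 0 \<subseteq> s n" for n unfolding s_def using \<phi>_ideal[OF oneideal] by blast
  have s0: "s 0 \<subseteq> carrier R" unfolding s_def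
    by (rule additive_subgroup.a_subset[OF ideal.axioms(1)]) (use \<phi>_ideal[OF oneideal, of 0] in blast)
  have qR: "q \<subseteq> carrier R" using Suc.prems(4) p.a_subset by (rule subset_trans)
  show ?case
    unfolding omega_chain.simps
    by (intro conjI exI[of _ s] allI oneideal p.is_ideal qR Suc.prems(4) s0 ps c)
qed

context field_power_series
begin

section \<open>The dimension of a power series ring\<close>

definition leads :: "((nat \<Rightarrow> nat) \<Rightarrow> 'a) set \<Rightarrow> (nat \<Rightarrow> nat) set"
  where "leads I = lead ` (I - {\<zero>\<^bsub>A\<^esub>})"

lemma leads_upset:
  assumes "ideal I A"
  shows "upset i (leads I)"
  unfolding upset_def
proof (intro conjI ballI)
  show "leads I \<subseteq> exps i" using ideal.Icarr[OF assms] lead_exps by (auto simp: leads_def)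
  fix \<nu> \<mu> assume "\<nu> \<in> leads I" and \<mu>: "\<mu> \<in> exps i"
  then obtain f where f: "f \<in> I" "f \<noteq> \<zero>\<^bsub>A\<^esub>" "\<nu> = lead f" by (auto simp: leads_def)
  have fA: "f \<in> carrier A" using f ideal.Icarr[OF assms] by blast
  have m: "monomial \<one> \<mu> \<in> carrier A" "is_lead (exps i) (monomial \<one> \<mu>) \<mu>" using \<mu> is_lead_monomial by auto
  then have m0: "monomial \<one> \<mu> \<noteq> \<zero>\<^bsub>A\<^esub>" "lead (monomial \<one> \<mu>) = \<mu>" using is_lead_nonzero lead_eqI by blast+
  have "f \<otimes>\<^bsub>A\<^esub> monomial \<one> \<mu> \<in> I" using f m ideal.I_r_closed[OF assms] by blast
  moreover have "f \<otimes>\<^bsub>A\<^esub> monomial \<one> \<mu> \<noteq> \<zero>\<^bsub>A\<^esub>" using f fA m m0 A.integral by blast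
  moreover have "lead (f \<otimes>\<^bsub>A\<^esub> monomial \<one> \<mu>) = \<nu> + \<mu>" using lead_mult[OF fA f(2) m(1) m0(1)] f m0 by simp
  ultimately show "\<nu> + \<mu> \<in> leads I" unfolding leads_def by (metis DiffI image_eqI singletonD)
qed

text \<open>Finitely many elements of \<open>I\<close> have leads below all leads of
  \<open>I\<close>, by Dickson's lemma. If \<open>J\<close> had no further leads, division by these
  elements would place \<open>J\<close> inside \<open>I\<close>.\<close>

lemma leads_strict:
  assumes I: "ideal I A" and J: "ideal J A" and "I \<subset> J"
  shows "leads I \<subset> leads J"
proof -
  have sub: "leads I \<subseteq> leads J" using assms(3) by (auto simp: leads_def)
  have "leads I \<noteq> leads J"
  proof
    assume eq: "leads I = leads J"
    obtain S where S: "S \<subseteq> leads I" "finite S" "\<And>\<nu>. \<nu> \<in> leads I \<Longrightarrow> \<exists>\<mu>\<in>S. \<mu> \<le> \<nu>"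
      using dickson[of "leads I" i] leads_upset[OF I] unfolding upset_def by metis
    have "\<forall>\<mu>\<in>S. \<exists>g. g \<in> I \<and> g \<noteq> \<zero>\<^bsub>A\<^esub> \<and> lead g = \<mu>" using S(1) by (auto simp: leads_def)
    then obtain g where g: "\<And>\<mu>. \<mu> \<in> S \<Longrightarrow> g \<mu> \<in> I \<and> g \<mu> \<noteq> \<zero>\<^bsub>A\<^esub> \<and> lead (g \<mu>) = \<mu>" by metis
    have "J \<subseteq> I"
    proof (rule division[OF I, of "g ` S"])
      show "g ` S \<subseteq> I" "finite (g ` S)" "\<zero>\<^bsub>A\<^esub> \<notin> g ` S" using g S(2) by (auto, metis)
      show "J \<subseteq> carrier A" using ideal.Icarr[OF J] by blast
      show "\<exists>g'\<in>g ` S. lead g' \<le> lead h" if "h \<in> J" "h \<noteq> \<zero>\<^bsub>A\<^esub>" for h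
      proof -
        have "lead h \<in> leads I" unfolding eq using that by (auto simp: leads_def)
        then show ?thesis using S(3)[of "lead h"] g by (metis imageI)
      qed
      show "h \<ominus>\<^bsub>A\<^esub> u \<in> J" if "h \<in> J" "u \<in> I" for h u
      proof -
        interpret J: ideal J A by fact
        show ?thesis unfolding A.minus_eq using that assms(3) J.a_closed J.a_inv_closed by blast
      qed
    qed
    then show False using assms(3) by blast
  qed
  then show ?thesis using sub by blast
qed

lemma prime_chain_length:
  assumes "\<And>j. j \<le> d \<Longrightarrow> primeideal (p j) A" "\<And>j. j < d \<Longrightarrow> p j \<subset> p (Suc j)"
  shows "d \<le> i"
proof -
  interpret p: primeideal "p 0" A using assms by simp
  have "omega_chain (\<lambda>J. ideal J A \<and> {\<zero>\<^bsub>A\<^esub>} \<subseteq> J) d (carrier A) (p 0)"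
    using assms A.zeroideal p.zero_closed by (intro A.primes_omega_chain) (auto simp del: A_zero)
  then have "omega_chain (upset i) d (leads (carrier A)) (leads (p 0))"
  proof (rule omega_chain_map[rotated 2])
    show "upset i (leads U)" if "ideal U A \<and> {\<zero>\<^bsub>A\<^esub>} \<subseteq> U" for U
      using that leads_upset by blast
    show "leads V \<subset> leads U" if "ideal U A \<and> {\<zero>\<^bsub>A\<^esub>} \<subseteq> U" "ideal V A \<and> {\<zero>\<^bsub>A\<^esub>} \<subseteq> V" "V \<subset> U" for U V
      by (rule leads_strict) (use that in blast)+
  qed
  then obtain S where "S \<subseteq> {..<i}" "card S = d" using omega_chain_upset_orthant by blast
  then show ?thesis using card_mono[of "{..<i}" S] by simp
qed

definition coord_face :: "nat \<Rightarrow> (nat \<Rightarrow> nat) set"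
  where "coord_face j = {\<nu> \<in> exps i. \<forall>l<j. \<nu> l = 0}"

text \<open>The ideal generated by the first \<open>j\<close> indeterminates: zero for
  \<open>j = 0\<close> and the maximal ideal for \<open>j = i\<close>. In terms of coefficients its
  primality follows from lowest terms along a face.\<close>

definition coord_prime :: "nat \<Rightarrow> ((nat \<Rightarrow> nat) \<Rightarrow> 'a) set"
  where "coord_prime j = {f \<in> carrier A. \<forall>\<nu>\<in>coord_face j. f \<nu> = \<zero>}"

lemma coord_face: "exp_face i (coord_face j)"
  by (auto simp: exp_face_def coord_face_def)

lemma coord_prime_primeideal: "primeideal (coord_prime j) A"
proof (rule primeidealI[OF _ A.is_cring])
  show "ideal (coord_prime j) A"
  proof (rule idealI[OF A.ring_axioms])
    show "subgroup (coord_prime j) (add_monoid A)"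
      by (rule A.add.subgroupI) (auto simp: coord_prime_def intro!: exI[of _ "\<zero>\<^bsub>A\<^esub>"])
  next
    fix f g assume f: "f \<in> coord_prime j" and g: "g \<in> carrier A"
    have fA: "f \<in> carrier A" using f by (simp add: coord_prime_def)
    have "(g \<otimes>\<^bsub>A\<^esub> f) \<nu> = \<zero>" if \<nu>: "\<nu> \<in> coord_face j" for \<nu>
    proof -
      have "f (\<nu> - \<mu>) = \<zero>" for \<mu>
        using f \<nu> by (auto simp: coord_prime_def coord_face_def)
      then have "(\<Oplus>\<mu>\<in>{..\<nu>}. g \<mu> \<otimes> f (\<nu> - \<mu>)) = (\<Oplus>\<mu>\<in>{..\<nu>}. \<zero>)"
        using coeff_closed[OF g] by (intro finsum_cong') auto
      then show ?thesis using \<nu> by (simp add: A_mult coord_face_def)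
    qed
    then show "g \<otimes>\<^bsub>A\<^esub> f \<in> coord_prime j" using fA g by (simp add: coord_prime_def)
    then show "f \<otimes>\<^bsub>A\<^esub> g \<in> coord_prime j" using fA g A.m_comm by simp
  qed
  have "\<one>\<^bsub>A\<^esub> \<notin> coord_prime j"
    by (auto simp: coord_prime_def coord_face_def A_one intro!: bexI[of _ 0])
  then show "carrier A \<noteq> coord_prime j" using A.one_closed by blast
  fix f g assume fg: "f \<in> carrier A" "g \<in> carrier A" "f \<otimes>\<^bsub>A\<^esub> g \<in> coord_prime j"
  show "f \<in> coord_prime j \<or> g \<in> coord_prime j"
  proof (rule ccontr)
    assume "\<not> ?thesis"
    then obtain \<nu>' \<mu>' where "\<nu>' \<in> coord_face j" "f \<nu>' \<noteq> \<zero>" "\<mu>' \<in> coord_face j" "g \<mu>' \<noteq> \<zero>"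
      using fg(1,2) unfolding coord_prime_def by blast
    from is_lead_exists[of \<nu>' "coord_face j" f, OF this(1,2)] is_lead_exists[of \<mu>' "coord_face j" g, OF this(3,4)]
    obtain \<nu> \<mu> where "is_lead (coord_face j) f \<nu>" "is_lead (coord_face j) g \<mu>" by blast
    then have "is_lead (coord_face j) (f \<otimes>\<^bsub>A\<^esub> g) (\<nu> + \<mu>)"
      using fg by (intro is_lead_mult[OF coord_face])
    then show False using fg(3) by (auto simp: is_lead_def coord_prime_def)
  qed
qed

lemma coord_prime_strict:
  assumes "j < i"
  shows "coord_prime j \<subset> coord_prime (Suc j)"
proof -
  let ?e = "\<lambda>l. if l = j then 1 else 0 :: nat"
  have e: "?e \<in> exps i" using assms by (auto simp: exps_def)
  have mA: "monomial \<one> ?e \<in> carrier A" using e by simp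
  have "monomial \<one> ?e \<in> coord_prime (Suc j)"
    unfolding coord_prime_def using mA by (simp add: coord_face_def) (auto simp: monomial_def)
  moreover have "monomial \<one> ?e \<notin> coord_prime j"
    using e by (auto simp: coord_prime_def coord_face_def monomial_def intro!: bexI[of _ ?e])
  moreover have "coord_prime j \<subseteq> coord_prime (Suc j)" by (auto simp: coord_prime_def coord_face_def)
  ultimately show ?thesis by blast
qed

section \<open>Complete integral closedness\<close>

lemma almost_integral_divides:
  assumes f: "f \<in> carrier A" "f \<noteq> \<zero>\<^bsub>A\<^esub>" and a: "a \<in> carrier A" and b: "b \<in> carrier A" "b \<noteq> \<zero>\<^bsub>A\<^esub>"
    and fab: "\<And>s::nat. \<exists>h\<in>carrier A. f \<otimes>\<^bsub>A\<^esub> a [^]\<^bsub>A\<^esub> s = h \<otimes>\<^bsub>A\<^esub> b [^]\<^bsub>A\<^esub> s"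
  shows "\<exists>h\<in>carrier A. a = h \<otimes>\<^bsub>A\<^esub> b"
proof -
  \<comment> \<open>The numerators that are almost integral over the denominator \<open>b\<close>
    with the fixed factor \<open>f\<close>. The principal ideal of \<open>b\<close> absorbs them by
    \<open>division\<close> with the single divisor \<open>b\<close>.\<close>
  define J where "J = {a \<in> carrier A. \<forall>s::nat. \<exists>h\<in>carrier A. f \<otimes>\<^bsub>A\<^esub> a [^]\<^bsub>A\<^esub> s = h \<otimes>\<^bsub>A\<^esub> b [^]\<^bsub>A\<^esub> s}"
  have lead_pow: "is_lead (exps i) (g [^]\<^bsub>A\<^esub> (s::nat)) (\<lambda>j. s * lead g j)" if "g \<in> carrier A" "g \<noteq> \<zero>\<^bsub>A\<^esub>" for g s
  proof (induction s)
    case 0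
    have "(\<lambda>j. 0 * lead g j) = 0" by (simp add: fun_eq_iff)
    moreover have "is_lead (exps i) \<one>\<^bsub>A\<^esub> 0"
      by (auto simp: is_lead_def A_one exp_key_def)
    ultimately show ?case by simp
  next
    case (Suc s)
    have "(\<lambda>j. Suc s * lead g j) = (\<lambda>j. s * lead g j) + lead g" by (simp add: fun_eq_iff)
    then show ?case using is_lead_mult[OF exp_face_exps _ Suc that(1) lead_is[OF that]] that by simp
  qed
  have "J \<subseteq> PIdl\<^bsub>A\<^esub> b"
  proof (rule division[of _ "{b}"])
    show "ideal (PIdl\<^bsub>A\<^esub> b) A" using A.cgenideal_ideal b by blast
    show "{b} \<subseteq> PIdl\<^bsub>A\<^esub> b" using A.cgenideal_self b by blast
    show "J \<subseteq> carrier A" by (auto simp: J_def)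
  next
    fix h assume h: "h \<in> J" "h \<noteq> \<zero>\<^bsub>A\<^esub>"
    then have hA: "h \<in> carrier A" by (simp add: J_def)
    have "lead b j \<le> lead h j" for j
    proof (rule ccontr)
      assume "\<not> lead b j \<le> lead h j"
      then have lt: "lead h j + 1 \<le> lead b j" by simp
      \<comment> \<open>For an exponent \<open>s\<close> larger than the \<open>j\<close>-th
        exponent of the lead of \<open>f\<close>, the factor \<open>f\<close> cannot make up for a
        deficit of one per power.\<close>
      define s where "s = lead f j + 1"
      obtain g where g: "g \<in> carrier A" "f \<otimes>\<^bsub>A\<^esub> h [^]\<^bsub>A\<^esub> s = g \<otimes>\<^bsub>A\<^esub> b [^]\<^bsub>A\<^esub> s" using h by (auto simp: J_def)
      have 1: "is_lead (exps i) (f \<otimes>\<^bsub>A\<^esub> h [^]\<^bsub>A\<^esub> s) (lead f + (\<lambda>j. s * lead h j))"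
        using is_lead_mult[OF exp_face_exps f(1) lead_is[OF f] _ lead_pow[OF hA h(2)]] hA by simp
      then have "g \<noteq> \<zero>\<^bsub>A\<^esub>" using is_lead_nonzero g b by fastforce
      then have "is_lead (exps i) (g \<otimes>\<^bsub>A\<^esub> b [^]\<^bsub>A\<^esub> s) (lead g + (\<lambda>j. s * lead b j))"
        using is_lead_mult[OF exp_face_exps g(1) lead_is[OF g(1)] _ lead_pow[OF b]] b by simp
      then have "lead f + (\<lambda>j. s * lead h j) = lead g + (\<lambda>j. s * lead b j)"
        using 1 g(2) is_lead_unique[OF subset_refl] by metis
      then have "lead f j + s * lead h j = lead g j + s * lead b j" by (simp add: fun_eq_iff)
      moreover have "s * (lead h j + 1) \<le> s * lead b j" using lt by (rule mult_le_mono2)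
      ultimately show False by (simp add: s_def)
    qed
    then show "\<exists>g\<in>{b}. lead g \<le> lead h" by (simp add: le_fun_def)
  next
    fix h u assume h: "h \<in> J" and "u \<in> PIdl\<^bsub>A\<^esub> b"
    then obtain c where c: "c \<in> carrier A" "u = c \<otimes>\<^bsub>A\<^esub> b" by (auto simp: cgenideal_def)
    have hA: "h \<in> carrier A" using h by (simp add: J_def)
    let ?v = "h \<ominus>\<^bsub>A\<^esub> u"
    have vA: "?v \<in> carrier A" using hA c b by simp
    \<comment> \<open>Keeping a power of \<open>h\<close> as a further factor turns stability under
      subtraction into an induction that replaces one factor \<open>h - u\<close> at a time, without
      a binomial expansion.\<close>
    have "\<exists>g\<in>carrier A. f \<otimes>\<^bsub>A\<^esub> ?v [^]\<^bsub>A\<^esub> s \<otimes>\<^bsub>A\<^esub> h [^]\<^bsub>A\<^esub> t = g \<otimes>\<^bsub>A\<^esub> b [^]\<^bsub>A\<^esub> (s + t)" for s t :: nat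
    proof (induction s arbitrary: t)
      case 0
      then show ?case using h f hA by (auto simp: J_def)
    next
      case (Suc s)
      obtain g1 where g1: "g1 \<in> carrier A" "f \<otimes>\<^bsub>A\<^esub> ?v [^]\<^bsub>A\<^esub> s \<otimes>\<^bsub>A\<^esub> h [^]\<^bsub>A\<^esub> Suc t = g1 \<otimes>\<^bsub>A\<^esub> b [^]\<^bsub>A\<^esub> (s + Suc t)" using Suc[of "Suc t"] by blast
      obtain g2 where g2: "g2 \<in> carrier A" "f \<otimes>\<^bsub>A\<^esub> ?v [^]\<^bsub>A\<^esub> s \<otimes>\<^bsub>A\<^esub> h [^]\<^bsub>A\<^esub> t = g2 \<otimes>\<^bsub>A\<^esub> b [^]\<^bsub>A\<^esub> (s + t)" using Suc[of t] by blast
      have cl: "?v [^]\<^bsub>A\<^esub> s \<in> carrier A" "h [^]\<^bsub>A\<^esub> t \<in> carrier A" "b [^]\<^bsub>A\<^esub> (s + t) \<in> carrier A" using vA hA b by auto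
      let ?w = "f \<otimes>\<^bsub>A\<^esub> ?v [^]\<^bsub>A\<^esub> s \<otimes>\<^bsub>A\<^esub> h [^]\<^bsub>A\<^esub> t"
      have w: "?w \<in> carrier A" using f cl by simp
      have "f \<otimes>\<^bsub>A\<^esub> ?v [^]\<^bsub>A\<^esub> Suc s \<otimes>\<^bsub>A\<^esub> h [^]\<^bsub>A\<^esub> t = ?w \<otimes>\<^bsub>A\<^esub> ?v"
        using f cl vA by (simp add: A.m_ac)
      also have "\<dots> = ?w \<otimes>\<^bsub>A\<^esub> h \<ominus>\<^bsub>A\<^esub> ?w \<otimes>\<^bsub>A\<^esub> u"
        using w hA c b by (simp add: A.minus_eq A.r_distr A.r_minus)
      also have "?w \<otimes>\<^bsub>A\<^esub> h = g1 \<otimes>\<^bsub>A\<^esub> b [^]\<^bsub>A\<^esub> (s + Suc t)"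
        unfolding g1(2)[symmetric] using f cl hA by (simp add: A.m_assoc)
      also have "?w \<otimes>\<^bsub>A\<^esub> u = (g2 \<otimes>\<^bsub>A\<^esub> c) \<otimes>\<^bsub>A\<^esub> b [^]\<^bsub>A\<^esub> (s + Suc t)"
      proof -
        have "?w \<otimes>\<^bsub>A\<^esub> u = (g2 \<otimes>\<^bsub>A\<^esub> b [^]\<^bsub>A\<^esub> (s + t)) \<otimes>\<^bsub>A\<^esub> u" by (simp only: g2(2))
        also have "\<dots> = (g2 \<otimes>\<^bsub>A\<^esub> b [^]\<^bsub>A\<^esub> (s + t)) \<otimes>\<^bsub>A\<^esub> (c \<otimes>\<^bsub>A\<^esub> b)" by (simp only: c(2))
        also have "\<dots> = (g2 \<otimes>\<^bsub>A\<^esub> c) \<otimes>\<^bsub>A\<^esub> b [^]\<^bsub>A\<^esub> (s + Suc t)"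
          using g2(1) c(1) b cl by (simp add: A.m_ac)
        finally show ?thesis .
      qed
      also have "g1 \<otimes>\<^bsub>A\<^esub> b [^]\<^bsub>A\<^esub> (s + Suc t) \<ominus>\<^bsub>A\<^esub> (g2 \<otimes>\<^bsub>A\<^esub> c) \<otimes>\<^bsub>A\<^esub> b [^]\<^bsub>A\<^esub> (s + Suc t) =
          (g1 \<ominus>\<^bsub>A\<^esub> g2 \<otimes>\<^bsub>A\<^esub> c) \<otimes>\<^bsub>A\<^esub> b [^]\<^bsub>A\<^esub> (Suc s + t)"
      proof -
        have "g1 \<otimes>\<^bsub>A\<^esub> B \<ominus>\<^bsub>A\<^esub> (g2 \<otimes>\<^bsub>A\<^esub> c) \<otimes>\<^bsub>A\<^esub> B = (g1 \<ominus>\<^bsub>A\<^esub> g2 \<otimes>\<^bsub>A\<^esub> c) \<otimes>\<^bsub>A\<^esub> B" if "B \<in> carrier A" for B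
          using that g1(1) g2(1) c(1) by (simp add: A.minus_eq A.l_distr A.l_minus del: A_add)
        moreover have "s + Suc t = Suc s + t" by simp
        ultimately show ?thesis using b by (simp only: A.nat_pow_closed)
      qed
      finally show ?case using g1(1) g2(1) c(1) by (metis A.minus_closed A.m_closed)
    qed
    from this[of _ 0] have "\<exists>g\<in>carrier A. f \<otimes>\<^bsub>A\<^esub> ?v [^]\<^bsub>A\<^esub> s = g \<otimes>\<^bsub>A\<^esub> b [^]\<^bsub>A\<^esub> s" for s :: nat
      using f vA by simp
    then show "?v \<in> J" using vA unfolding J_def by blast
  qed (use b in auto)
  moreover have "a \<in> J" using a fab by (simp add: J_def)
  ultimately show ?thesis by (auto simp: cgenideal_def)
qed

end

section \<open>Evaluation of power series\<close>

lemma finsum_subring_eq: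
  assumes "ring R" "subring K R" "\<And>a. a \<in> S \<Longrightarrow> f a \<in> K"
  shows "finsum (R\<lparr>carrier := K\<rparr>) f S = finsum R f S"
proof -
  interpret R: ring R by fact
  interpret K: ring "R\<lparr>carrier := K\<rparr>" by (rule R.subring_is_ring[OF assms(2)])
  have KR: "K \<subseteq> carrier R" using subringE(1)[OF assms(2)] .
  show ?thesis
  proof (cases "finite S")
    case True
    then show ?thesis using assms(3)
    proof (induction S rule: finite_induct)
      case (insert a S)
      have "finsum (R\<lparr>carrier := K\<rparr>) f (insert a S) = f a \<oplus>\<^bsub>R\<lparr>carrier := K\<rparr>\<^esub> finsum (R\<lparr>carrier := K\<rparr>) f S"
        using insert by (intro K.finsum_insert) auto
      moreover have "finsum R f (insert a S) = f a \<oplus>\<^bsub>R\<^esub> finsum R f S"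
        using insert KR by (intro R.finsum_insert) auto
      ultimately show ?case using insert by simp
    qed simp
  qed (simp add: R.finsum_infinite K.finsum_infinite)
qed

lemma (in cring) ideal_power_mult:
  assumes "ideal I R" "a \<in> ideal_power R I m" "b \<in> ideal_power R I n"
  shows "a \<otimes> b \<in> ideal_power R I (m + n)"
proof -
  interpret S: semiring "ideals_set R" by (rule ideals_set_is_semiring)
  have "I \<in> carrier (ideals_set R)" using assms(1) by (simp add: ideals_set_def)
  then have "ideal_power R I (m + n) = ideal_prod R (ideal_power R I m) (ideal_power R I n)"
    by (rule S.nat_pow_mult[of I m n, symmetric, unfolded ideals_set_simps])
  then show ?thesis using assms by (auto intro: ideal_prod.prod)
qed

section \<open>Truncations and their limits\<close>

definition exp_degree :: "nat \<Rightarrow> (nat \<Rightarrow> nat) \<Rightarrow> nat"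
  where "exp_degree i \<nu> = (\<Sum>j<i. \<nu> j)"

lemma exp_degree_mono: "\<nu> \<le> \<mu> \<Longrightarrow> exp_degree i \<nu> \<le> exp_degree i \<mu>"
  unfolding exp_degree_def by (intro sum_mono) (simp add: le_fun_def)

definition low_exps :: "nat \<Rightarrow> nat \<Rightarrow> (nat \<Rightarrow> nat) set"
  where "low_exps i N = {\<nu> \<in> exps i. exp_degree i \<nu> < N}"

lemma low_exps_finite: "finite (low_exps i N)"
proof (rule finite_subset[OF _ finite_exps_bounded[of i N]], safe)
  fix \<nu> assume \<nu>: "\<nu> \<in> low_exps i N"
  then show "\<nu> \<in> exps i" by (simp add: low_exps_def)
  fix j assume "j < i"
  then have "\<nu> j \<le> exp_degree i \<nu>" unfolding exp_degree_def by (intro member_le_sum) auto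
  then show "\<nu> j \<le> N" using \<nu> by (simp add: low_exps_def)
qed

text \<open>All members of the sequence lie in the ideal, which avoids carrying a bound on their
  indices; in the theorem the given sequence is continued by zeros.\<close>

locale evaluation = cring R for R (structure) +
  fixes \<mm> k :: "'a set" and i :: nat and x :: "nat \<Rightarrow> 'a"
  assumes m_ideal: "ideal \<mm> R" and complete: "adic_complete R \<mm>"
    and k_subfield: "subfield k R" and x_m: "x j \<in> \<mm>"

sublocale evaluation \<subseteq> P: field_power_series "R\<lparr>carrier := k\<rparr>" i
  by (rule field_power_series.intro, rule subfield_iff(2)[OF k_subfield])

context evaluation
begin

abbreviation A :: "((nat \<Rightarrow> nat) \<Rightarrow> 'a) ring" where "A \<equiv> power_series_ring (R\<lparr>carrier := k\<rparr>) i"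

lemma k_R: "a \<in> k \<Longrightarrow> a \<in> carrier R"
  using subfieldE(3)[OF k_subfield] by blast

lemma coeff_k: "f \<in> carrier A \<Longrightarrow> f \<nu> \<in> k"
  using P.coeff_closed[of f \<nu>] by simp

lemma x_R: "x j \<in> carrier R"
  using x_m ideal.Icarr[OF m_ideal] by blast

abbreviation mon :: "(nat \<Rightarrow> nat) \<Rightarrow> 'a" where "mon \<equiv> monomial_value R i x"

abbreviation mpow :: "nat \<Rightarrow> 'a set" where "mpow N \<equiv> ideal_power R \<mm> N"

lemma mpow_ideal: "ideal (mpow N) R"
  by (rule ideal_power_ideal[OF m_ideal])

lemma mon_closed: "mon \<nu> \<in> carrier R"
  unfolding monomial_value_def using x_R by (intro finprod_closed) auto

lemma mon_add: "mon (\<nu> + \<mu>) = mon \<nu> \<otimes> mon \<mu>"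
proof -
  have "(\<Otimes>j\<in>{..<i}. x j [^] (\<nu> + \<mu>) j) = (\<Otimes>j\<in>{..<i}. x j [^] \<nu> j \<otimes> x j [^] \<mu> j)"
    using x_R by (intro finprod_cong') (auto simp: nat_pow_mult)
  also have "\<dots> = (\<Otimes>j\<in>{..<i}. x j [^] \<nu> j) \<otimes> (\<Otimes>j\<in>{..<i}. x j [^] \<mu> j)"
    using x_R by (intro finprod_multf) auto
  finally show ?thesis by (simp add: monomial_value_def)
qed

lemma mon_0: "mon 0 = \<one>"
  by (simp add: monomial_value_def)

lemma mon_mpow: "mon \<nu> \<in> mpow (exp_degree i \<nu>)"
  unfolding monomial_value_def exp_degree_def
proof (induction i)
  case 0
  show ?case by simp
next
  case (Suc n)
  have "(\<Otimes>j\<in>{..<Suc n}. x j [^] \<nu> j) = x n [^] \<nu> n \<otimes> (\<Otimes>j\<in>{..<n}. x j [^] \<nu> j)"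
    unfolding lessThan_Suc using x_R by (intro finprod_insert) auto
  moreover have "x n [^] \<nu> n \<in> mpow (\<nu> n)" by (rule pow_in_ideal_power[OF m_ideal x_m])
  ultimately have "(\<Otimes>j\<in>{..<Suc n}. x j [^] \<nu> j) \<in> mpow (\<nu> n + (\<Sum>j<n. \<nu> j))"
    using Suc ideal_power_mult[OF m_ideal] by simp
  then show ?case by (simp add: add.commute)
qed

lemma mon_mpow_ge: "N \<le> exp_degree i \<nu> \<Longrightarrow> mon \<nu> \<in> mpow N"
  using mon_mpow ideal_power_antimono[OF m_ideal] by blast

definition trunc :: "((nat \<Rightarrow> nat) \<Rightarrow> 'a) \<Rightarrow> nat \<Rightarrow> 'a"
  where "trunc f N = (\<Oplus>\<nu>\<in>low_exps i N. f \<nu> \<otimes> mon \<nu>)"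

lemma term_closed: "f \<in> carrier A \<Longrightarrow> f \<nu> \<otimes> mon \<nu> \<in> carrier R"
  using coeff_k k_R mon_closed by blast

lemma term_mpow: "f \<in> carrier A \<Longrightarrow> N \<le> exp_degree i \<nu> \<Longrightarrow> f \<nu> \<otimes> mon \<nu> \<in> mpow N"
  using mon_mpow_ge ideal.I_l_closed[OF mpow_ideal] coeff_k k_R by blast

lemma trunc_closed: "f \<in> carrier A \<Longrightarrow> trunc f N \<in> carrier R"
  unfolding trunc_def using term_closed by (intro finsum_closed) auto

lemma mpow_minus_trans:
  assumes "a \<in> carrier R" "b \<in> carrier R" "c \<in> carrier R" "a \<ominus> b \<in> mpow N" "b \<ominus> c \<in> mpow N"
  shows "a \<ominus> c \<in> mpow N"
  using minus_minus_cancel[OF assms(1-3)] additive_subgroup.a_closed[OF ideal.axioms(1)[OF mpow_ideal] assms(4,5)] by simp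

lemma mpow_minus_sym:
  assumes "a \<in> carrier R" "b \<in> carrier R" "a \<ominus> b \<in> mpow N"
  shows "b \<ominus> a \<in> mpow N"
  using minus_swap[OF assms(1,2)] additive_subgroup.a_inv_closed[OF ideal.axioms(1)[OF mpow_ideal] assms(3)] by simp

lemma trunc_diff:
  assumes f: "f \<in> carrier A" and "M \<le> N"
  shows "trunc f N \<ominus> trunc f M \<in> mpow M"
proof -
  let ?D = "low_exps i N - low_exps i M"
  have un: "low_exps i N = low_exps i M \<union> ?D" using assms(2) by (auto simp: low_exps_def)
  have "trunc f N = trunc f M \<oplus> (\<Oplus>\<nu>\<in>?D. f \<nu> \<otimes> mon \<nu>)"
    unfolding trunc_def by (subst un, rule finsum_Un_disjoint) (use term_closed[OF f] low_exps_finite in auto)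
  moreover have D: "(\<Oplus>\<nu>\<in>?D. f \<nu> \<otimes> mon \<nu>) \<in> mpow M"
    by (intro finsum_in_ideal[OF mpow_ideal] term_mpow[OF f]) (auto simp: low_exps_def)
  moreover have "(\<Oplus>\<nu>\<in>?D. f \<nu> \<otimes> mon \<nu>) \<in> carrier R" using D ideal.Icarr[OF mpow_ideal] by blast
  ultimately show ?thesis using trunc_closed[OF f, of M] a_comm[of "trunc f M"] by (simp add: minus_eq a_assoc r_neg)
qed

text \<open>Terms of degree at least \<open>N\<close> lie in the \<open>N\<close>-th power of the
  ideal, so convergence automatically has this uniform rate. With it, values can be computed modulo
  each power separately.\<close>

lemma limit_iff:
  assumes f: "f \<in> carrier A" and r: "r \<in> carrier R"
  shows "adic_limit R \<mm> (trunc f) r \<longleftrightarrow> (\<forall>N. r \<ominus> trunc f N \<in> mpow N)"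
proof
  assume l: "adic_limit R \<mm> (trunc f) r"
  show "\<forall>N. r \<ominus> trunc f N \<in> mpow N"
  proof
    fix N
    obtain n\<^sub>0 where n\<^sub>0: "\<And>n. n \<ge> n\<^sub>0 \<Longrightarrow> trunc f n \<ominus> r \<in> mpow N" using l unfolding adic_limit_def by blast
    have "r \<ominus> trunc f (max n\<^sub>0 N) \<in> mpow N" by (intro mpow_minus_sym[OF trunc_closed[OF f] r] n\<^sub>0) simp
    moreover have "trunc f (max n\<^sub>0 N) \<ominus> trunc f N \<in> mpow N" using trunc_diff[OF f] by simp
    ultimately show "r \<ominus> trunc f N \<in> mpow N" by (rule mpow_minus_trans[OF r trunc_closed[OF f] trunc_closed[OF f]])
  qed
next
  assume a: "\<forall>N. r \<ominus> trunc f N \<in> mpow N"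
  show "adic_limit R \<mm> (trunc f) r"
    unfolding adic_limit_def
  proof (intro allI exI impI)
    fix N n :: nat assume "N \<le> n"
    then have "r \<ominus> trunc f n \<in> mpow N" using a ideal_power_antimono[OF m_ideal, of N n] by blast
    then show "trunc f n \<ominus> r \<in> mpow N" by (rule mpow_minus_sym[OF r trunc_closed[OF f]])
  qed
qed

lemma limit_exists:
  assumes f: "f \<in> carrier A"
  shows "\<exists>r\<in>carrier R. \<forall>N. r \<ominus> trunc f N \<in> mpow N"
proof -
  have "adic_Cauchy R \<mm> (trunc f)"
    unfolding adic_Cauchy_def
  proof (intro allI exI impI)
    note t = trunc_closed[OF f]
    fix N p q :: nat assume "N \<le> p" "N \<le> q"
    then have "trunc f p \<ominus> trunc f N \<in> mpow N" "trunc f N \<ominus> trunc f q \<in> mpow N"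
      using trunc_diff[OF f] mpow_minus_sym[OF t t] by blast+
    then show "trunc f p \<ominus> trunc f q \<in> mpow N" by (rule mpow_minus_trans[OF t t t])
  qed
  then obtain r where "r \<in> carrier R" "adic_limit R \<mm> (trunc f) r"
    using complete trunc_closed[OF f] unfolding adic_complete_def by blast
  then show ?thesis using limit_iff[OF f] by blast
qed

lemma separated:
  assumes "a \<in> carrier R" "b \<in> carrier R" "\<And>N. a \<ominus> b \<in> mpow N"
  shows "a = b"
proof -
  have "a \<ominus> b \<in> (\<Inter>N. mpow N)" using assms(3) by blast
  then have "a \<ominus> b = \<zero>" using complete unfolding adic_complete_def by auto
  then show ?thesis using assms(1,2) by simp
qed

definition value_at :: "((nat \<Rightarrow> nat) \<Rightarrow> 'a) \<Rightarrow> 'a"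
  where "value_at f = (SOME r. r \<in> carrier R \<and> (\<forall>N. r \<ominus> trunc f N \<in> mpow N))"

lemma value_at:
  assumes "f \<in> carrier A"
  shows "value_at f \<in> carrier R" "value_at f \<ominus> trunc f N \<in> mpow N"
proof -
  have "value_at f \<in> carrier R \<and> (\<forall>N. value_at f \<ominus> trunc f N \<in> mpow N)"
    unfolding value_at_def by (rule someI_ex) (use limit_exists[OF assms] in blast)
  then show "value_at f \<in> carrier R" "value_at f \<ominus> trunc f N \<in> mpow N" by blast+
qed

lemma value_at_eqI:
  assumes f: "f \<in> carrier A" and r: "r \<in> carrier R" "\<And>N. r \<ominus> trunc f N \<in> mpow N"
  shows "value_at f = r"
proof (rule separated)
  fix N
  have "trunc f N \<ominus> r \<in> mpow N" by (rule mpow_minus_sym[OF r(1) trunc_closed[OF f] r(2)])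
  then show "value_at f \<ominus> r \<in> mpow N"
    by (rule mpow_minus_trans[OF value_at(1)[OF f] trunc_closed[OF f] r(1) value_at(2)[OF f]])
qed (use value_at[OF f] r in auto)

lemma trunc_add:
  assumes f: "f \<in> carrier A" and g: "g \<in> carrier A"
  shows "trunc (f \<oplus>\<^bsub>A\<^esub> g) N = trunc f N \<oplus> trunc g N"
proof -
  note kR = k_R[OF coeff_k[OF f]] k_R[OF coeff_k[OF g]]
  have "trunc (f \<oplus>\<^bsub>A\<^esub> g) N = (\<Oplus>\<nu>\<in>low_exps i N. f \<nu> \<otimes> mon \<nu> \<oplus> g \<nu> \<otimes> mon \<nu>)"
    unfolding trunc_def using kR mon_closed by (intro finsum_cong') (auto simp: l_distr)
  also have "\<dots> = trunc f N \<oplus> trunc g N"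
    unfolding trunc_def using kR mon_closed by (intro finsum_addf) auto
  finally show ?thesis .
qed

text \<open>The product of the truncations contains in addition the pairs of low exponents whose sum
  has degree at least \<open>N\<close>; their terms lie in the \<open>N\<close>-th power of the
  ideal.\<close>

lemma trunc_mult:
  assumes f: "f \<in> carrier A" and g: "g \<in> carrier A"
  shows "trunc f N \<otimes> trunc g N \<ominus> trunc (f \<otimes>\<^bsub>A\<^esub> g) N \<in> mpow N"
proof -
  note kR [simp] = k_R[OF coeff_k[OF f]] k_R[OF coeff_k[OF g]] mon_closed
  let ?L = "low_exps i N"
  let ?t = "\<lambda>p. f (fst p) \<otimes> g (snd p) \<otimes> mon (fst p + snd p)"
  let ?T = "{p \<in> ?L \<times> ?L. fst p + snd p \<in> ?L}"
  note fin = low_exps_finite[of i N]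
  have T: "Sigma ?L (\<lambda>\<nu>. {..\<nu>}) = (\<lambda>p. (fst p + snd p, fst p)) ` ?T"
  proof (intro equalityI subsetI)
    fix p assume "p \<in> Sigma ?L (\<lambda>\<nu>. {..\<nu>})"
    then obtain \<nu> \<mu> where p: "p = (\<nu>, \<mu>)" "\<nu> \<in> ?L" "\<mu> \<le> \<nu>" by auto
    have "\<mu> \<in> ?L" "\<nu> - \<mu> \<in> ?L"
      using p(2) exps_le[OF p(3), of i] exp_degree_mono[OF p(3), of i] exp_degree_mono[OF fun_diff_le[of \<nu> \<mu>], of i]
      by (simp_all add: low_exps_def)
    then have "(\<mu>, \<nu> - \<mu>) \<in> ?T" using p by (simp add: fun_diff_add)
    moreover have "p = (fst (\<mu>, \<nu> - \<mu>) + snd (\<mu>, \<nu> - \<mu>), fst (\<mu>, \<nu> - \<mu>))" using p by (simp add: fun_diff_add)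
    ultimately show "p \<in> (\<lambda>p. (fst p + snd p, fst p)) ` ?T" by blast
  qed auto
  have "trunc f N \<otimes> trunc g N = (\<Oplus>\<nu>\<in>?L. f \<nu> \<otimes> mon \<nu> \<otimes> trunc g N)"
    unfolding trunc_def[of f] using fin trunc_closed[OF g] by (intro finsum_ldistr) auto
  also have "\<dots> = (\<Oplus>\<nu>\<in>?L. \<Oplus>\<mu>\<in>?L. f \<nu> \<otimes> mon \<nu> \<otimes> (g \<mu> \<otimes> mon \<mu>))"
    unfolding trunc_def[of g] using fin by (intro finsum_cong' finsum_rdistr) (auto intro!: finsum_closed)
  also have "\<dots> = (\<Oplus>p\<in>?L \<times> ?L. f (fst p) \<otimes> mon (fst p) \<otimes> (g (snd p) \<otimes> mon (snd p)))"
    using fin by (intro finsum_Sigma) auto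
  also have "\<dots> = (\<Oplus>p\<in>?L \<times> ?L. ?t p)"
    by (intro finsum_cong') (auto simp: mon_add m_ac)
  also have "\<dots> = (\<Oplus>p\<in>?T \<union> (?L \<times> ?L - ?T). ?t p)" by (rule arg_cong2[where f = "finsum R"]) auto
  also have "\<dots> = (\<Oplus>p\<in>?T. ?t p) \<oplus> (\<Oplus>p\<in>?L \<times> ?L - ?T. ?t p)"
    using fin by (intro finsum_Un_disjoint) auto
  finally have 1: "trunc f N \<otimes> trunc g N = (\<Oplus>p\<in>?T. ?t p) \<oplus> (\<Oplus>p\<in>?L \<times> ?L - ?T. ?t p)" .
  \<comment> \<open>Coefficients of the product are sums in \<open>k\<close>, whereas truncations
    are sums in \<open>R\<close>.\<close>
  have prod: "(f \<otimes>\<^bsub>A\<^esub> g) \<nu> = (\<Oplus>\<mu>\<in>{..\<nu>}. f \<mu> \<otimes> g (\<nu> - \<mu>))" if "\<nu> \<in> exps i" for \<nu>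
    unfolding P.A_mult[OF that] using coeff_k[OF f] coeff_k[OF g] subfieldE(1,6)[OF k_subfield] ring_axioms
    by (subst finsum_subring_eq) (auto simp: subringE(6))
  have "trunc (f \<otimes>\<^bsub>A\<^esub> g) N = (\<Oplus>\<nu>\<in>?L. \<Oplus>\<mu>\<in>{..\<nu>}. f \<mu> \<otimes> g (\<nu> - \<mu>) \<otimes> mon \<nu>)"
    unfolding trunc_def
    by (intro finsum_cong') (auto simp: low_exps_def prod finsum_ldistr intro!: finsum_closed)
  also have "\<dots> = (\<Oplus>p\<in>Sigma ?L (\<lambda>\<nu>. {..\<nu>}). f (snd p) \<otimes> g (fst p - snd p) \<otimes> mon (fst p))"
    using fin by (intro finsum_Sigma) (auto simp: low_exps_def)
  also have "\<dots> = (\<Oplus>p\<in>?T. ?t p)"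
    unfolding T by (subst finsum_reindex) (auto simp: inj_on_def)
  finally have 2: "trunc (f \<otimes>\<^bsub>A\<^esub> g) N = (\<Oplus>p\<in>?T. ?t p)" .
  have 3: "(\<Oplus>p\<in>?L \<times> ?L - ?T. ?t p) \<in> mpow N"
  proof (rule finsum_in_ideal[OF mpow_ideal])
    fix p assume "p \<in> ?L \<times> ?L - ?T"
    then have "N \<le> exp_degree i (fst p + snd p)" by (auto simp: low_exps_def)
    then show "?t p \<in> mpow N" using mon_mpow_ge ideal.I_l_closed[OF mpow_ideal] by simp
  qed
  have "(\<Oplus>p\<in>?T. ?t p) \<in> carrier R" by (intro finsum_closed) auto
  moreover have "(\<Oplus>p\<in>?L \<times> ?L - ?T. ?t p) \<in> carrier R" by (intro finsum_closed) auto
  ultimately have "trunc f N \<otimes> trunc g N \<ominus> trunc (f \<otimes>\<^bsub>A\<^esub> g) N = (\<Oplus>p\<in>?L \<times> ?L - ?T. ?t p)"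
    unfolding 1 2 using a_comm[of "\<Oplus>p\<in>?T. ?t p"] by (simp add: minus_eq a_assoc r_neg)
  then show ?thesis using 3 by simp
qed

lemma value_at_hom: "value_at \<in> ring_hom A R"
proof (rule ring_hom_memI)
  fix f assume f: "f \<in> carrier A"
  show "value_at f \<in> carrier R" using value_at f by blast
  fix g assume g: "g \<in> carrier A"
  note c = value_at(1)[OF f] value_at(1)[OF g] trunc_closed[OF f] trunc_closed[OF g]
  show "value_at (f \<oplus>\<^bsub>A\<^esub> g) = value_at f \<oplus> value_at g"
  proof (rule value_at_eqI)
    fix N
    have "(value_at f \<oplus> value_at g) \<ominus> trunc (f \<oplus>\<^bsub>A\<^esub> g) N = (value_at f \<ominus> trunc f N) \<oplus> (value_at g \<ominus> trunc g N)"
      unfolding trunc_add[OF f g] using c by (simp add: minus_eq minus_add a_ac)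
    then show "(value_at f \<oplus> value_at g) \<ominus> trunc (f \<oplus>\<^bsub>A\<^esub> g) N \<in> mpow N"
      using value_at(2)[OF f] value_at(2)[OF g] additive_subgroup.a_closed[OF ideal.axioms(1)[OF mpow_ideal]] by simp
  qed (use f g c in \<open>auto simp del: P.A_add\<close>)
  \<comment> \<open>One factor at a time is replaced by its truncation, before the truncation of the
    product is compared.\<close>
  show "value_at (f \<otimes>\<^bsub>A\<^esub> g) = value_at f \<otimes> value_at g"
  proof (rule value_at_eqI)
    fix N
    have "value_at f \<otimes> value_at g \<ominus> value_at f \<otimes> trunc g N = value_at f \<otimes> (value_at g \<ominus> trunc g N)"
      using c by (simp add: minus_eq r_distr r_minus)
    then have 1: "value_at f \<otimes> value_at g \<ominus> value_at f \<otimes> trunc g N \<in> mpow N"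
      using value_at(2)[OF g] c ideal.I_l_closed[OF mpow_ideal] by simp
    have "value_at f \<otimes> trunc g N \<ominus> trunc f N \<otimes> trunc g N = (value_at f \<ominus> trunc f N) \<otimes> trunc g N"
      using c by (simp add: minus_eq l_distr l_minus)
    then have 2: "value_at f \<otimes> trunc g N \<ominus> trunc f N \<otimes> trunc g N \<in> mpow N"
      using value_at(2)[OF f] c ideal.I_r_closed[OF mpow_ideal] by simp
    have "value_at f \<otimes> value_at g \<ominus> trunc f N \<otimes> trunc g N \<in> mpow N"
      by (rule mpow_minus_trans[OF _ _ _ 1 2]) (use c in auto)
    from mpow_minus_trans[OF _ _ _ this trunc_mult[OF f g]]
    show "value_at f \<otimes> value_at g \<ominus> trunc (f \<otimes>\<^bsub>A\<^esub> g) N \<in> mpow N"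
      using c trunc_closed[OF P.A.m_closed[OF f g]] by simp
  qed (use f g c in auto)
next
  show "value_at \<one>\<^bsub>A\<^esub> = \<one>"
  proof (rule value_at_eqI)
    fix N
    show "\<one> \<ominus> trunc \<one>\<^bsub>A\<^esub> N \<in> mpow N"
    proof (cases N)
      case 0
      then show ?thesis using trunc_closed[OF P.A.one_closed] by simp
    next
      case (Suc n)
      have "trunc \<one>\<^bsub>A\<^esub> N = (\<Oplus>\<nu>\<in>low_exps i N. if 0 = \<nu> then mon \<nu> else \<zero>)"
        unfolding trunc_def using mon_closed by (intro finsum_cong') (auto simp: P.A_one)
      also have "\<dots> = mon 0"
        using low_exps_finite mon_closed Suc by (intro finsum_singleton) (auto simp: low_exps_def exp_degree_def)
      finally show ?thesis using additive_subgroup.zero_closed[OF ideal.axioms(1)[OF mpow_ideal]]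
        by (simp add: mon_0 minus_eq r_neg)
    qed
  qed auto
qed

end

section \<open>Injectivity and integral closedness of the evaluation\<close>

context evaluation
begin

lemmas value_at_mult = ring_hom_mult[OF value_at_hom]
lemmas value_at_add = ring_hom_add[OF value_at_hom]
lemmas value_at_one = ring_hom_one[OF value_at_hom]

lemma value_at_ring_hom_cring: "ring_hom_cring A R value_at"
  using P.A_cring is_cring value_at_hom by (intro ring_hom_cringI) auto

lemma value_at_zero: "value_at \<zero>\<^bsub>A\<^esub> = \<zero>"
  using ring_hom_cring.hom_zero[OF value_at_ring_hom_cring] .

lemma value_at_minus: "f \<in> carrier A \<Longrightarrow> g \<in> carrier A \<Longrightarrow> value_at (f \<ominus>\<^bsub>A\<^esub> g) = value_at f \<ominus> value_at g"
  using value_at_add[of f "\<ominus>\<^bsub>A\<^esub> g"] ring_hom_cring.hom_a_inv[OF value_at_ring_hom_cring, of g]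
  by (simp add: P.A.minus_eq minus_eq del: P.A_add)

lemma value_at_monomial:
  assumes "\<nu> \<in> exps i"
  shows "value_at (P.monomial \<one> \<nu>) = mon \<nu>"
proof (rule value_at_eqI)
  show m: "P.monomial \<one> \<nu> \<in> carrier A" using P.monomial_closed[of \<one> \<nu>] assms subfieldE(1)[OF k_subfield] by (simp add: subringE(3))
  fix N
  have "trunc (P.monomial \<one> \<nu>) N = (\<Oplus>\<mu>\<in>low_exps i N. if \<nu> = \<mu> then mon \<mu> else \<zero>)"
    unfolding trunc_def using mon_closed by (intro finsum_cong') (auto simp: P.monomial_def)
  also have "\<dots> = (if \<nu> \<in> low_exps i N then mon \<nu> else \<zero>)"
  proof (cases "\<nu> \<in> low_exps i N")
    case True
    then show ?thesis using low_exps_finite mon_closed by (simp add: finsum_singleton)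
  next
    case False
    then have "(\<Oplus>\<mu>\<in>low_exps i N. if \<nu> = \<mu> then mon \<mu> else \<zero>) = (\<Oplus>\<mu>\<in>low_exps i N. \<zero>)"
      by (intro finsum_cong') auto
    then show ?thesis using False by simp
  qed
  finally have t: "trunc (P.monomial \<one> \<nu>) N = (if \<nu> \<in> low_exps i N then mon \<nu> else \<zero>)" .
  show "mon \<nu> \<ominus> trunc (P.monomial \<one> \<nu>) N \<in> mpow N"
  proof (cases "\<nu> \<in> low_exps i N")
    case True
    then show ?thesis unfolding t using additive_subgroup.zero_closed[OF ideal.axioms(1)[OF mpow_ideal]] mon_closed
      by (simp add: minus_eq r_neg)
  next
    case False
    then show ?thesis unfolding t using assms mon_mpow_ge[of N \<nu>] mon_closed by (simp add: minus_eq low_exps_def)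
  qed
qed (rule mon_closed)

section \<open>Boxes of exponents and ideals of powers\<close>

definition powers_ideal :: "nat \<Rightarrow> 'a set"
  where "powers_ideal M = genideal R ((\<lambda>l. x l [^] M) ` {..<i})"

lemma powers_ideal: "ideal (powers_ideal M) R"
  unfolding powers_ideal_def using x_R by (intro genideal_ideal) auto

lemma powers_ideal_gen: "l < i \<Longrightarrow> x l [^] M \<in> powers_ideal M"
proof -
  have "(\<lambda>l. x l [^] M) ` {..<i} \<subseteq> powers_ideal M"
    unfolding powers_ideal_def using x_R by (intro genideal_self) auto
  then show "l < i \<Longrightarrow> x l [^] M \<in> powers_ideal M" by auto
qed

text \<open>The largest exponent with all entries less than \<open>M\<close>. As a bound for an
  element of the dual it belongs to the denominator \<open>(x 0 ... x (i-1))^M\<close>, because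
  inverse exponents are shifted by one.\<close>

definition box :: "nat \<Rightarrow> nat \<Rightarrow> nat"
  where "box M = (\<lambda>j. if j < i then M - 1 else 0)"

lemma box_exps: "box M \<in> exps i"
  by (simp add: box_def exps_def)

lemma le_box: "M \<ge> 1 \<Longrightarrow> \<nu> \<le> box M \<longleftrightarrow> \<nu> \<in> exps i \<and> (\<forall>j<i. \<nu> j < M)"
proof -
  assume M: "M \<ge> 1"
  have "\<nu> j \<le> box M j \<longleftrightarrow> (if j < i then \<nu> j < M else \<nu> j = 0)" for j using M by (auto simp: box_def)
  then show ?thesis unfolding le_fun_def exps_def by (auto simp: not_less[symmetric])
qed

lemma box_mono: "M \<le> N \<Longrightarrow> box M \<le> box N"
  by (auto simp: box_def le_fun_def)

lemma exists_box:
  assumes "T \<in> exps i"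
  shows "\<exists>M\<ge>1. T \<le> box M"
proof -
  have "T j \<le> (\<Sum>j<i. T j)" if "j < i" for j using that by (intro member_le_sum) auto
  then have "T \<le> box (Suc (\<Sum>j<i. T j))" using assms by (simp add: le_box less_Suc_eq_le)
  then show ?thesis by (intro exI[of _ "Suc (\<Sum>j<i. T j)"]) simp
qed

definition unit_exp :: "nat \<Rightarrow> nat \<Rightarrow> nat \<Rightarrow> nat"
  where "unit_exp M l = (\<lambda>j. if j = l then M else 0)"

lemma mon_unit_exp:
  assumes "l < i"
  shows "mon (unit_exp M l) = x l [^] M"
proof -
  have "mon (unit_exp M l) = (\<Otimes>j\<in>{..<i}. if l = j then x j [^] M else \<one>)"
    unfolding monomial_value_def using x_R by (intro finprod_cong') (auto simp: unit_exp_def)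
  also have "\<dots> = x l [^] M" using assms x_R by (intro finprod_singleton) auto
  finally show ?thesis .
qed

text \<open>A series has infinitely many terms, so its value cannot be treated term by term. Instead
  a multiple of the \<open>M\<close>-th power of one indeterminate is split off, for each
  indeterminate in turn; values respect the resulting finite sum.\<close>

lemma value_at_powers_ideal:
  assumes "f \<in> carrier A" "\<And>\<nu>. \<nu> \<in> exps i \<Longrightarrow> \<forall>j<i. \<nu> j < M \<Longrightarrow> f \<nu> = \<zero>"
  shows "value_at f \<in> powers_ideal M"
proof -
  interpret I: ideal "powers_ideal M" R by (rule powers_ideal)
  \<comment> \<open>The bound \<open>l\<close> counts the indeterminates still to be treated. For
    \<open>l = 0\<close> the hypothesis says that \<open>f\<close> vanishes.\<close>
  have "f \<in> carrier A \<Longrightarrow> l \<le> i \<Longrightarrow> (\<And>\<nu>. \<nu> \<in> exps i \<Longrightarrow> \<forall>j<l. \<nu> j < M \<Longrightarrow> f \<nu> = \<zero>) \<Longrightarrow> value_at f \<in> powers_ideal M" for l f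
  proof (induction l arbitrary: f)
    case 0
    have "f \<nu> = \<zero>" for \<nu>
      using 0(3)[of \<nu>] P.coeff_out[OF 0(1), of \<nu>] by (cases "\<nu> \<in> exps i") auto
    then have "f = \<zero>\<^bsub>A\<^esub>" by (simp add: P.A_zero_eq fun_eq_iff)
    then show ?case using value_at_zero I.zero_closed by (simp del: P.A_zero)
  next
    case (Suc l)
    let ?e = "unit_exp M l"
    have l: "l < i" using Suc by simp
    have e: "?e \<in> exps i" using l by (simp add: exps_def unit_exp_def)
    define g where "g \<nu> = (if \<nu> \<in> exps i then f (?e + \<nu>) else \<zero>)" for \<nu>
    define h where "h \<nu> = (if \<nu> l < M then f \<nu> else \<zero>)" for \<nu>
    have k0: "\<zero> \<in> k" using subfieldE(1)[OF k_subfield] by (simp add: subringE(2))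
    have gA: "g \<in> carrier A" using coeff_k[OF Suc.prems(1)] k0 by (intro P.A_carrierI) (auto simp: g_def)
    have hA: "h \<in> carrier A" using coeff_k[OF Suc.prems(1)] k0 P.coeff_out[OF Suc.prems(1)] by (intro P.A_carrierI) (auto simp: h_def)
    have mA: "P.monomial \<one> ?e \<in> carrier A" using P.monomial_closed[of \<one> ?e] e subfieldE(1)[OF k_subfield] by (simp add: subringE(3))
    have mg: "(P.monomial \<one> ?e \<otimes>\<^bsub>A\<^esub> g) \<nu> = (if ?e \<le> \<nu> then g (\<nu> - ?e) else \<zero>)" for \<nu>
      using P.monomial_mult[of \<one> ?e g \<nu>] e gA subfieldE(1)[OF k_subfield] k_R[OF coeff_k[OF gA]] by (simp add: subringE(3))
    have le: "?e \<le> \<nu> \<longleftrightarrow> M \<le> \<nu> l" for \<nu> by (auto simp: le_fun_def unit_exp_def)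
    have "f = P.monomial \<one> ?e \<otimes>\<^bsub>A\<^esub> g \<oplus>\<^bsub>A\<^esub> h"
    proof
      fix \<nu>
      have fk: "f \<nu> \<in> carrier R" using k_R[OF coeff_k[OF Suc.prems(1)]] .
      show "f \<nu> = (P.monomial \<one> ?e \<otimes>\<^bsub>A\<^esub> g \<oplus>\<^bsub>A\<^esub> h) \<nu>"
      proof (cases "M \<le> \<nu> l")
        case True
        then have "?e + (\<nu> - ?e) = \<nu>" using le by (intro fun_diff_add) simp
        moreover have "\<nu> - ?e \<in> exps i \<longleftrightarrow> \<nu> \<in> exps i" using calculation e exps_add_iff by metis
        ultimately show ?thesis using True le fk P.coeff_out[OF Suc.prems(1)] by (auto simp: mg h_def g_def)
      next
        case False
        then show ?thesis using le fk by (simp add: mg h_def)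
      qed
    qed
    then have "value_at f = value_at (P.monomial \<one> ?e \<otimes>\<^bsub>A\<^esub> g \<oplus>\<^bsub>A\<^esub> h)" by simp
    also have "\<dots> = value_at (P.monomial \<one> ?e) \<otimes> value_at g \<oplus> value_at h"
      using value_at_add[of "P.monomial \<one> ?e \<otimes>\<^bsub>A\<^esub> g" h] value_at_mult[OF mA gA] mA gA hA by (simp del: P.A_add)
    also have "\<dots> = x l [^] M \<otimes> value_at g \<oplus> value_at h" using value_at_monomial[OF e] mon_unit_exp[OF l] by simp
    finally have eq: "value_at f = x l [^] M \<otimes> value_at g \<oplus> value_at h" .
    have "x l [^] M \<otimes> value_at g \<in> powers_ideal M"
      using powers_ideal_gen[OF l] value_at(1)[OF gA] by (rule I.I_r_closed)
    moreover have "value_at h \<in> powers_ideal M"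
    proof (rule Suc.IH)
      show "l \<le> i" using l by simp
      show "h \<nu> = \<zero>" if "\<nu> \<in> exps i" "\<forall>j<l. \<nu> j < M" for \<nu>
        using that Suc.prems(3)[of \<nu>] by (auto simp: h_def less_Suc_eq)
    qed (rule hA)
    ultimately show ?case unfolding eq by (rule I.a_closed)
  qed
  from this[OF assms(1), of i] show ?thesis using assms(2) by simp
qed

text \<open>Modulo the ideal of \<open>M\<close>-th powers the value depends only on the
  coefficients in the box.\<close>

lemma value_at_cong_box:
  assumes f: "f \<in> carrier A" and g: "g \<in> carrier A" and M: "M \<ge> 1"
    and eq: "\<And>\<nu>. \<nu> \<le> box M \<Longrightarrow> f \<nu> = g \<nu>" and fI: "value_at f \<in> powers_ideal M"
  shows "value_at g \<in> powers_ideal M"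
proof -
  interpret I: ideal "powers_ideal M" R by (rule powers_ideal)
  have "value_at (f \<ominus>\<^bsub>A\<^esub> g) \<in> powers_ideal M"
  proof (rule value_at_powers_ideal)
    show "f \<ominus>\<^bsub>A\<^esub> g \<in> carrier A" using f g by simp
    fix \<nu> assume "\<nu> \<in> exps i" "\<forall>j<i. \<nu> j < M"
    then have "f \<nu> = g \<nu>" using eq le_box[OF M] by blast
    then show "(f \<ominus>\<^bsub>A\<^esub> g) \<nu> = \<zero>"
      using P.A_minus[OF f g, of \<nu>] P.r_neg[OF P.coeff_closed[OF g, of \<nu>]] by (simp add: P.minus_eq)
  qed
  then have "value_at f \<ominus> value_at g \<in> powers_ideal M" using value_at_minus[OF f g] by simp
  then have "value_at f \<oplus> \<ominus> (value_at f \<ominus> value_at g) \<in> powers_ideal M" using fI by blast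
  moreover have "value_at f \<oplus> \<ominus> (value_at f \<ominus> value_at g) = value_at g"
    unfolding minus_swap[OF value_at(1)[OF f] value_at(1)[OF g]]
    using value_at(1)[OF f] value_at(1)[OF g] a_comm[of "value_at f" "value_at g \<ominus> value_at f"]
    by (simp add: minus_eq a_assoc l_neg)
  ultimately show ?thesis by simp
qed

text \<open>
  \<open>dead_inverse\<close> is the kernel of \<open>P.dual \<rightarrow> P.dual \<otimes> R\<close>, the target being the top local
  cohomology of \<open>R\<close> in its description by the Cech complex.
\<close>

definition dead_inverse :: "((nat \<Rightarrow> nat) \<Rightarrow> 'a) set"
  where "dead_inverse = {e \<in> P.dual. \<exists>M\<ge>1. (\<forall>\<nu>. \<not> \<nu> \<le> box M \<longrightarrow> e \<nu> = \<zero>) \<and>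
    value_at (P.reverse (box M) e) \<in> powers_ideal M}"

lemma reverse_box_closed: "e \<in> P.dual \<Longrightarrow> P.reverse (box M) e \<in> carrier A"
  by (rule P.reverse_closed[OF box_exps P.dual_coeff])

text \<open>These multiplications are the transition maps \<open>R / powers_ideal M\<close> to
  \<open>R / powers_ideal N\<close>, whose direct limit is the top local cohomology; here their
  well-definedness.\<close>

lemma powers_ideal_step:
  assumes "M \<ge> 1" "M \<le> N" "z \<in> powers_ideal M"
  shows "mon (box N - box M) \<otimes> z \<in> powers_ideal N"
proof -
  interpret I: ideal "powers_ideal N" R by (rule powers_ideal)
  let ?m = "mon (box N - box M)"
  define K where "K = {z \<in> carrier R. ?m \<otimes> z \<in> powers_ideal N}"
  have "ideal K R"
  proof (rule idealI[OF ring_axioms])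
    have "\<zero> \<in> K" unfolding K_def using mon_closed I.zero_closed by simp
    then show "subgroup K (add_monoid R)"
      using mon_closed by (intro add.subgroupI) (auto simp: K_def r_distr r_minus)
  next
    fix a r assume a: "a \<in> K" and r: "r \<in> carrier R"
    then have ac: "a \<in> carrier R" "?m \<otimes> a \<in> powers_ideal N" by (auto simp: K_def)
    have "?m \<otimes> (r \<otimes> a) = r \<otimes> (?m \<otimes> a)" using ac r mon_closed by (simp add: m_ac)
    then show "r \<otimes> a \<in> K" using ac r I.I_l_closed by (simp add: K_def)
    then show "a \<otimes> r \<in> K" using ac r by (simp add: m_comm)
  qed
  moreover have "(\<lambda>l. x l [^] M) ` {..<i} \<subseteq> K"
  proof safe
    fix l assume l: "l < i"
    have "box N - box M + unit_exp M l = unit_exp N l + (\<lambda>j. if j = l then 0 else (box N - box M) j)"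
      using assms(1,2) l by (auto simp: fun_eq_iff box_def unit_exp_def)
    then have "?m \<otimes> x l [^] M = x l [^] N \<otimes> mon (\<lambda>j. if j = l then 0 else (box N - box M) j)"
      using mon_add[of "box N - box M" "unit_exp M l"] mon_add[of "unit_exp N l"] mon_unit_exp[OF l] by metis
    then show "x l [^] M \<in> K" unfolding K_def using I.I_r_closed[OF powers_ideal_gen[OF l] mon_closed] x_R by simp
  qed
  ultimately have "powers_ideal M \<subseteq> K" unfolding powers_ideal_def by (rule genideal_minimal)
  then show ?thesis using assms(3) by (auto simp: K_def)
qed

lemma k_one: "\<one> \<in> k"
  using subfieldE(1)[OF k_subfield] by (simp add: subringE(3))

text \<open>Enlarging the common denominator multiplies the numerator by the quotient of the
  denominators, which is a transition map. An element that has died therefore stays dead, and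
  different elements can be compared in one box.\<close>

lemma dead_inverse_enlarge:
  assumes e: "e \<in> P.dual" and M: "M \<ge> 1" "M \<le> N" "\<And>\<nu>. \<not> \<nu> \<le> box M \<Longrightarrow> e \<nu> = \<zero>"
    and v: "value_at (P.reverse (box M) e) \<in> powers_ideal M"
  shows "value_at (P.reverse (box N) e) \<in> powers_ideal N"
proof -
  let ?d = "box N - box M"
  have d: "?d \<in> exps i" using box_exps by simp
  have le: "box M \<le> box N" by (rule box_mono[OF M(2)])
  have rA: "P.reverse (box M) e \<in> carrier A" by (rule reverse_box_closed[OF e])
  have "P.reverse (box N) e = P.monomial \<one> ?d \<otimes>\<^bsub>A\<^esub> P.reverse (box M) e"
  proof
    fix \<kappa>
    have m: "(P.monomial \<one> ?d \<otimes>\<^bsub>A\<^esub> P.reverse (box M) e) \<kappa> = (if ?d \<le> \<kappa> then P.reverse (box M) e (\<kappa> - ?d) else \<zero>)"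
      using P.monomial_mult[of \<one> ?d "P.reverse (box M) e" \<kappa>] k_one d rA k_R[OF coeff_k[OF rA]] by simp
    show "P.reverse (box N) e \<kappa> = (P.monomial \<one> ?d \<otimes>\<^bsub>A\<^esub> P.reverse (box M) e) \<kappa>"
    proof (cases "?d \<le> \<kappa> \<and> \<kappa> \<le> box N")
      case True
      then have j: "box N j - box M j \<le> \<kappa> j" "\<kappa> j \<le> box N j" "box M j \<le> box N j" for j
        using le by (auto simp: le_fun_def)
      have "\<kappa> j - (box N j - box M j) \<le> box M j" "box M j - (\<kappa> j - (box N j - box M j)) = box N j - \<kappa> j" for j
        using j[of j] by arith+
      then have "\<kappa> - ?d \<le> box M" "box M - (\<kappa> - ?d) = box N - \<kappa>"
        by (simp_all add: le_fun_def fun_eq_iff)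
      then show ?thesis using True by (simp add: m P.reverse_def)
    next
      case False
      show ?thesis
      proof (cases "\<kappa> \<le> box N")
        case True
        then have nd: "\<not> ?d \<le> \<kappa>" using False by simp
        have "\<not> box N - \<kappa> \<le> box M"
        proof
          assume "box N - \<kappa> \<le> box M"
          then have "box N j - \<kappa> j \<le> box M j" for j by (simp add: le_fun_def)
          then have "box N j - box M j \<le> \<kappa> j" for j by (metis le_diff_conv add.commute)
          then show False using nd by (simp add: le_fun_def)
        qed
        then show ?thesis using True nd M(3) by (simp add: m P.reverse_def)
      next
        case False
        have "\<not> \<kappa> - ?d \<le> box M" if dk: "?d \<le> \<kappa>"
        proof
          assume "\<kappa> - ?d \<le> box M"
          then have "?d + (\<kappa> - ?d) \<le> ?d + box M" by (simp add: le_fun_def)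
          moreover have "?d + box M = box N" using fun_diff_add[OF le] by (simp add: add.commute)
          ultimately show False using False fun_diff_add[OF dk] by simp
        qed
        then show ?thesis using False by (auto simp: m P.reverse_def)
      qed
    qed
  qed
  then have "value_at (P.reverse (box N) e) = mon ?d \<otimes> value_at (P.reverse (box M) e)"
    using value_at_mult[OF _ rA, of "P.monomial \<one> ?d"] value_at_monomial[OF d] P.monomial_closed[of \<one> ?d] k_one d by simp
  then show ?thesis using powers_ideal_step[OF M(1,2) v] by simp
qed

end

context evaluation
begin

section \<open>The dead inverse polynomials as a proper subspace\<close>

lemma dead_inverse_zero: "\<zero>\<^bsub>A\<^esub> \<in> dead_inverse"
proof -
  have "P.reverse (box 1) \<zero>\<^bsub>A\<^esub> = \<zero>\<^bsub>A\<^esub>" by (simp add: fun_eq_iff P.reverse_def)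
  then have "value_at (P.reverse (box 1) \<zero>\<^bsub>A\<^esub>) \<in> powers_ideal 1"
    using value_at_zero additive_subgroup.zero_closed[OF ideal.axioms(1)[OF powers_ideal]] by metis
  then show ?thesis unfolding dead_inverse_def using P.dual_zero P.A_zero by auto
qed

lemma dead_inverse_minus:
  assumes "e \<in> dead_inverse" "e' \<in> dead_inverse"
  shows "e \<ominus>\<^bsub>A\<^esub> e' \<in> dead_inverse"
proof -
  obtain M where e: "e \<in> P.dual" "M \<ge> 1" "\<And>\<nu>. \<not> \<nu> \<le> box M \<Longrightarrow> e \<nu> = \<zero>" "value_at (P.reverse (box M) e) \<in> powers_ideal M"
    using assms(1) unfolding dead_inverse_def by blast
  obtain M' where e': "e' \<in> P.dual" "M' \<ge> 1" "\<And>\<nu>. \<not> \<nu> \<le> box M' \<Longrightarrow> e' \<nu> = \<zero>" "value_at (P.reverse (box M') e') \<in> powers_ideal M'"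
    using assms(2) unfolding dead_inverse_def by blast
  define N where "N = max M M'"
  have N: "M \<le> N" "M' \<le> N" "N \<ge> 1" using e(2) by (auto simp: N_def)
  interpret I: ideal "powers_ideal N" R by (rule powers_ideal)
  note d = P.dual_minus[OF e(1) e'(1)]
  note c = P.dual_A[OF e(1)] P.dual_A[OF e'(1)]
  have v: "value_at (P.reverse (box N) e) \<in> powers_ideal N" "value_at (P.reverse (box N) e') \<in> powers_ideal N"
    using dead_inverse_enlarge[OF e(1,2) N(1) e(3,4)] dead_inverse_enlarge[OF e'(1,2) N(2) e'(3,4)] by auto
  have "P.reverse (box N) (e \<ominus>\<^bsub>A\<^esub> e') = P.reverse (box N) e \<ominus>\<^bsub>A\<^esub> P.reverse (box N) e'"
  proof
    fix \<kappa>
    have "\<zero> \<ominus>\<^bsub>R\<lparr>carrier := k\<rparr>\<^esub> \<zero> = \<zero>" using P.minus_eq[of \<zero> \<zero>] P.minus_zero P.r_zero[OF P.zero_closed] by simp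
    then show "P.reverse (box N) (e \<ominus>\<^bsub>A\<^esub> e') \<kappa> = (P.reverse (box N) e \<ominus>\<^bsub>A\<^esub> P.reverse (box N) e') \<kappa>"
      using P.A_minus[OF c] P.A_minus[OF reverse_box_closed[OF e(1)] reverse_box_closed[OF e'(1)], of N N \<kappa>]
      by (simp add: P.reverse_def)
  qed
  then have "value_at (P.reverse (box N) (e \<ominus>\<^bsub>A\<^esub> e')) = value_at (P.reverse (box N) e) \<ominus> value_at (P.reverse (box N) e')"
    using value_at_minus[OF reverse_box_closed[OF e(1)] reverse_box_closed[OF e'(1)]] by simp
  then have "value_at (P.reverse (box N) (e \<ominus>\<^bsub>A\<^esub> e')) \<in> powers_ideal N"
    using v by (simp add: minus_eq)
  moreover have "(e \<ominus>\<^bsub>A\<^esub> e') \<nu> = \<zero>" if "\<not> \<nu> \<le> box N" for \<nu>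
  proof -
    have "\<not> \<nu> \<le> box M" "\<not> \<nu> \<le> box M'" using that box_mono[OF N(1)] box_mono[OF N(2)] order_trans by blast+
    then have "e \<nu> = \<zero>" "e' \<nu> = \<zero>" using e(3) e'(3) by blast+
    then show ?thesis using P.A_minus[OF c, of \<nu>] P.minus_eq[of \<zero> \<zero>] P.minus_zero P.r_zero[OF P.zero_closed] by simp
  qed
  ultimately show ?thesis unfolding dead_inverse_def using d N(3) by blast
qed

lemma dead_inverse_scale:
  assumes c: "c \<in> k" and "e \<in> dead_inverse"
  shows "P.scale c e \<in> dead_inverse"
proof -
  obtain M where e: "e \<in> P.dual" "M \<ge> 1" "\<And>\<nu>. \<not> \<nu> \<le> box M \<Longrightarrow> e \<nu> = \<zero>" "value_at (P.reverse (box M) e) \<in> powers_ideal M"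
    using assms(2) unfolding dead_inverse_def by blast
  interpret I: ideal "powers_ideal M" R by (rule powers_ideal)
  note r = reverse_box_closed[OF e(1), of M]
  have m: "P.monomial c 0 \<in> carrier A" using P.monomial_closed[of c 0] c by simp
  have cR: "c \<in> carrier R" by (rule k_R[OF c])
  have z: "(0 :: nat \<Rightarrow> nat) \<le> \<kappa>" "\<kappa> - 0 = \<kappa>" for \<kappa> :: "nat \<Rightarrow> nat" by (auto simp: le_fun_def)
  have "P.reverse (box M) (P.scale c e) = P.monomial c 0 \<otimes>\<^bsub>A\<^esub> P.reverse (box M) e"
    using P.monomial_mult[of c 0, OF _ _ r] c cR by (auto simp: fun_eq_iff z P.reverse_def P.scale_def)
  then have "value_at (P.reverse (box M) (P.scale c e)) = value_at (P.monomial c 0) \<otimes> value_at (P.reverse (box M) e)"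
    using value_at_mult[OF m r] by simp
  then have "value_at (P.reverse (box M) (P.scale c e)) \<in> powers_ideal M"
    using I.I_l_closed[OF e(4) value_at(1)[OF m]] by simp
  moreover have "P.scale c e \<in> P.dual" using P.dual_scale[of c e] c e by simp
  moreover have "P.scale c e \<nu> = \<zero>" if "\<not> \<nu> \<le> box M" for \<nu>
    using e(3)[OF that] cR by (simp add: P.scale_def)
  ultimately show ?thesis unfolding dead_inverse_def using e(2) by blast
qed

lemma mon_const: "mon (\<lambda>j. if j < i then s else 0) = (\<Otimes>l\<in>{..<i}. x l) [^] s"
proof (induction s)
  case 0
  have "(\<lambda>j. if j < i then 0 else 0) = (0 :: nat \<Rightarrow> nat)" by (simp add: fun_eq_iff)
  then show ?case using mon_0 by simp
next
  case (Suc s)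
  let ?c = "\<lambda>s j. if j < i then s else 0 :: nat"
  have "?c (Suc s) = ?c s + ?c 1" by (simp add: fun_eq_iff)
  then have "mon (?c (Suc s)) = mon (?c s) \<otimes> mon (?c 1)" using mon_add by metis
  also have "mon (?c 1) = (\<Otimes>l\<in>{..<i}. x l)"
    unfolding monomial_value_def using x_R by (intro finprod_cong') auto
  finally show ?case using Suc by simp
qed

lemma powers_ideal_antimono:
  assumes "M \<le> N" shows "powers_ideal N \<subseteq> powers_ideal M"
proof -
  interpret I: ideal "powers_ideal M" R by (rule powers_ideal)
  have "x l [^] N \<in> powers_ideal M" if "l < i" for l
  proof -
    have "x l [^] N = x l [^] M \<otimes> x l [^] (N - M)" using assms x_R by (simp add: nat_pow_mult)
    then show ?thesis using I.I_r_closed[OF powers_ideal_gen[OF that]] x_R by simp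
  qed
  then have "(\<lambda>l. x l [^] N) ` {..<i} \<subseteq> powers_ideal M" by blast
  then show ?thesis unfolding powers_ideal_def[of N] by (rule genideal_minimal[OF powers_ideal])
qed

text \<open>The surviving element is the inverse monomial with denominator
  \<open>(x 0 ... x (i-1))^(n+1)\<close>. If it died in the box of size \<open>n+1+s\<close>, the
  \<open>s\<close>-th power of the product would lie in the corresponding ideal of powers.\<close>

lemma dead_inverse_proper:
  fixes n :: nat
  assumes nz: "\<And>s::nat. (\<Otimes>l\<in>{..<i}. x l) [^] s \<notin> powers_ideal (n + s)"
  shows "dead_inverse \<noteq> P.dual"
proof
  assume eq: "dead_inverse = P.dual"
  let ?e = "P.monomial \<one> (box (Suc n))"
  have "?e \<in> dead_inverse" unfolding eq using P.dual_monomial[OF box_exps, of "Suc n"] by simp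
  then obtain M where M: "M \<ge> 1" "\<And>\<nu>. \<not> \<nu> \<le> box M \<Longrightarrow> ?e \<nu> = \<zero>" "value_at (P.reverse (box M) ?e) \<in> powers_ideal M"
    unfolding dead_inverse_def by blast
  have "\<one> \<noteq> \<zero>" using P.one_not_zero by simp
  then have le: "box (Suc n) \<le> box M" using M(2)[of "box (Suc n)"] by (auto simp: P.monomial_def)
  let ?d = "box M - box (Suc n)"
  have "P.reverse (box M) ?e = P.monomial \<one> ?d"
  proof
    fix \<kappa>
    have "box M - \<kappa> = box (Suc n) \<longleftrightarrow> \<kappa> = ?d" if "\<kappa> \<le> box M"
      using fun_diff_diff_cancel[OF that] fun_diff_diff_cancel[OF le] by metis
    then show "P.reverse (box M) ?e \<kappa> = P.monomial \<one> ?d \<kappa>" by (auto simp: P.reverse_def P.monomial_def)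
  qed
  then have d: "mon ?d \<in> powers_ideal M" using M(3) value_at_monomial[OF exps_diff[OF box_exps]] by simp
  show False
  \<comment> \<open>Without indeterminates all boxes coincide, so \<open>M\<close> cannot be
    compared with \<open>n\<close>; the hypothesis then says directly that one is not in the ideal
    generated by the empty set.\<close>
  proof (cases "i = 0")
    case True
    have "mon ?d = \<one>" using True by (simp add: monomial_value_def)
    moreover have "powers_ideal M = powers_ideal (n + 0)" using True unfolding powers_ideal_def by simp
    ultimately show False using nz[of 0] d by simp
  next
    case False
    then have "Suc n \<le> M" using le_funD[OF le, of 0] M(1) by (auto simp: box_def)
    then obtain s where s: "M = Suc n + s" using le_Suc_ex by blast
    have "?d = (\<lambda>j. if j < i then s else 0)" by (auto simp: fun_eq_iff box_def s)
    then have "(\<Otimes>l\<in>{..<i}. x l) [^] s \<in> powers_ideal M" using d mon_const by simp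
    \<comment> \<open>The index \<open>n+1\<close> of the box is one larger than in the hypothesis,
      which is harmless because the ideals of powers decrease.\<close>
    then show False using nz[of s] powers_ideal_antimono[of "n + s" M] s by auto
  qed
qed

text \<open>The numerator of \<open>act b e\<close> agrees with the product of \<open>b\<close> and
  the numerator of \<open>e\<close> only inside the box, which suffices modulo the ideal of
  powers.\<close>

lemma act_dead_inverse:
  assumes b: "b \<in> carrier A" and e: "e \<in> P.dual" and M: "M \<ge> 1" "\<And>\<nu>. \<not> \<nu> \<le> box M \<Longrightarrow> e \<nu> = \<zero>"
    and v: "value_at (b \<otimes>\<^bsub>A\<^esub> P.reverse (box M) e) \<in> powers_ideal M"
  shows "P.act b e \<in> dead_inverse"
proof -
  note a = P.act_closed[OF b e]
  have "value_at (P.reverse (box M) (P.act b e)) \<in> powers_ideal M"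
  proof (rule value_at_cong_box[OF _ _ M(1) _ v])
    show "b \<otimes>\<^bsub>A\<^esub> P.reverse (box M) e \<in> carrier A" using b reverse_box_closed[OF e] by simp
    show "P.reverse (box M) (P.act b e) \<in> carrier A" by (rule reverse_box_closed[OF a])
    show "(b \<otimes>\<^bsub>A\<^esub> P.reverse (box M) e) \<nu> = P.reverse (box M) (P.act b e) \<nu>" if "\<nu> \<le> box M" for \<nu>
      using P.reverse_act[OF box_exps b e _ that] M(2) by simp
  qed
  moreover have "P.act b e \<nu> = \<zero>" if "\<not> \<nu> \<le> box M" for \<nu>
    using P.act_out[of "box M" e \<nu> b] M(2) that by simp
  ultimately show ?thesis unfolding dead_inverse_def using a M(1) by blast
qed

lemma dual_box:
  assumes "e \<in> P.dual"
  obtains M where "M \<ge> 1" "\<And>\<nu>. \<not> \<nu> \<le> box M \<Longrightarrow> e \<nu> = \<zero>"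
proof -
  obtain T where T: "T \<in> exps i" "\<And>\<nu>. \<not> \<nu> \<le> T \<Longrightarrow> e \<nu> = \<zero>"
    using assms by (rule P.dualE) simp
  obtain M where "M \<ge> 1" "T \<le> box M" using exists_box[OF T(1)] by blast
  then show ?thesis using that T(2) order_trans by metis
qed

section \<open>Consequences of nonvanishing top local cohomology\<close>

context
  fixes n :: nat
  assumes nz: "\<And>s::nat. (\<Otimes>l\<in>{..<i}. x l) [^] s \<notin> powers_ideal (n + s)"
begin

lemma killing_series:
  obtains f where "f \<in> carrier A" "f \<noteq> \<zero>\<^bsub>A\<^esub>" "\<And>e. e \<in> dead_inverse \<Longrightarrow> P.pairing f e = \<zero>"
proof -
  have "\<exists>f\<in>carrier A. f \<noteq> \<zero>\<^bsub>A\<^esub> \<and> (\<forall>w\<in>dead_inverse. P.pairing f w = \<zero>\<^bsub>R\<lparr>carrier := k\<rparr>\<^esub>)"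
  proof (rule P.separating_functional)
    show "dead_inverse \<subseteq> P.dual" by (auto simp: dead_inverse_def)
    show "P.scale c w \<in> dead_inverse" if "c \<in> carrier (R\<lparr>carrier := k\<rparr>)" "w \<in> dead_inverse" for c w
      using dead_inverse_scale that by simp
  qed (use dead_inverse_zero dead_inverse_minus dead_inverse_proper[OF nz] in auto)
  then show ?thesis using that by auto
qed

lemma value_at_inj_zero:
  assumes g: "g \<in> carrier A" "value_at g = \<zero>"
  shows "g = \<zero>\<^bsub>A\<^esub>"
proof -
  obtain f where f: "f \<in> carrier A" "f \<noteq> \<zero>\<^bsub>A\<^esub>" "\<And>e. e \<in> dead_inverse \<Longrightarrow> P.pairing f e = \<zero>"
    using killing_series by blast
  have "P.pairing (f \<otimes>\<^bsub>A\<^esub> g) e = \<zero>\<^bsub>R\<lparr>carrier := k\<rparr>\<^esub>" if e: "e \<in> P.dual" for e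
  proof -
    obtain M where M: "M \<ge> 1" "\<And>\<nu>. \<not> \<nu> \<le> box M \<Longrightarrow> e \<nu> = \<zero>" using dual_box[OF e] by blast
    have "value_at (g \<otimes>\<^bsub>A\<^esub> P.reverse (box M) e) = \<zero>"
      using value_at_mult[OF g(1) reverse_box_closed[OF e]] g(2) value_at(1)[OF reverse_box_closed[OF e]] by simp
    then have "P.act g e \<in> dead_inverse"
      using act_dead_inverse[OF g(1) e M] additive_subgroup.zero_closed[OF ideal.axioms(1)[OF powers_ideal]] by simp
    then show ?thesis using f(3) P.pairing_act[OF f(1) g(1) e] by simp
  qed
  then have "f \<otimes>\<^bsub>A\<^esub> g = \<zero>\<^bsub>A\<^esub>" using f g by (intro P.pairing_zero_imp_zero) auto
  then show ?thesis using P.A.integral[OF _ f(1) g(1)] f(2) by blast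
qed

lemma value_at_inj: "inj_on value_at (carrier A)"
proof (rule inj_onI)
  fix f g assume fg: "f \<in> carrier A" "g \<in> carrier A" "value_at f = value_at g"
  have "value_at (f \<ominus>\<^bsub>A\<^esub> g) = \<zero>"
    using value_at_minus[OF fg(1,2)] fg(3) value_at(1)[OF fg(2)] by (simp add: minus_eq r_neg)
  then have "f \<ominus>\<^bsub>A\<^esub> g = \<zero>\<^bsub>A\<^esub>" using value_at_inj_zero fg by simp
  then show "f = g" using fg by (simp del: P.A_zero)
qed

lemma value_at_divides:
  assumes a: "a \<in> carrier A" and b: "b \<in> carrier A" "b \<noteq> \<zero>\<^bsub>A\<^esub>"
    and r: "r \<in> carrier R" "value_at a = r \<otimes> value_at b"
  shows "\<exists>h\<in>carrier A. a = h \<otimes>\<^bsub>A\<^esub> b"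
proof -
  obtain f where f: "f \<in> carrier A" "f \<noteq> \<zero>\<^bsub>A\<^esub>" "\<And>e. e \<in> dead_inverse \<Longrightarrow> P.pairing f e = \<zero>"
    using killing_series by blast
  show ?thesis
  proof (rule P.almost_integral_divides[OF f(1,2) a b])
    fix s :: nat
    have as: "a [^]\<^bsub>A\<^esub> s \<in> carrier A" and bs: "b [^]\<^bsub>A\<^esub> s \<in> carrier A" using a b by auto
    have bs0: "b [^]\<^bsub>A\<^esub> s \<noteq> \<zero>\<^bsub>A\<^esub>"
    proof (induction s)
      case 0
      then show ?case using P.A.one_not_zero by (simp del: P.A_zero)
    next
      case (Suc s)
      then show ?case using P.A.integral[of "b [^]\<^bsub>A\<^esub> s" b] b by (auto simp del: P.A_zero)
    qed
    have vs: "value_at (a [^]\<^bsub>A\<^esub> s) = r [^] s \<otimes> value_at (b [^]\<^bsub>A\<^esub> s)"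
    proof -
      have vp: "value_at (g [^]\<^bsub>A\<^esub> s) = value_at g [^] s" if "g \<in> carrier A" for g
        using that value_at_one value_at_mult by (induction s) auto
      show ?thesis unfolding vp[OF a] vp[OF b(1)] r(2) using r(1) value_at(1)[OF b(1)] by (simp add: nat_pow_distrib)
    qed
    have "\<exists>h\<in>carrier A. f \<otimes>\<^bsub>A\<^esub> a [^]\<^bsub>A\<^esub> s = h \<otimes>\<^bsub>A\<^esub> b [^]\<^bsub>A\<^esub> s"
    proof (rule P.divides_if_annihilator[OF bs bs0])
      show "f \<otimes>\<^bsub>A\<^esub> a [^]\<^bsub>A\<^esub> s \<in> carrier A" using f as by simp
      fix e assume e: "e \<in> P.dual" and be: "P.act (b [^]\<^bsub>A\<^esub> s) e = \<zero>\<^bsub>A\<^esub>"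
      obtain M where M: "M \<ge> 1" "\<And>\<nu>. \<not> \<nu> \<le> box M \<Longrightarrow> e \<nu> = \<zero>" using dual_box[OF e] by blast
      let ?e = "P.reverse (box M) e"
      have eA: "?e \<in> carrier A" by (rule reverse_box_closed[OF e])
      interpret I: ideal "powers_ideal M" R by (rule powers_ideal)
      \<comment> \<open>As \<open>b^s\<close> annihilates \<open>e\<close>, its product with the
        numerator of \<open>e\<close> has no terms in the box. The value is therefore in the ideal
        of powers and stays there after multiplication by \<open>r^s\<close>, which turns
        \<open>b^s\<close> into \<open>a^s\<close>.\<close>
      have "value_at (b [^]\<^bsub>A\<^esub> s \<otimes>\<^bsub>A\<^esub> ?e) \<in> powers_ideal M"
      proof (rule value_at_cong_box[OF P.A.zero_closed _ M(1)])
        show "b [^]\<^bsub>A\<^esub> s \<otimes>\<^bsub>A\<^esub> ?e \<in> carrier A" using bs eA by simp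
        show "value_at \<zero>\<^bsub>A\<^esub> \<in> powers_ideal M" unfolding value_at_zero by simp
        show "\<zero>\<^bsub>A\<^esub> \<nu> = (b [^]\<^bsub>A\<^esub> s \<otimes>\<^bsub>A\<^esub> ?e) \<nu>" if "\<nu> \<le> box M" for \<nu>
          using P.reverse_act[OF box_exps bs e _ that] M(2) that by (simp add: be P.reverse_def)
      qed
      then have "r [^] s \<otimes> (value_at (b [^]\<^bsub>A\<^esub> s) \<otimes> value_at ?e) \<in> powers_ideal M"
        unfolding value_at_mult[OF bs eA] by (rule I.I_l_closed[OF _ nat_pow_closed[OF r(1)]])
      then have "value_at (a [^]\<^bsub>A\<^esub> s \<otimes>\<^bsub>A\<^esub> ?e) \<in> powers_ideal M"
        unfolding value_at_mult[OF as eA] vs using r(1) value_at(1)[OF bs] value_at(1)[OF eA] by (simp add: m_assoc)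
      then have "P.act (a [^]\<^bsub>A\<^esub> s) e \<in> dead_inverse" using act_dead_inverse[OF as e M(1)] M(2) by blast
      then show "P.pairing (f \<otimes>\<^bsub>A\<^esub> a [^]\<^bsub>A\<^esub> s) e = \<zero>\<^bsub>R\<lparr>carrier := k\<rparr>\<^esub>"
        using f(3) P.pairing_act[OF f(1) as e] by simp
    qed
    then show "\<exists>h\<in>carrier A. f \<otimes>\<^bsub>A\<^esub> a [^]\<^bsub>A\<^esub> s = h \<otimes>\<^bsub>A\<^esub> b [^]\<^bsub>A\<^esub> s" .
  qed
qed

end

section \<open>Comparison with the subring of power series\<close>

text \<open>Restriction to the first \<open>i\<close> indices is a bijection from zero-extended
  exponents to extensional ones; it preserves degrees and monomials.\<close>

lemma truncation_value_eq:
  assumes f: "f \<in> carrier A" and f': "\<And>\<nu>. \<nu> \<in> exps i \<Longrightarrow> f' (restrict \<nu> {..<i}) = f \<nu>"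
  shows "truncation_value R i x f' = trunc f"
proof
  fix N
  let ?h = "\<lambda>\<nu> :: nat \<Rightarrow> nat. restrict \<nu> {..<i}"
  have im: "{\<nu> \<in> exponents i. (\<Sum>j<i. \<nu> j) < N} = ?h ` low_exps i N"
  proof (intro equalityI subsetI)
    fix \<nu> assume \<nu>: "\<nu> \<in> {\<nu> \<in> exponents i. (\<Sum>j<i. \<nu> j) < N}"
    let ?\<mu> = "\<lambda>j. if j < i then \<nu> j else 0"
    have "?\<mu> \<in> low_exps i N" using \<nu> by (auto simp: low_exps_def exps_def exp_degree_def)
    moreover have "\<nu> = ?h ?\<mu>" using \<nu> by (auto simp: exponents_def fun_eq_iff PiE_def extensional_def)
    ultimately show "\<nu> \<in> ?h ` low_exps i N" by blast
  next
    fix \<nu> assume "\<nu> \<in> ?h ` low_exps i N"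
    then obtain \<mu> where \<mu>: "\<mu> \<in> low_exps i N" "\<nu> = ?h \<mu>" by blast
    have "?h \<mu> \<in> exponents i" by (simp add: exponents_def)
    then show "\<nu> \<in> {\<nu> \<in> exponents i. (\<Sum>j<i. \<nu> j) < N}" using \<mu> by (simp add: low_exps_def exp_degree_def)
  qed
  have inj: "inj_on ?h (low_exps i N)"
  proof (rule inj_onI)
    fix \<nu> \<mu> assume a: "\<nu> \<in> low_exps i N" "\<mu> \<in> low_exps i N" "?h \<nu> = ?h \<mu>"
    show "\<nu> = \<mu>"
    proof
      fix j show "\<nu> j = \<mu> j"
        using a(1,2) fun_cong[OF a(3), of j] by (cases "j < i") (auto simp: low_exps_def exps_def)
    qed
  qed
  have mv: "monomial_value R i x (?h \<nu>) = mon \<nu>" for \<nu>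
    unfolding monomial_value_def using x_R by (intro finprod_cong') auto
  have t: "f' (?h \<nu>) \<otimes> monomial_value R i x (?h \<nu>) = f \<nu> \<otimes> mon \<nu>" if "\<nu> \<in> low_exps i N" for \<nu>
    using that f' mv by (simp add: low_exps_def)
  have "truncation_value R i x f' N = (\<Oplus>\<nu>\<in>low_exps i N. f' (?h \<nu>) \<otimes> monomial_value R i x (?h \<nu>))"
    unfolding truncation_value_def im using inj t term_closed[OF f] by (intro finsum_reindex) auto
  also have "\<dots> = trunc f N"
    unfolding trunc_def using t term_closed[OF f] by (intro finsum_cong') auto
  finally show "truncation_value R i x f' N = trunc f N" .
qed

lemma power_series_subring_eq: "power_series_subring R \<mm> k i x = value_at ` carrier A"
proof (intro equalityI subsetI)
  fix r assume "r \<in> power_series_subring R \<mm> k i x"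
  then obtain f' where r: "r \<in> carrier R" and f': "f' \<in> exponents i \<rightarrow> k" "adic_limit R \<mm> (truncation_value R i x f') r"
    by (auto simp: power_series_subring_def)
  define f where "f \<nu> = (if \<nu> \<in> exps i then f' (restrict \<nu> {..<i}) else \<zero>)" for \<nu>
  have "restrict \<nu> {..<i} \<in> exponents i" for \<nu> :: "nat \<Rightarrow> nat" by (simp add: exponents_def)
  then have f: "f \<in> carrier A" using f'(1) by (intro P.A_carrierI) (auto simp: f_def)
  have "truncation_value R i x f' = trunc f" by (rule truncation_value_eq[OF f]) (simp add: f_def)
  then have "value_at f = r" using f'(2) limit_iff[OF f r] by (intro value_at_eqI[OF f r]) auto
  then show "r \<in> value_at ` carrier A" using f by blast
next
  fix r assume "r \<in> value_at ` carrier A"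
  then obtain f where f: "f \<in> carrier A" "r = value_at f" by blast
  \<comment> \<open>The inverse translation: an extensional exponent is read off on the first
    \<open>i\<close> indices and continued by zero.\<close>
  define f' where "f' \<nu> = f (\<lambda>j. if j < i then \<nu> j else 0)" for \<nu>
  have f'k: "f' \<in> exponents i \<rightarrow> k" using coeff_k[OF f(1)] by (auto simp: f'_def)
  have "truncation_value R i x f' = trunc f"
  proof (rule truncation_value_eq[OF f(1)])
    fix \<nu> assume "\<nu> \<in> exps i"
    then have "(\<lambda>j. if j < i then restrict \<nu> {..<i} j else 0) = \<nu>" by (auto simp: fun_eq_iff exps_def)
    then show "f' (restrict \<nu> {..<i}) = f \<nu>" by (simp add: f'_def)
  qed
  then have "adic_limit R \<mm> (truncation_value R i x f') r"
    using limit_iff[OF f(1) value_at(1)[OF f(1)]] value_at(2)[OF f(1)] f(2) by simp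
  then show "r \<in> power_series_subring R \<mm> k i x"
    unfolding power_series_subring_def using f'k value_at(1)[OF f(1)] f(2) by blast
qed

end

section \<open>Krull dimension\<close>

lemma ring_iso_primeideal:
  assumes A: "cring A" and B: "cring B" and h: "h \<in> ring_iso A B" and p: "primeideal p A"
  shows "primeideal (h ` p) B"
proof -
  interpret A: cring A by fact
  interpret B: cring B by fact
  interpret p: primeideal p A by fact
  have hom: "h \<in> ring_hom A B" and bij: "bij_betw h (carrier A) (carrier B)" using h by (auto simp: ring_iso_def)
  interpret h: ring_hom_cring A B h using hom A B by (intro ring_hom_cringI) auto
  have surj: "\<exists>a\<in>carrier A. b = h a" if "b \<in> carrier B" for b
    using that bij by (auto simp: bij_betw_def)
  have inj: "a = a'" if "a \<in> carrier A" "a' \<in> carrier A" "h a = h a'" for a a'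
    using that bij by (auto simp: bij_betw_def inj_on_def)
  have mem: "h a \<in> h ` p \<longleftrightarrow> a \<in> p" if "a \<in> carrier A" for a
    using inj[OF that] p.Icarr by (metis imageE imageI)
  show ?thesis
  proof (rule primeidealI[OF _ B])
    show "ideal (h ` p) B"
    proof (rule idealI[OF B.ring_axioms])
      show "subgroup (h ` p) (add_monoid B)"
      proof (rule B.add.subgroupI)
        show "h ` p \<subseteq> carrier B" using p.Icarr by auto
        show "h ` p \<noteq> {}" using p.zero_closed by blast
        fix a assume "a \<in> h ` p"
        then obtain u where u: "u \<in> p" "a = h u" by blast
        have "\<ominus>\<^bsub>B\<^esub> a = h (\<ominus>\<^bsub>A\<^esub> u)" using u p.Icarr by simp
        then show "\<ominus>\<^bsub>B\<^esub> a \<in> h ` p" using imageI[OF p.a_inv_closed[OF u(1)], of h] by (simp only:)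
        fix b assume "b \<in> h ` p"
        then obtain v where v: "v \<in> p" "b = h v" by blast
        then have "a \<oplus>\<^bsub>B\<^esub> b = h (u \<oplus>\<^bsub>A\<^esub> v)" using u p.Icarr by simp
        then show "a \<oplus>\<^bsub>B\<^esub> b \<in> h ` p" using imageI[OF p.a_closed[OF u(1) v(1)], of h] by (simp only:)
      qed
    next
      fix a r assume "a \<in> h ` p" "r \<in> carrier B"
      then obtain u s where u: "u \<in> p" "a = h u" "s \<in> carrier A" "r = h s" using surj by blast
      then have e: "r \<otimes>\<^bsub>B\<^esub> a = h (s \<otimes>\<^bsub>A\<^esub> u)" "a \<otimes>\<^bsub>B\<^esub> r = h (u \<otimes>\<^bsub>A\<^esub> s)" using p.Icarr by simp_all
      show "r \<otimes>\<^bsub>B\<^esub> a \<in> h ` p" unfolding e(1) using u p.I_l_closed by blast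
      show "a \<otimes>\<^bsub>B\<^esub> r \<in> h ` p" unfolding e(2) using u p.I_r_closed by blast
    qed
    show "carrier B \<noteq> h ` p"
    proof
      assume eq: "carrier B = h ` p"
      have "carrier A \<subseteq> p"
      proof
        fix a assume a: "a \<in> carrier A"
        then have "h a \<in> h ` p" unfolding eq[symmetric] by simp
        then show "a \<in> p" using mem[OF a] by blast
      qed
      then show False using p.I_notcarr p.a_subset by blast
    qed
    fix a b assume ab: "a \<in> carrier B" "b \<in> carrier B" "a \<otimes>\<^bsub>B\<^esub> b \<in> h ` p"
    obtain u where u: "u \<in> carrier A" "a = h u" using surj[OF ab(1)] by blast
    obtain v where v: "v \<in> carrier A" "b = h v" using surj[OF ab(2)] by blast
    have "h (u \<otimes>\<^bsub>A\<^esub> v) \<in> h ` p" using ab(3) u v by simp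
    then have "u \<otimes>\<^bsub>A\<^esub> v \<in> p" using mem u v by blast
    then show "a \<in> h ` p \<or> b \<in> h ` p" using p.I_prime[OF u(1) v(1)] u v by blast
  qed
qed

lemma ring_iso_krull_dim_le:
  assumes A: "cring A" and B: "cring B" and h: "h \<in> ring_iso A B"
  shows "krull_dim A \<le> krull_dim B"
  unfolding krull_dim_def
proof (rule Sup_subset_mono, safe)
  fix n :: nat and p assume p: "\<forall>j\<le>n. primeideal (p j) A" "\<forall>j<n. p j \<subset> p (Suc j)"
  have inj: "inj_on h (carrier A)" using h by (auto simp: ring_iso_def bij_betw_def)
  have "h ` p j \<subset> h ` p (Suc j)" if "j < n" for j
  proof -
    have "primeideal (p (Suc j)) A" using p(1) that by simp
    then have "p (Suc j) \<subseteq> carrier A" using additive_subgroup.a_subset[OF ideal.axioms(1)[OF primeideal.axioms(1)]] by blast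
    then show ?thesis using p(2) that inj_on_subset[OF inj] by (intro image_strict_mono) auto
  qed
  moreover have "primeideal (h ` p j) B" if "j \<le> n" for j
    using ring_iso_primeideal[OF A B h] p(1) that by blast
  ultimately have "\<exists>p. (\<forall>j\<le>n. primeideal (p j) B) \<and> (\<forall>j<n. p j \<subset> p (Suc j))"
    by (intro exI[of _ "\<lambda>j. h ` p j"]) blast
  then show "\<exists>n'. enat n = enat n' \<and> (\<exists>p. (\<forall>j\<le>n'. primeideal (p j) B) \<and> (\<forall>j<n'. p j \<subset> p (Suc j)))" by blast
qed

text \<open>The coordinate primes form a chain of length \<open>i\<close>, so the supremum is
  attained.\<close>

lemma (in field_power_series) krull_dim_power_series: "krull_dim A = enat i"
  unfolding krull_dim_def
proof (rule antisym[OF Sup_least Sup_upper])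
  fix d assume "d \<in> {enat n |n. \<exists>p. (\<forall>j\<le>n. primeideal (p j) A) \<and> (\<forall>j<n. p j \<subset> p (Suc j))}"
  then obtain n p where "d = enat n" "\<forall>j\<le>n. primeideal (p j) A" "\<forall>j<n. p j \<subset> p (Suc j)" by blast
  then show "d \<le> enat i" using prime_chain_length[of n p] by simp
next
  show "enat i \<in> {enat n |n. \<exists>p. (\<forall>j\<le>n. primeideal (p j) A) \<and> (\<forall>j<n. p j \<subset> p (Suc j))}"
    using coord_prime_primeideal coord_prime_strict by blast
qed

theorem theorem3p1:
  fixes R :: "('a, 'r) ring_scheme"
    and \<mm> k :: "'a set"
    and i :: nat
    and x :: "nat \<Rightarrow> 'a"
    and E :: "nat \<Rightarrow> ('a, 'e) module"
    and \<epsilon> :: "'a \<Rightarrow> 'e"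
    and d :: "nat \<Rightarrow> 'e \<Rightarrow> 'e"
    and Q :: "('q, 's) ring_scheme"
    and \<iota> :: "'a \<Rightarrow> 'q"
  defines "I \<equiv> genideal R (x ` {..<i})"
    and "R\<^sub>0 \<equiv> power_series_subring R \<mm> k i x"
  assumes "noetherian_domain R"
    and "local_ring R \<mm>"
    and "adic_complete R \<mm>"
    and "subfield k R"
    and "\<And>j. j < i \<Longrightarrow> x j \<in> \<mm>"
    and "quotient_field R Q \<iota>"
    and "injective_resolution R (ring_module R) E \<epsilon> d"
    and "carrier (local_cohomology R I E d i) \<noteq> {\<zero>\<^bsub>local_cohomology R I E d i\<^esub>}"
  shows "krull_dim (R\<lparr>carrier := R\<^sub>0\<rparr>) = enat i \<and>
    \<iota> ` carrier R \<inter> fractions Q (\<iota> ` R\<^sub>0) = \<iota> ` R\<^sub>0"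
proof -
  interpret R: noetherian_domain R by fact
  have m: "ideal \<mm> R" using \<open>local_ring R \<mm>\<close> by (simp add: local_ring_def maximalideal_def)
  \<comment> \<open>Nothing is known about \<open>x j\<close> for \<open>j \<ge> i\<close>.
    Replacing these members by zero puts the whole sequence into the maximal ideal without affecting
    the ideal \<open>I\<close> or the monomials.\<close>
  define x' where "x' j = (if j < i then x j else \<zero>\<^bsub>R\<^esub>)" for j
  have x'_m: "x' j \<in> \<mm>" for j
    using \<open>\<And>j. j < i \<Longrightarrow> x j \<in> \<mm>\<close> additive_subgroup.zero_closed[OF ideal.axioms(1)[OF m]] by (simp add: x'_def)
  have x'_R: "x' j \<in> carrier R" for j using ideal.Icarr[OF m x'_m] .
  interpret res: resolved_ring R E \<epsilon> d x'
    by (intro resolved_ring.intro resolved_ring_axioms.intro R.noetherian_ring_axioms R.is_cring x'_R)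
      (rule \<open>injective_resolution R (ring_module R) E \<epsilon> d\<close>)
  have "I = genideal R (x' ` {..<i})" unfolding I_def by (rule arg_cong[of _ _ "genideal R"]) (auto simp: x'_def)
  then obtain n where nz: "\<And>s::nat. (\<Otimes>\<^bsub>R\<^esub>l\<in>{..<i}. x' l) [^]\<^bsub>R\<^esub> s \<notin> genideal R ((\<lambda>l. x' l [^]\<^bsub>R\<^esub> (n + s)) ` {..<i})"
    using res.local_cohomology_nonzero[of i]
      \<open>carrier (local_cohomology R I E d i) \<noteq> {\<zero>\<^bsub>local_cohomology R I E d i\<^esub>}\<close> by metis
  interpret ev: evaluation R \<mm> k i x'
    using m x'_m \<open>adic_complete R \<mm>\<close> \<open>subfield k R\<close>
    by (intro evaluation.intro evaluation_axioms.intro R.is_cring)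
  have nz': "(\<Otimes>\<^bsub>R\<^esub>l\<in>{..<i}. x' l) [^]\<^bsub>R\<^esub> s \<notin> ev.powers_ideal (n + s)" for s :: nat
    using nz[of s] by (simp add: ev.powers_ideal_def)
  have "monomial_value R i x = monomial_value R i x'"
    unfolding monomial_value_def using x'_R by (intro ext R.finprod_cong') (auto simp: x'_def)
  then have R\<^sub>0_eq: "R\<^sub>0 = ev.value_at ` carrier ev.A"
    unfolding R\<^sub>0_def ev.power_series_subring_eq[symmetric] power_series_subring_def truncation_value_def by simp
  have "ring_hom_ring ev.A R ev.value_at"
    using ev.value_at_hom ev.P.A.ring_axioms R.ring_axioms by (intro ring_hom_ringI2)
  then have "subring R\<^sub>0 R"
    unfolding R\<^sub>0_eq by (rule ring_hom_ring.img_is_subring[OF _ ev.P.A.carrier_is_subring])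
  then have R\<^sub>0: "cring (R\<lparr>carrier := R\<^sub>0\<rparr>)" "R\<^sub>0 \<subseteq> carrier R" "\<one>\<^bsub>R\<^esub> \<in> R\<^sub>0"
    using R.subcring_iff[OF subringE(1)] R.subcringI' subringE(1,3) by blast+
  \<comment> \<open>Surjectivity is the description of \<open>R\<^sub>0\<close> as an image;
    injectivity comes from nonvanishing local cohomology.\<close>
  have "ev.value_at \<in> ring_iso ev.A (R\<lparr>carrier := R\<^sub>0\<rparr>)"
    using ev.value_at_mult ev.value_at_add ev.value_at_one ev.value_at_inj[OF nz']
    by (intro ring_iso_memI) (auto simp: R\<^sub>0_eq bij_betw_def simp del: ev.P.A_add)
  then have "krull_dim (R\<lparr>carrier := R\<^sub>0\<rparr>) = krull_dim ev.A"
    using ring_iso_krull_dim_le[OF ev.P.A_cring R\<^sub>0(1)] ring_iso_krull_dim_le[OF R\<^sub>0(1) ev.P.A_cring]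
      ring_iso_set_sym[OF ev.P.A.ring_axioms] by (metis antisym)
  then have dim: "krull_dim (R\<lparr>carrier := R\<^sub>0\<rparr>) = enat i" using ev.P.krull_dim_power_series by simp
  have Q: "field Q" "\<iota> \<in> ring_hom R Q" "inj_on \<iota> (carrier R)"
    using \<open>quotient_field R Q \<iota>\<close> by (auto simp: quotient_field_def)
  interpret Q: field Q by (rule Q(1))
  interpret \<iota>: ring_hom_cring R Q \<iota> using Q(2) R.is_cring Q.is_cring by (intro ring_hom_cringI) auto
  have "\<iota> r \<in> \<iota> ` R\<^sub>0" if r: "r \<in> carrier R" "\<iota> r \<in> fractions Q (\<iota> ` R\<^sub>0)" for r
  proof -
    obtain u v where uv: "u \<in> R\<^sub>0" "v \<in> R\<^sub>0" "\<iota> v \<noteq> \<zero>\<^bsub>Q\<^esub>" "\<iota> r = \<iota> u \<otimes>\<^bsub>Q\<^esub> inv\<^bsub>Q\<^esub> \<iota> v"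
      using r(2) by (auto simp: fractions_def)
    obtain a b where ab: "a \<in> carrier ev.A" "u = ev.value_at a" "b \<in> carrier ev.A" "v = ev.value_at b"
      using uv(1,2) unfolding R\<^sub>0_eq by blast
    have c: "u \<in> carrier R" "v \<in> carrier R" using uv R\<^sub>0(2) by auto
    have vU: "\<iota> v \<in> Units Q" using uv(3) c Q.field_Units by auto
    \<comment> \<open>The equation of fractions is cleared of its denominator and pulled back along
      the injective \<open>\<iota>\<close>, so that divisibility can be decided in the power series
      ring.\<close>
    have "\<iota> r \<otimes>\<^bsub>Q\<^esub> \<iota> v = \<iota> u" unfolding uv(4) using c vU by (simp add: Q.m_assoc)
    then have "\<iota> (r \<otimes>\<^bsub>R\<^esub> v) = \<iota> u" using r(1) c by simp
    from inj_onD[OF Q(3) this] have rv: "u = r \<otimes>\<^bsub>R\<^esub> v" using r(1) c by simp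
    have v0: "v \<noteq> \<zero>\<^bsub>R\<^esub>" using uv(3) by auto
    then have "b \<noteq> \<zero>\<^bsub>ev.A\<^esub>" using ab(4) ev.value_at_zero by metis
    then obtain h where h: "h \<in> carrier ev.A" "a = h \<otimes>\<^bsub>ev.A\<^esub> b"
      using ev.value_at_divides[OF nz' ab(1,3) _ r(1)] rv ab by metis
    then have "r \<otimes>\<^bsub>R\<^esub> v = ev.value_at h \<otimes>\<^bsub>R\<^esub> v" using rv ab ev.value_at_mult by metis
    then have "r = ev.value_at h" using R.m_rcancel[OF v0 c(2) r(1) ev.value_at(1)[OF h(1)]] by simp
    then show ?thesis unfolding R\<^sub>0_eq using h(1) by blast
  qed
  moreover have "\<iota> r \<in> fractions Q (\<iota> ` R\<^sub>0)" if r: "r \<in> R\<^sub>0" for r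
  proof -
    \<comment> \<open>For the easy inclusion an element of \<open>R\<^sub>0\<close> is a fraction
      with denominator one.\<close>
    have "\<iota> r = \<iota> r \<otimes>\<^bsub>Q\<^esub> inv\<^bsub>Q\<^esub> \<iota> \<one>\<^bsub>R\<^esub>" using r R\<^sub>0(2) by auto
    moreover have "\<iota> \<one>\<^bsub>R\<^esub> \<noteq> \<zero>\<^bsub>Q\<^esub>" by simp
    ultimately show ?thesis unfolding fractions_def using r R\<^sub>0(3) by blast
  qed
  ultimately have "\<iota> ` carrier R \<inter> fractions Q (\<iota> ` R\<^sub>0) = \<iota> ` R\<^sub>0" using R\<^sub>0(2) by blast
  with dim show ?thesis by blast
qed

end
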